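(* Let $\kappa>0$, $r=1/\kappa$, and let $x,y\in\mathbb{R}^2$ with $0<\|x-y\|<2r$. Then the set of all $\sigma\in\Sigma(x,y)$ that are not in $\mathrm{cl}(\mathcal{I})$ is a homotopy class in $\Sigma(x,y)$ (a single equivalence class under $\kappa$-constrained homotopy).
   Context: Fix $\kappa>0$ and put $r=1/\kappa$. A $\kappa$-constrained plane curve is an arc-length parametrised curve $\sigma:[0,s]\to\mathbb{R}^2$ ($s>0$) which is $C^1$ and piecewise $C^2$ and satisfies $\|\sigma''(t)\|\le\kappa$ wherever $\sigma''(t)$ is defined. For $x,y\in\mathbb{R}^2$, $\Sigma(x,y)$ is the set of $\kappa$-constrained plane curves with $\sigma(0)=x$ and $\sigma(s)=y$; the length $s$ and the initial and final tangent vectors are not prescribed. $\Sigma(x,y)$ carries the $C^1$ metric: curves of different lengths are compared after rescaling their arc-length parametrisations linearly to $[0,1]$, using uniform distance of the curves and of their first derivatives. A $\kappa$-constrained homotopy between $\sigma,\gamma\in\Sigma(x,y)$ is a continuous map $H:[0,1]\to\Sigma(x,y)$ with $H(0)=\sigma$ and $H(1)=\gamma$. Two curves are $\kappa$-constrained homotopic if such an $H$ exists; the equivalence classes (path components) are called homotopy classes. For $0<\|x-y\|<2r$ let $D_1,D_2$ be the two closed disks of radius $r$ with boundary circles $C_1=\partial D_1$, $C_2=\partial D_2$ such that $C_1\cap C_2=\{x,y\}$, and set $\mathcal{I}=\mathrm{int}(D_1\cap D_2)$. A curve $\sigma$ is "not in $X$" if there exists $t$ with $\sigma(t)\notin X$.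 *)

theory Defs
  imports "HOL-Analysis.Analysis"
begin

text \<open>Derivative of \<open>f\<close> as a function on the closed interval \<open>{a..b}\<close>, hence one-sided at the end
  points. It is meaningful only where \<open>f\<close> is differentiable within \<open>{a..b}\<close>.\<close>

definition ivl_deriv :: "real \<Rightarrow> real \<Rightarrow> (real \<Rightarrow> 'a::real_normed_vector) \<Rightarrow> real \<Rightarrow> 'a" where
  "ivl_deriv a b f t = vector_derivative f (at t within {a..b})"

definition C1_on_ivl :: "real \<Rightarrow> real \<Rightarrow> (real \<Rightarrow> 'a::real_normed_vector) \<Rightarrow> bool" where
  "C1_on_ivl a b f \<longleftrightarrow> f differentiable_on {a..b} \<and> continuous_on {a..b} (ivl_deriv a b f)"

definition C2_on_ivl :: "real \<Rightarrow> real \<Rightarrow> (real \<Rightarrow> 'a::real_normed_vector) \<Rightarrow> bool" where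
  "C2_on_ivl a b f \<longleftrightarrow> C1_on_ivl a b f \<and> C1_on_ivl a b (ivl_deriv a b f)"

text \<open>The pieces are closed, so the second derivative has one-sided limits at the break points.\<close>

definition piecewise_C2_on_ivl :: "real \<Rightarrow> real \<Rightarrow> (real \<Rightarrow> 'a::real_normed_vector) \<Rightarrow> bool" where
  "piecewise_C2_on_ivl a b f \<longleftrightarrow>
     (\<exists>(n::nat) p. p 0 = a \<and> p n = b \<and>
        (\<forall>i<n. p i < p (Suc i) \<and> C2_on_ivl (p i) (p (Suc i)) f))"

text \<open>A curve is a pair \<open>(s, f)\<close> of its length and its arc-length parametrisation on \<open>{0..s}\<close>.
  The map is \<open>extensional\<close>, so that a curve is determined by its values on \<open>{0..s}\<close>.\<close>

type_synonym curve = "real \<times> (real \<Rightarrow> real^2)"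

definition constrained_curve :: "real \<Rightarrow> curve \<Rightarrow> bool" where
  "constrained_curve \<kappa> = (\<lambda>(s, f).
     0 < s \<and> f \<in> extensional {0..s} \<and>
     C1_on_ivl 0 s f \<and> piecewise_C2_on_ivl 0 s f \<and>
     (\<forall>t\<in>{0..s}. norm (ivl_deriv 0 s f t) = 1) \<and>
     (\<forall>t\<in>{0..s}. ivl_deriv 0 s f differentiable (at t within {0..s}) \<longrightarrow>
        norm (ivl_deriv 0 s (ivl_deriv 0 s f) t) \<le> \<kappa>))"

definition constrained_curves :: "real \<Rightarrow> real^2 \<Rightarrow> real^2 \<Rightarrow> curve set" where
  "constrained_curves \<kappa> x y =
     {(s, f). constrained_curve \<kappa> (s, f) \<and> f 0 = x \<and> f s = y}"

definition unit_param :: "curve \<Rightarrow> real \<Rightarrow> real^2" where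
  "unit_param = (\<lambda>(s, f) u. f (s * u))"

text \<open>Off the set of constrained curves the distance is \<open>0\<close>, because \<open>Metric_space\<close> asks for
  nonnegativity and symmetry for arbitrary arguments.\<close>

definition C1_dist :: "real \<Rightarrow> real^2 \<Rightarrow> real^2 \<Rightarrow> curve \<Rightarrow> curve \<Rightarrow> real" where
  "C1_dist \<kappa> x y \<sigma> \<gamma> =
     (if \<sigma> \<in> constrained_curves \<kappa> x y \<and> \<gamma> \<in> constrained_curves \<kappa> x y
      then (SUP u\<in>{0..1}. dist (unit_param \<sigma> u) (unit_param \<gamma> u)) +
           (SUP u\<in>{0..1}. dist (ivl_deriv 0 1 (unit_param \<sigma>) u) (ivl_deriv 0 1 (unit_param \<gamma>) u))
      else 0)"

definition curve_topology :: "real \<Rightarrow> real^2 \<Rightarrow> real^2 \<Rightarrow> curve topology" where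
  "curve_topology \<kappa> x y =
     Metric_space.mtopology (constrained_curves \<kappa> x y) (C1_dist \<kappa> x y)"

definition constrained_homotopic :: "real \<Rightarrow> real^2 \<Rightarrow> real^2 \<Rightarrow> curve \<Rightarrow> curve \<Rightarrow> bool" where
  "constrained_homotopic \<kappa> x y \<sigma> \<gamma> \<longleftrightarrow>
     (\<exists>H. pathin (curve_topology \<kappa> x y) H \<and> H 0 = \<sigma> \<and> H 1 = \<gamma>)"

definition homotopy_classes :: "real \<Rightarrow> real^2 \<Rightarrow> real^2 \<Rightarrow> curve set set" where
  "homotopy_classes \<kappa> x y =
     constrained_curves \<kappa> x y // {(\<sigma>, \<gamma>). constrained_homotopic \<kappa> x y \<sigma> \<gamma>}"

definition not_in :: "curve \<Rightarrow> (real^2) set \<Rightarrow> bool" where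
  "not_in = (\<lambda>(s, f) X. \<exists>t\<in>{0..s}. f t \<notin> X)"


lemma unit_param_has_deriv:
  assumes "\<sigma> \<in> constrained_curves \<kappa> x y" "u \<in> {0..1}"
  shows "(unit_param \<sigma> has_vector_derivative
           fst \<sigma> *\<^sub>R ivl_deriv 0 (fst \<sigma>) (snd \<sigma>) (fst \<sigma> * u)) (at u within {0..1})"
proof -
  obtain s f where \<sigma>: "\<sigma> = (s, f)" by force
  have s: "0 < s" and diff: "f differentiable_on {0..s}"
    using assms by (auto simp: \<sigma> constrained_curves_def constrained_curve_def C1_on_ivl_def)
  have im: "(\<lambda>u. s * u) ` {0..1} = {0..s}"
    using s by (simp add: image_mult_atLeastAtMost)
  have su: "s * u \<in> {0..s}" using im assms(2) by blast
  have "(f has_vector_derivative ivl_deriv 0 s f (s * u)) (at (s * u) within {0..s})"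
    unfolding ivl_deriv_def
    using diff su by (simp add: differentiable_on_def flip: vector_derivative_works)
  moreover have "((\<lambda>u. s * u) has_vector_derivative s) (at u within {0..1})"
    by (auto intro!: derivative_eq_intros)
  ultimately have "((f \<circ> (\<lambda>u. s * u)) has_vector_derivative s *\<^sub>R ivl_deriv 0 s f (s * u))
      (at u within {0..1})"
    by (intro vector_diff_chain_within) (simp_all add: im)
  then show ?thesis by (simp add: \<sigma> unit_param_def o_def)
qed

lemma ivl_deriv_unit_param:
  assumes "\<sigma> \<in> constrained_curves \<kappa> x y" "u \<in> {0..1}"
  shows "ivl_deriv 0 1 (unit_param \<sigma>) u = fst \<sigma> *\<^sub>R ivl_deriv 0 (fst \<sigma>) (snd \<sigma>) (fst \<sigma> * u)"
  unfolding ivl_deriv_def[of 0 1]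
  using vector_derivative_within_closed_interval[OF _ assms(2) unit_param_has_deriv[OF assms]]
  by simp

lemma norm_ivl_deriv_unit_param:
  assumes "\<sigma> \<in> constrained_curves \<kappa> x y" "u \<in> {0..1}"
  shows "norm (ivl_deriv 0 1 (unit_param \<sigma>) u) = fst \<sigma>"
proof -
  obtain s f where \<sigma>: "\<sigma> = (s, f)" by force
  have "s > 0" "\<forall>t\<in>{0..s}. norm (ivl_deriv 0 s f t) = 1"
    using assms(1) by (auto simp: \<sigma> constrained_curves_def constrained_curve_def)
  then show ?thesis
    using assms(2) unfolding ivl_deriv_unit_param[OF assms] by (simp add: \<sigma> mult_left_le)
qed

lemma continuous_on_unit_param:
  assumes "\<sigma> \<in> constrained_curves \<kappa> x y"
  shows "continuous_on {0..1} (unit_param \<sigma>)"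
  using unit_param_has_deriv[OF assms]
  by (meson continuous_on_eq_continuous_within has_vector_derivative_continuous)

lemma continuous_on_deriv_unit_param:
  assumes "\<sigma> \<in> constrained_curves \<kappa> x y"
  shows "continuous_on {0..1} (ivl_deriv 0 1 (unit_param \<sigma>))"
proof -
  obtain s f where \<sigma>: "\<sigma> = (s, f)" by force
  have s: "0 < s" and cont: "continuous_on {0..s} (ivl_deriv 0 s f)"
    using assms by (auto simp: \<sigma> constrained_curves_def constrained_curve_def C1_on_ivl_def)
  have "continuous_on {0..1} (\<lambda>u. s *\<^sub>R ivl_deriv 0 s f (s * u))"
    by (rule continuous_intros continuous_on_compose2[OF cont])+
       (use s in \<open>auto simp: mult_left_le\<close>)
  then show ?thesis
    by (rule continuous_on_eq) (use ivl_deriv_unit_param[OF assms] in \<open>simp add: \<sigma>\<close>)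
qed

lemma unit_param_eqD:
  assumes \<sigma>: "\<sigma> \<in> constrained_curves \<kappa> x y" and \<gamma>: "\<gamma> \<in> constrained_curves \<kappa> x y"
    and eq: "\<And>u. u \<in> {0..1} \<Longrightarrow> unit_param \<sigma> u = unit_param \<gamma> u"
  shows "\<sigma> = \<gamma>"
proof -
  have "(unit_param \<sigma> has_vector_derivative ivl_deriv 0 1 (unit_param \<gamma>) 0) (at 0 within {0..1})"
    using unit_param_has_deriv[OF \<gamma>, of 0] ivl_deriv_unit_param[OF \<gamma>, of 0]
    by (auto intro: has_vector_derivative_transform[OF _ eq])
  then have "ivl_deriv 0 1 (unit_param \<sigma>) 0 = ivl_deriv 0 1 (unit_param \<gamma>) 0"
    unfolding ivl_deriv_def[of 0 1 "unit_param \<sigma>"]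
    by (intro vector_derivative_within_closed_interval) auto
  then have len: "fst \<sigma> = fst \<gamma>"
    using norm_ivl_deriv_unit_param[OF \<sigma>, of 0] norm_ivl_deriv_unit_param[OF \<gamma>, of 0] by simp
  obtain s f where sf: "\<sigma> = (s, f)" by force
  with len obtain g where sg: "\<gamma> = (s, g)" by (cases \<gamma>) auto
  have s: "0 < s" and ext: "f \<in> extensional {0..s}" "g \<in> extensional {0..s}"
    using \<sigma> \<gamma> by (auto simp: sf sg constrained_curves_def constrained_curve_def)
  have "f t = g t" if "t \<in> {0..s}" for t
    using eq[of "t / s"] that s by (simp add: sf sg unit_param_def)
  then show ?thesis
    using extensionalityI[OF ext] by (simp add: sf sg)
qed

lemma bdd_above_dist:
  fixes f g :: "real \<Rightarrow> 'a::metric_space"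
  assumes "continuous_on {0..1} f" "continuous_on {0..1} g"
  shows "bdd_above ((\<lambda>u. dist (f u) (g u)) ` {0..1})"
  using assms by (intro compact_imp_bounded[THEN bounded_imp_bdd_above] compact_continuous_image
      continuous_intros) auto

lemma Metric_space_C1_dist: "Metric_space (constrained_curves \<kappa> x y) (C1_dist \<kappa> x y)"
proof -
  let ?M = "constrained_curves \<kappa> x y"
  let ?D = "\<lambda>\<sigma>. ivl_deriv 0 1 (unit_param \<sigma>)"
  have b0: "bdd_above ((\<lambda>u. dist (unit_param \<sigma> u) (unit_param \<gamma> u)) ` {0..1})"
    and b1: "bdd_above ((\<lambda>u. dist (?D \<sigma> u) (?D \<gamma> u)) ` {0..1})"
    if "\<sigma> \<in> ?M" "\<gamma> \<in> ?M" for \<sigma> \<gamma>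
    using that by (auto intro!: bdd_above_dist continuous_on_unit_param
        continuous_on_deriv_unit_param)
  have nonneg: "0 \<le> (SUP u\<in>{0..1}. dist (f u) (g u))"
    if "bdd_above ((\<lambda>u. dist (f u) (g u)) ` {0..1})" for f g :: "real \<Rightarrow> real^2"
    by (rule cSUP_upper2[OF that, of 0]) auto
  have tri: "(SUP u\<in>{0..1}. dist (f u) (h u)) \<le>
      (SUP u\<in>{0..1}. dist (f u) (g u)) + (SUP u\<in>{0..1}. dist (g u) (h u))"
    if "bdd_above ((\<lambda>u. dist (f u) (g u)) ` {0..1})" "bdd_above ((\<lambda>u. dist (g u) (h u)) ` {0..1})"
    for f g h :: "real \<Rightarrow> real^2"
  proof (rule cSUP_least)
    fix u :: real assume u: "u \<in> {0..1}"
    show "dist (f u) (h u) \<le>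
      (SUP u\<in>{0..1}. dist (f u) (g u)) + (SUP u\<in>{0..1}. dist (g u) (h u))"
      using cSUP_upper[OF u that(1)] cSUP_upper[OF u that(2)] dist_triangle[of "f u" "h u" "g u"]
      by linarith
  qed auto
  show ?thesis
  proof
    fix \<sigma> \<gamma> show "0 \<le> C1_dist \<kappa> x y \<sigma> \<gamma>"
      by (auto simp: C1_dist_def intro!: add_nonneg_nonneg nonneg b0 b1)
    show "C1_dist \<kappa> x y \<sigma> \<gamma> = C1_dist \<kappa> x y \<gamma> \<sigma>"
      by (auto simp: C1_dist_def dist_commute)
  next
    fix \<sigma> \<gamma> assume M: "\<sigma> \<in> ?M" "\<gamma> \<in> ?M"
    show "C1_dist \<kappa> x y \<sigma> \<gamma> = 0 \<longleftrightarrow> \<sigma> = \<gamma>"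
    proof
      assume "C1_dist \<kappa> x y \<sigma> \<gamma> = 0"
      then have z: "(SUP u\<in>{0..1}. dist (unit_param \<sigma> u) (unit_param \<gamma> u)) \<le> 0"
        using M nonneg[OF b1[OF M]] by (simp add: C1_dist_def)
      show "\<sigma> = \<gamma>"
      proof (rule unit_param_eqD[OF M])
        fix u :: real assume "u \<in> {0..1}"
        from cSUP_upper[OF this b0[OF M]] z show "unit_param \<sigma> u = unit_param \<gamma> u"
          by (metis dist_le_zero_iff order_trans)
      qed
    qed (use M in \<open>simp add: C1_dist_def\<close>)
  next
    fix \<sigma> \<gamma> \<delta> assume M: "\<sigma> \<in> ?M" "\<gamma> \<in> ?M" "\<delta> \<in> ?M"
    show "C1_dist \<kappa> x y \<sigma> \<delta> \<le> C1_dist \<kappa> x y \<sigma> \<gamma> + C1_dist \<kappa> x y \<gamma> \<delta>"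
      using tri[OF b0[OF M(1,2)] b0[OF M(2,3)]] tri[OF b1[OF M(1,2)] b1[OF M(2,3)]] M
      by (simp add: C1_dist_def)
  qed
qed

lemma topspace_curve_topology: "topspace (curve_topology \<kappa> x y) = constrained_curves \<kappa> x y"
  by (simp add: curve_topology_def Metric_space.topspace_mtopology[OF Metric_space_C1_dist])

lemma homotopy_classes_eq:
  "homotopy_classes \<kappa> x y = path_components_of (curve_topology \<kappa> x y)"
proof -
  have "constrained_homotopic \<kappa> x y = path_component_of (curve_topology \<kappa> x y)"
    by (simp add: fun_eq_iff constrained_homotopic_def path_component_of_def)
  then show ?thesis
    by (auto simp: homotopy_classes_def path_components_of_def quotient_def
        topspace_curve_topology)
qed

lemma two_circles_exist:
  fixes x y :: "real^2"
  assumes "0 < dist x y" "dist x y < 2 * r"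
  shows "\<exists>c1 c2. sphere c1 r \<inter> sphere c2 r = {x, y}"
proof -
  define v where "v = (1/2) *\<^sub>R (y - x)"
  define m where "m = (1/2) *\<^sub>R (x + y)"
  define n :: "real^2" where "n = vector [- (v $ 2), v $ 1]"
  have xv: "x = m - v" "y = m + v"
    by (simp_all add: m_def v_def vec_eq_iff field_simps)
  have nv: "norm v = dist x y / 2" by (simp add: v_def dist_norm norm_minus_commute)
  define N where "N = (v$1)\<^sup>2 + (v$2)\<^sup>2"
  have N: "N = (norm v)\<^sup>2"
    unfolding power2_norm_eq_inner by (simp add: N_def inner_vec_def sum_2 power2_eq_square)
  have Npos: "N > 0" using N nv assms by simp
  have Nr: "N < r\<^sup>2" unfolding N using nv assms by (intro power_strict_mono) auto
  have r: "r > 0" using assms by linarith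
  define h where "h = sqrt ((r\<^sup>2 - N) / N)"
  have h2: "h\<^sup>2 * N = r\<^sup>2 - N" and h: "h > 0" using Npos Nr by (simp_all add: h_def)
  have sph: "p \<in> sphere c r \<longleftrightarrow> (p$1 - c$1)\<^sup>2 + (p$2 - c$2)\<^sup>2 = r\<^sup>2" for p c :: "real^2"
  proof -
    have "p \<in> sphere c r \<longleftrightarrow> (norm (p - c))\<^sup>2 = r\<^sup>2"
      using r by (auto simp: dist_norm norm_minus_commute power2_eq_iff_nonneg)
    then show ?thesis
      unfolding power2_norm_eq_inner by (simp add: inner_vec_def sum_2 power2_eq_square)
  qed
  have "p \<in> sphere (m + h *\<^sub>R n) r \<inter> sphere (m - h *\<^sub>R n) r \<longleftrightarrow> p \<in> {x, y}" for p
  proof -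
    define a where "a = p$1 - m$1" define b where "b = p$2 - m$2"
    define v1 where "v1 = v$1" define v2 where "v2 = v$2"
    have Nd: "N = v1\<^sup>2 + v2\<^sup>2" by (simp add: N_def v1_def v2_def)
    have "p \<in> sphere (m + h *\<^sub>R n) r \<inter> sphere (m - h *\<^sub>R n) r \<longleftrightarrow>
      (a + h * v2)\<^sup>2 + (b - h * v1)\<^sup>2 = r\<^sup>2 \<and> (a - h * v2)\<^sup>2 + (b + h * v1)\<^sup>2 = r\<^sup>2"
      unfolding Int_iff sph by (simp add: n_def a_def b_def v1_def v2_def algebra_simps)
    also have "\<dots> \<longleftrightarrow> a * v2 = b * v1 \<and> a\<^sup>2 + b\<^sup>2 = N"
    proof -
      have e1: "(a + h * v2)\<^sup>2 + (b - h * v1)\<^sup>2 = a\<^sup>2 + b\<^sup>2 + h\<^sup>2 * N + 2 * h * (a * v2 - b * v1)"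
        and e2: "(a - h * v2)\<^sup>2 + (b + h * v1)\<^sup>2 = a\<^sup>2 + b\<^sup>2 + h\<^sup>2 * N - 2 * h * (a * v2 - b * v1)"
        by (simp_all add: Nd power2_eq_square algebra_simps)
      have "2 * h * (a * v2 - b * v1) = 0 \<longleftrightarrow> a * v2 = b * v1" using h by simp
      then show ?thesis unfolding e1 e2 h2 by linarith
    qed
    also have "\<dots> \<longleftrightarrow> (a = v1 \<and> b = v2) \<or> (a = - v1 \<and> b = - v2)"
    proof
      assume A: "a * v2 = b * v1 \<and> a\<^sup>2 + b\<^sup>2 = N"
      have "N * (a\<^sup>2 - v1\<^sup>2) = (a * v2 - b * v1) * (a * v2 + b * v1)
          + v1\<^sup>2 * (a\<^sup>2 + b\<^sup>2 - N)"
        by (simp add: Nd power2_eq_square algebra_simps)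
      then have 1: "a\<^sup>2 = v1\<^sup>2" using A Npos by simp
      have 2: "b\<^sup>2 = v2\<^sup>2" using 1 A Nd by simp
      show "(a = v1 \<and> b = v2) \<or> (a = - v1 \<and> b = - v2)"
        using 1 2 A unfolding power2_eq_iff by auto
    qed (auto simp: Nd)
    also have "\<dots> \<longleftrightarrow> p \<in> {x, y}"
      by (auto simp: xv vec_eq_iff forall_2 a_def b_def v1_def v2_def)
    finally show ?thesis .
  qed
  then show ?thesis by blast
qed

end

theory Submission
  imports Defs
begin

text \<open>Lift the unit tangent of a curve to a continuous angle, so that a curve becomes a tangent angle
  \<open>\<theta>\<close> together with a speed \<open>\<rho>\<close> on \<open>{0..1}\<close>. If \<open>\<theta>\<close> varies by more than \<open>\<pi>\<close>, some subarc turns by exactly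
  \<open>\<pi>\<close> and has a chord of length at least \<open>2 r\<close>, which exceeds the diameter of the lens. If \<open>\<theta>\<close> varies
  by at most \<open>\<pi>\<close>, comparison with circular arcs shows that the curve advances strictly in the direction
  \<open>y - x\<close> and stays in the lens. Leaving the lens and always advancing are both open
  conditions, so the curves outside the lens form a clopen set.

  For path-connectedness, note that for fixed \<open>\<theta>\<close> the admissible speeds form a convex set, which is
  nonempty when \<open>\<theta>\<close> varies by more than \<open>\<pi>\<close> because the directions taken then positively span the
  plane. Two angle functions that both increase by more than \<open>\<pi>\<close> from time \<open>p\<close> to time \<open>q\<close> can
  therefore be joined by linear interpolation of the angles, with speeds chosen locally by Cramer's
  rule. Every angle function is linked in this way to a linear one, and each steep enough linear one
  to \<open>16 u (1 - u)\<close>.\<close>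

subsection \<open>Tangent angles\<close>

text \<open>The end tangents are free, so the total turning angle is no invariant; only the
  oscillation of the lifted angle decides the class. Interpolating angles in arc length is
  obstructed twice: the condition of ending at \<open>y\<close> is nonlinear in the angle, and the
  length changes along a homotopy. A separate speed on a fixed interval absorbs both. Raising the
  speed never violates the curvature bound, so only the end point has to be repaired. Speeds chosen
  locally along a family of angles need not fit together into one global choice, because two speeds
  over the same angle are joined by a segment and \<open>{0..1}\<close> is connected. A rise and a
  fall cannot be interpolated directly: the combination may pass through a constant angle, where no
  curve outside the lens exists. The hump removes this obstacle, since it rises by 4 > \<pi> and
  falls by 4 and so shares a large turn with linear angles of either sign.\<close>

definition dir :: "real \<Rightarrow> real^2" where
  "dir a = vector [cos a, sin a]"

text \<open>One derivative below \<open>piecewise_C2_on_ivl\<close>, with the same closed pieces: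
  the angle of such a curve has one-sided derivatives at the break points.\<close>

definition piecewise_C1_on_ivl :: "real \<Rightarrow> real \<Rightarrow> (real \<Rightarrow> real) \<Rightarrow> bool" where
  "piecewise_C1_on_ivl a b f \<longleftrightarrow>
     (\<exists>(n::nat) p. p 0 = a \<and> p n = b \<and>
        (\<forall>i<n. p i < p (Suc i) \<and> C1_on_ivl (p i) (p (Suc i)) f))"

text \<open>The curvature bound takes the form of a Lipschitz condition because the derivative of
  the angle may fail to exist at break points.\<close>

definition angle_fun :: "real \<Rightarrow> real \<Rightarrow> (real \<Rightarrow> real) \<Rightarrow> bool" where
  "angle_fun \<kappa> s \<phi> \<longleftrightarrow> 0 < s \<and> piecewise_C1_on_ivl 0 s \<phi> \<and>
     (\<forall>u\<in>{0..s}. \<forall>v\<in>{0..s}. \<bar>\<phi> v - \<phi> u\<bar> \<le> \<kappa> * \<bar>v - u\<bar>)"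

text \<open>\<open>restrict\<close> makes the map extensional, so that a curve rebuilt from its
  angle is equal to the original pair.\<close>

definition curve_of :: "real^2 \<Rightarrow> real \<Rightarrow> (real \<Rightarrow> real) \<Rightarrow> curve" where
  "curve_of x s \<phi> = (s, restrict (\<lambda>t. x + integral {0..t} (\<lambda>\<tau>. dir (\<phi> \<tau>))) {0..s})"

lemma dir_nth [simp]: "dir a $ 1 = cos a" "dir a $ 2 = sin a"
  by (simp_all add: dir_def)

lemma inner_real2: "(a :: real^2) \<bullet> b = a$1 * b$1 + a$2 * b$2"
  by (simp add: inner_vec_def sum_2)

lemma norm_real2: "norm (a :: real^2) = sqrt ((a$1)\<^sup>2 + (a$2)\<^sup>2)"
  by (simp add: norm_eq_sqrt_inner inner_real2 power2_eq_square)

lemma norm_dir [simp]: "norm (dir a) = 1"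
  by (simp add: norm_real2)

lemma inner_dir_dir: "dir a \<bullet> dir b = cos (a - b)"
  by (simp add: inner_real2 cos_diff)

lemma dir_alt: "dir a = cos a *\<^sub>R axis 1 1 + sin a *\<^sub>R axis 2 1"
  by (simp add: vec_eq_iff forall_2 axis_def)

lemma continuous_on_dir [continuous_intros]:
  fixes f :: "'a::t2_space \<Rightarrow> real"
  assumes "continuous_on S f" shows "continuous_on S (\<lambda>x. dir (f x))"
  unfolding dir_alt by (intro continuous_intros assms)

lemma has_vector_derivative_dir:
  assumes "(f has_vector_derivative D) (at t within A)"
  shows "((\<lambda>t. dir (f t)) has_vector_derivative D *\<^sub>R dir (f t + pi / 2)) (at t within A)"
  using assms unfolding dir_alt has_real_derivative_iff_has_vector_derivative[symmetric]
  by (auto intro!: derivative_eq_intros simp: algebra_simps cos_add sin_add)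

text \<open>A chord of the unit circle, of length 2 |sin ((a - b) / 2)|, is at most as long as its
  arc. Thus a Lipschitz bound for the angle is one for the tangent.\<close>

lemma dist_dir_le: "norm (dir a - dir b) \<le> \<bar>a - b\<bar>"
proof -
  have "(norm (dir a - dir b))\<^sup>2 = 2 - 2 * cos (a - b)"
    by (simp add: power2_norm_eq_inner inner_diff_left inner_diff_right inner_dir_dir
        cos_diff algebra_simps)
  also have "\<dots> = (2 * sin ((a - b) / 2))\<^sup>2"
    proof -
    have "cos (a - b) = 1 - 2 * (sin ((a - b) / 2))\<^sup>2"
      using cos_double_sin[of "(a - b) / 2"] unfolding mult_2 by simp
    then show ?thesis by (simp add: power_mult_distrib)
  qed
  also have "\<dots> \<le> \<bar>a - b\<bar>\<^sup>2"
  proof -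
    have "\<bar>2 * sin ((a - b) / 2)\<bar> \<le> \<bar>a - b\<bar>"
      using abs_sin_x_le_abs_x[of "(a - b) / 2"] by (simp add: abs_mult)
    then have "\<bar>2 * sin ((a - b) / 2)\<bar>\<^sup>2 \<le> \<bar>a - b\<bar>\<^sup>2" by (intro power_mono) auto
    then show ?thesis by simp
  qed
  finally show ?thesis by (metis abs_ge_zero power2_le_imp_le)
qed

lemma ivl_derivI:
  fixes f :: "real \<Rightarrow> 'a::euclidean_space"
  assumes "a < b" "t \<in> {a..b}" "(f has_vector_derivative D) (at t within {a..b})"
  shows "ivl_deriv a b f t = D"
  unfolding ivl_deriv_def using vector_derivative_within_closed_interval[OF assms] .

lemma C1_on_ivlI:
  fixes f :: "real \<Rightarrow> 'a::euclidean_space"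
  assumes "a < b" and d: "\<And>t. t \<in> {a..b} \<Longrightarrow> (f has_vector_derivative D t) (at t within {a..b})"
    and c: "continuous_on {a..b} D"
  shows "C1_on_ivl a b f"
  unfolding C1_on_ivl_def
proof
  show "f differentiable_on {a..b}"
    using d by (meson differentiable_on_def differentiableI_vector)
  show "continuous_on {a..b} (ivl_deriv a b f)"
    by (rule continuous_on_eq[OF c]) (use ivl_derivI[OF assms(1) _ d] in auto)
qed

lemma C1_on_ivlD:
  assumes "C1_on_ivl a b f" "t \<in> {a..b}"
  shows "(f has_vector_derivative ivl_deriv a b f t) (at t within {a..b})"
  using assms unfolding C1_on_ivl_def ivl_deriv_def differentiable_on_def
  by (auto simp flip: vector_derivative_works)

lemma partition_mono:
  fixes p :: "nat \<Rightarrow> real"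
  assumes "\<And>i. i < n \<Longrightarrow> p i < p (Suc i)" "i \<le> j" "j \<le> n"
  shows "p i \<le> p j"
  using assms(2,3)
proof (induction j rule: dec_induct)
  case (step m)
  then show ?case using assms(1)[of m] by force
qed auto

lemma partition_cover:
  fixes p :: "nat \<Rightarrow> real"
  assumes "p 0 \<le> t" "t < p n"
  shows "\<exists>i<n. p i \<le> t \<and> t < p (Suc i)"
  using assms(2)
proof (induction n)
  case (Suc n)
  then show ?case by (cases "t < p n") (use less_Suc_eq in auto)
qed (use assms(1) in auto)

lemma angle_fun_continuous: 
  assumes "angle_fun \<kappa> s \<phi>" shows "continuous_on {0..s} \<phi>"
proof -
  \<comment> \<open>\<open>lipschitz_on\<close> demands a nonnegative constant, and the sign of
    \<kappa> is not given here.\<close>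
  have "\<bar>\<kappa>\<bar>-lipschitz_on {0..s} \<phi>"
  proof (rule lipschitz_onI)
    fix u v assume "u \<in> {0..s}" "v \<in> {0..s}"
    then have "\<bar>\<phi> u - \<phi> v\<bar> \<le> \<kappa> * \<bar>u - v\<bar>" using assms by (auto simp: angle_fun_def)
    also have "\<dots> \<le> \<bar>\<kappa>\<bar> * \<bar>u - v\<bar>" by (intro mult_right_mono) auto
    finally show "dist (\<phi> u) (\<phi> v) \<le> \<bar>\<kappa>\<bar> * dist u v" by (simp add: dist_real_def)
  qed auto
  then show ?thesis by (rule lipschitz_on_continuous_on)
qed

section \<open>From angle functions to constrained curves\<close>

lemma curve_of_deriv:
  assumes "continuous_on {0..s} \<phi>" "t \<in> {0..s}"
  shows "(snd (curve_of x s \<phi>) has_vector_derivative dir (\<phi> t)) (at t within {0..s})"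
proof -
  have "((\<lambda>t. x + integral {0..t} (\<lambda>\<tau>. dir (\<phi> \<tau>))) has_vector_derivative 0 + dir (\<phi> t))
     (at t within {0..s})"
    by (intro has_vector_derivative_add has_vector_derivative_const
        integral_has_vector_derivative continuous_intros assms)
  then show ?thesis
    by (auto simp: curve_of_def intro: has_vector_derivative_transform[OF assms(2), rotated])
qed

text \<open>Difference quotients inherit the Lipschitz bound. One-sided derivatives are covered
  because the curvature condition also speaks of the two end points of the interval.\<close>

lemma norm_derivative_le_lipschitz:
  fixes f :: "real \<Rightarrow> 'a::real_normed_vector"
  assumes "a < b" "t \<in> {a..b}" and d: "(f has_vector_derivative D) (at t within {a..b})"
    and L: "\<And>u. u \<in> {a..b} \<Longrightarrow> norm (f u - f t) \<le> L * \<bar>u - t\<bar>"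
  shows "norm D \<le> L"
proof (rule field_le_epsilon)
  fix e :: real assume "e > 0"
  then have "\<forall>\<^sub>F u in at t within {a..b}. norm (f u - f t - (u - t) *\<^sub>R D) \<le> e * norm (u - t)"
    using d unfolding has_vector_derivative_def has_derivative_within_alt2 by blast
  moreover have "\<forall>\<^sub>F u in at t within {a..b}. u \<in> {a..b} \<and> u \<noteq> t"
    by (auto simp: eventually_at_filter)
  moreover have "at t within {a..b} \<noteq> bot"
    using assms(1,2) by (metis trivial_limit_within islimpt_Icc)
  ultimately obtain u where u: "u \<in> {a..b}" "u \<noteq> t"
      and *: "norm (f u - f t - (u - t) *\<^sub>R D) \<le> e * norm (u - t)"
    using eventually_happens'[OF _ eventually_conj] by blast
  have "\<bar>u - t\<bar> * norm D = norm ((f u - f t) - (f u - f t - (u - t) *\<^sub>R D))" by simp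
  also have "\<dots> \<le> norm (f u - f t) + norm (f u - f t - (u - t) *\<^sub>R D)" by (rule norm_triangle_ineq4)
  also have "\<dots> \<le> \<bar>u - t\<bar> * (L + e)" using * L[OF u(1)] by (simp add: algebra_simps)
  finally show "norm D \<le> L + e" using u(2) by simp
qed

text \<open>The tangent is \<open>dir\<close> of the angle, and on each piece the second derivative
  is the derivative of the angle times the unit normal. The curvature bound at an arbitrary time
  comes from the Lipschitz bound of the tangent, so break points need no separate treatment.\<close>

lemma curve_of_constrained:
  assumes \<phi>: "angle_fun \<kappa> s \<phi>" and y: "x + integral {0..s} (\<lambda>\<tau>. dir (\<phi> \<tau>)) = y"
  shows "curve_of x s \<phi> \<in> constrained_curves \<kappa> x y"
proof -
  have s: "s > 0" and L: "\<And>u v. u \<in> {0..s} \<Longrightarrow> v \<in> {0..s} \<Longrightarrow> \<bar>\<phi> v - \<phi> u\<bar> \<le> \<kappa> * \<bar>v - u\<bar>"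
    using \<phi> by (auto simp: angle_fun_def)
  note cont = angle_fun_continuous[OF \<phi>]
  define f where "f = snd (curve_of x s \<phi>)"
  have d: "(f has_vector_derivative dir (\<phi> t)) (at t within {0..s})" if "t \<in> {0..s}" for t
    unfolding f_def by (rule curve_of_deriv[OF cont that])
  have D: "ivl_deriv 0 s f t = dir (\<phi> t)" if "t \<in> {0..s}" for t
    by (rule ivl_derivI[OF s that d[OF that]])
  obtain n p where p: "p 0 = 0" "p (n::nat) = s"
    "\<And>i. i < n \<Longrightarrow> p i < p (Suc i)" "\<And>i. i < n \<Longrightarrow> C1_on_ivl (p i) (p (Suc i)) \<phi>"
    using \<phi> unfolding angle_fun_def piecewise_C1_on_ivl_def by blast
  have "C2_on_ivl (p i) (p (Suc i)) f" if i: "i < n" for i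
  proof -
    let ?a = "p i" and ?b = "p (Suc i)"
    have ab: "?a < ?b" using p i by simp
    have sub: "{?a..?b} \<subseteq> {0..s}"
      using partition_mono[of n p 0 i] partition_mono[of n p "Suc i" n] p i by auto
    have d': "(f has_vector_derivative dir (\<phi> t)) (at t within {?a..?b})" if "t \<in> {?a..?b}" for t
      using d[of t] sub that has_vector_derivative_within_subset by blast
    have D': "ivl_deriv ?a ?b f t = dir (\<phi> t)" if "t \<in> {?a..?b}" for t
      by (rule ivl_derivI[OF ab that d'[OF that]])
    have c: "continuous_on {?a..?b} \<phi>" using cont sub continuous_on_subset by blast
    have "C1_on_ivl ?a ?b f"
      by (rule C1_on_ivlI[OF ab d']) (auto intro!: continuous_intros c)
    moreover have "C1_on_ivl ?a ?b (ivl_deriv ?a ?b f)"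
    proof (rule C1_on_ivlI[OF ab])
      fix t assume t: "t \<in> {?a..?b}"
      show "(ivl_deriv ?a ?b f has_vector_derivative ivl_deriv ?a ?b \<phi> t *\<^sub>R dir (\<phi> t + pi/2))
          (at t within {?a..?b})"
        by (rule has_vector_derivative_transform[OF t _ has_vector_derivative_dir[OF C1_on_ivlD]])
           (use p i t D' in auto)
    next
      show "continuous_on {?a..?b} (\<lambda>t. ivl_deriv ?a ?b \<phi> t *\<^sub>R dir (\<phi> t + pi/2))"
        using p(4)[OF i] by (auto intro!: continuous_intros c simp: C1_on_ivl_def)
    qed
    ultimately show ?thesis by (simp add: C2_on_ivl_def)
  qed
  then have C2: "piecewise_C2_on_ivl 0 s f"
    unfolding piecewise_C2_on_ivl_def using p by (intro exI[of _ n] exI[of _ p]) auto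
  have C1: "C1_on_ivl 0 s f"
    by (rule C1_on_ivlI[OF s d]) (auto intro!: continuous_intros cont)
  have curv: "norm (ivl_deriv 0 s (ivl_deriv 0 s f) t) \<le> \<kappa>"
    if t: "t \<in> {0..s}" and dd: "ivl_deriv 0 s f differentiable (at t within {0..s})" for t
  proof (rule norm_derivative_le_lipschitz[OF s t])
    show "(ivl_deriv 0 s f has_vector_derivative ivl_deriv 0 s (ivl_deriv 0 s f) t) (at t within {0..s})"
      using dd unfolding ivl_deriv_def[of 0 s "ivl_deriv 0 s f"]
      by (simp flip: vector_derivative_works)
    fix u :: real assume u: "u \<in> {0..s}"
    show "norm (ivl_deriv 0 s f u - ivl_deriv 0 s f t) \<le> \<kappa> * \<bar>u - t\<bar>"
      using dist_dir_le[of "\<phi> u" "\<phi> t"] L[OF t u] unfolding D[OF t] D[OF u] by linarith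
  qed
  have "curve_of x s \<phi> = (s, f)" by (simp add: f_def curve_of_def)
  moreover have "f 0 = x" "f s = y" using s y by (auto simp: f_def curve_of_def)
  moreover have "f \<in> extensional {0..s}" by (auto simp: f_def curve_of_def)
  ultimately show ?thesis
    using s C1 C2 curv D by (auto simp: constrained_curves_def constrained_curve_def)
qed

text \<open>The fundamental theorem of calculus tolerates finitely many exceptional points, so
  estimates of angles can be integrated across break points.\<close>

lemma abs_diff_le_integral:
  fixes h g :: "real \<Rightarrow> real"
  assumes F: "finite F" and "u \<le> v" and h: "continuous_on {u..v} h" and g: "continuous_on {u..v} g"
    and pos: "\<And>t. t \<in> {u..v} \<Longrightarrow> 0 \<le> g t"
    and d: "\<And>t. t \<in> {u<..<v} - F \<Longrightarrow> \<exists>D. (h has_real_derivative D) (at t) \<and> \<bar>D\<bar> \<le> g t"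
  shows "\<bar>h v - h u\<bar> \<le> integral {u..v} g"
proof -
  obtain D where D: "\<And>t. t \<in> {u<..<v} - F \<Longrightarrow> (h has_real_derivative D t) (at t) \<and> \<bar>D t\<bar> \<le> g t"
    using d by metis
  \<comment> \<open>The value 0 at the exceptional points and at the ends keeps \<open>E\<close>
    bounded by the nonnegative \<open>g\<close> on the whole interval.\<close>
  define E where "E t = (if t \<in> {u<..<v} - F then D t else 0)" for t
  have "(E has_integral (h v - h u)) {u..v}"
    by (rule fundamental_theorem_of_calculus_interior_strong[OF F \<open>u \<le> v\<close> _ h])
       (use D in \<open>auto simp: E_def has_real_derivative_iff_has_vector_derivative\<close>)
  then have "E integrable_on {u..v}" "integral {u..v} E = h v - h u"
    by (auto simp: has_integral_integrable integral_unique)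
  moreover have "g integrable_on {u..v}" using g by (rule integrable_continuous_real)
  moreover have "norm (E t) \<le> g t" if "t \<in> {u..v}" for t
    using D pos that by (auto simp: E_def)
  ultimately show ?thesis using integral_norm_bound_integral[of E "{u..v}" g] by simp
qed

section \<open>Pointwise derivatives of angles, and the lift of a curve to its angle\<close>

lemma C1_on_ivl_interior:
  assumes "C1_on_ivl a b (f :: real \<Rightarrow> real)" "t \<in> {a<..<b}"
  shows "(f has_real_derivative ivl_deriv a b f t) (at t)"
  using C1_on_ivlD[OF assms(1), of t] assms(2)
  by (simp add: at_within_Icc_at has_real_derivative_iff_has_vector_derivative)

lemma partition_cover_open:
  fixes p :: "nat \<Rightarrow> real"
  assumes "t \<in> {p 0<..<p n} - p ` {..n}"
  shows "\<exists>i<n. t \<in> {p i<..<p (Suc i)}"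
proof -
  obtain i where i: "i < n" "p i \<le> t" "t < p (Suc i)" using partition_cover[of p t n] assms by auto
  moreover have "t \<noteq> p i" using assms i by auto
  ultimately show ?thesis by force
qed

lemma angle_fun_differentiable:
  assumes "angle_fun \<kappa> s \<phi>"
  obtains F where "finite F"
    "\<And>t. t \<in> {0<..<s} - F \<Longrightarrow> \<exists>D. (\<phi> has_real_derivative D) (at t) \<and> \<bar>D\<bar> \<le> \<kappa>"
proof -
  obtain n p where p: "p 0 = 0" "p (n::nat) = s"
    "\<And>i. i < n \<Longrightarrow> p i < p (Suc i)" "\<And>i. i < n \<Longrightarrow> C1_on_ivl (p i) (p (Suc i)) \<phi>"
    using assms unfolding angle_fun_def piecewise_C1_on_ivl_def by blast
  show thesis
  proof
    show "finite (p ` {..n})" by simp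
    fix t assume "t \<in> {0<..<s} - p ` {..n}"
    then have t: "t \<in> {p 0<..<p n} - p ` {..n}" by (simp add: p)
    then obtain i where i: "i < n" and ti: "t \<in> {p i<..<p (Suc i)}"
      using partition_cover_open by blast
    let ?D = "ivl_deriv (p i) (p (Suc i)) \<phi> t"
    have D: "(\<phi> has_real_derivative ?D) (at t)"
      using C1_on_ivl_interior[OF p(4)[OF i] ti] .
    have "norm ?D \<le> \<kappa>"
    proof (rule norm_derivative_le_lipschitz)
      show "0 < s" "t \<in> {0..s}" using t p by auto
      show "(\<phi> has_vector_derivative ?D) (at t within {0..s})"
        using D by (simp add: has_real_derivative_iff_has_vector_derivative has_vector_derivative_at_within)
      show "\<And>u. u \<in> {0..s} \<Longrightarrow> norm (\<phi> u - \<phi> t) \<le> \<kappa> * \<bar>u - t\<bar>"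
        using assms t p by (auto simp: angle_fun_def)
    qed
    with D show "\<exists>D. (\<phi> has_real_derivative D) (at t) \<and> \<bar>D\<bar> \<le> \<kappa>" by auto
  qed
qed

text \<open>The derivative of sin (\<phi> - m) is the curvature times cos (\<phi> - m), and the
  latter is the velocity in direction \<open>m\<close>. Turning therefore costs progress in
  direction \<open>m\<close>, with equality for arcs of radius 1 / \<kappa>. This is the comparison
  with circular arcs, in the form used by all later estimates.\<close>

lemma angle_fun_sin_diff:
  assumes \<phi>: "angle_fun \<kappa> s \<phi>" and uv: "0 \<le> u" "u \<le> v" "v \<le> s" and "\<kappa> \<ge> 0"
    and pos: "\<And>t. t \<in> {u..v} \<Longrightarrow> cos (\<phi> t - m) \<ge> 0"
  shows "\<bar>sin (\<phi> v - m) - sin (\<phi> u - m)\<bar> \<le> \<kappa> * integral {u..v} (\<lambda>t. cos (\<phi> t - m))"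
proof -
  obtain F where F: "finite F"
    "\<And>t. t \<in> {0<..<s} - F \<Longrightarrow> \<exists>D. (\<phi> has_real_derivative D) (at t) \<and> \<bar>D\<bar> \<le> \<kappa>"
    using angle_fun_differentiable[OF \<phi>] by metis
  have c: "continuous_on {u..v} \<phi>"
    using angle_fun_continuous[OF \<phi>] uv continuous_on_subset by fastforce
  have "\<bar>sin (\<phi> v - m) - sin (\<phi> u - m)\<bar> \<le> integral {u..v} (\<lambda>t. \<kappa> * cos (\<phi> t - m))"
  proof (rule abs_diff_le_integral[OF F(1) \<open>u \<le> v\<close>])
    fix t assume t: "t \<in> {u<..<v} - F"
    then obtain D where D: "(\<phi> has_real_derivative D) (at t)" "\<bar>D\<bar> \<le> \<kappa>"
      using F(2)[of t] uv by auto
    have "((\<lambda>t. sin (\<phi> t - m)) has_real_derivative D * cos (\<phi> t - m)) (at t)"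
      by (auto intro!: derivative_eq_intros D)
    moreover have "\<bar>D * cos (\<phi> t - m)\<bar> \<le> \<kappa> * cos (\<phi> t - m)"
      using D(2) pos[of t] t by (auto simp: abs_mult intro!: mult_right_mono)
    ultimately show "\<exists>D. ((\<lambda>t. sin (\<phi> t - m)) has_real_derivative D) (at t) \<and> \<bar>D\<bar> \<le> \<kappa> * cos (\<phi> t - m)"
      by blast
  qed (auto intro!: continuous_intros c mult_nonneg_nonneg \<open>\<kappa> \<ge> 0\<close> pos)
  then show ?thesis by simp
qed

text \<open>The component of \<open>T u\<close> along the normal at \<open>t\<close> is sin (\<phi>
  u - \<phi> t). Near \<open>t\<close> the angle is hence \<phi> t plus the arcsine of a
  differentiable function that vanishes at \<open>t\<close>, and the arcsine has derivative 1 at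
  0.\<close>

lemma C1_on_ivl_angle:
  assumes "a < b" and c: "continuous_on {a..b} \<phi>" and T: "C1_on_ivl a b T"
    and eq: "\<And>t. t \<in> {a..b} \<Longrightarrow> T t = dir (\<phi> t)"
  shows "C1_on_ivl a b \<phi>"
proof (rule C1_on_ivlI[OF \<open>a < b\<close>])
  let ?T' = "ivl_deriv a b T"
  show "continuous_on {a..b} (\<lambda>t. dir (\<phi> t + pi / 2) \<bullet> ?T' t)"
    using T by (auto intro!: continuous_intros c simp: C1_on_ivl_def)
  fix t assume t: "t \<in> {a..b}"
  have T': "(T has_vector_derivative ?T' t) (at t within {a..b})"
    using C1_on_ivlD[OF T t] .
  define q where "q u = dir (\<phi> t + pi / 2) \<bullet> T u" for u
  have q: "q u = sin (\<phi> u - \<phi> t)" if "u \<in> {a..b}" for u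
    by (simp add: q_def eq[OF that] inner_dir_dir cos_add sin_diff cos_diff algebra_simps sin_add)
  have "(q has_vector_derivative dir (\<phi> t + pi / 2) \<bullet> ?T' t) (at t within {a..b})"
    unfolding q_def by (rule bounded_linear.has_vector_derivative[OF bounded_linear_inner_right T'])
  then have qd: "(q has_real_derivative dir (\<phi> t + pi / 2) \<bullet> ?T' t) (at t within {a..b})"
    by (simp add: has_real_derivative_iff_has_vector_derivative)
  have q0: "q t = 0" using q[OF t] by simp
  have "(arcsin has_real_derivative 1) (at (q t))"
    using DERIV_arcsin[of 0] by (simp add: q0)
  from DERIV_add[OF DERIV_const[of "\<phi> t"] DERIV_chain2[OF this qd]]
  have d: "((\<lambda>u. \<phi> t + arcsin (q u)) has_vector_derivative dir (\<phi> t + pi / 2) \<bullet> ?T' t) (at t within {a..b})"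
    by (simp add: has_real_derivative_iff_has_vector_derivative)
  \<comment> \<open>Continuity keeps \<phi> u within \<pi>/2 of \<phi> t, the range in which the
    arcsine inverts the sine.\<close>
  obtain e where e: "e > 0" "\<And>u. u \<in> {a..b} \<Longrightarrow> dist u t < e \<Longrightarrow> dist (\<phi> u) (\<phi> t) < pi / 2"
    using c t unfolding continuous_on_iff by (metis pi_half_gt_zero)
  have eq: "\<phi> t + arcsin (q u) = \<phi> u" if "u \<in> {a..b}" "dist u t < e" for u
  proof -
    have "\<bar>\<phi> u - \<phi> t\<bar> < pi / 2" using e(2)[OF that] by (simp only: dist_real_def)
    then show ?thesis unfolding q[OF that(1)] by (subst arcsin_sin) linarith+
  qed
  show "(\<phi> has_vector_derivative dir (\<phi> t + pi / 2) \<bullet> ?T' t) (at t within {a..b})"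
    by (rule has_vector_derivative_transform_within[OF d e(1) t eq])
qed

text \<open>In the complex plane the angle is the imaginary part of a continuous logarithm, which
  exists because an interval is contractible.\<close>

lemma continuous_angle_exists:
  fixes T :: "real \<Rightarrow> real^2"
  assumes "continuous_on {a..b} T" and n: "\<And>t. t \<in> {a..b} \<Longrightarrow> norm (T t) = 1"
  obtains \<phi> where "continuous_on {a..b} \<phi>" "\<And>t. t \<in> {a..b} \<Longrightarrow> T t = dir (\<phi> t)"
proof -
  define Z where "Z t = Complex (T t $ 1) (T t $ 2)" for t
  have nZ: "norm (Z t) = 1" if "t \<in> {a..b}" for t
    using n[OF that] by (simp add: Z_def norm_real2 cmod_def)
  have "continuous_on {a..b} Z"
    unfolding Z_def by (intro continuous_intros assms)
  moreover have "Z t \<noteq> 0" if "t \<in> {a..b}" for t using nZ[OF that] by auto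
  ultimately obtain g where g: "continuous_on {a..b} g" "\<And>t. t \<in> {a..b} \<Longrightarrow> Z t = exp (g t)"
    using continuous_logarithm_on_contractible[of "{a..b}" Z] convex_imp_contractible[of "{a..b}"] by auto
  show thesis
  proof
    show "continuous_on {a..b} (\<lambda>t. Im (g t))" by (intro continuous_intros g)
    fix t assume t: "t \<in> {a..b}"
    have "Re (g t) = 0" using nZ[OF t] g(2)[OF t] by simp
    then have "Z t = cis (Im (g t))" using g(2)[OF t] by (simp add: exp_eq_polar)
    then show "T t = dir (Im (g t))"
      by (simp add: vec_eq_iff forall_2 Z_def complex_eq_iff)
  qed
qed

text \<open>A converse to \<open>curve_of_constrained\<close>: inside a piece the norm of the second
  derivative is the absolute value of the derivative of the angle, so this is at most \<kappa>, and
  integration across the break points yields the Lipschitz bound.\<close>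

lemma constrained_curve_angle:
  assumes \<sigma>: "\<sigma> \<in> constrained_curves \<kappa> x y" and "\<kappa> \<ge> 0"
  obtains s \<phi> where "angle_fun \<kappa> s \<phi>" "\<sigma> = curve_of x s \<phi>"
    "x + integral {0..s} (\<lambda>t. dir (\<phi> t)) = y"
proof -
  obtain s f where sf: "\<sigma> = (s, f)" by force
  define T where "T = ivl_deriv 0 s f"
  have s: "0 < s" and ext: "f \<in> extensional {0..s}" and C1: "C1_on_ivl 0 s f"
    and C2: "piecewise_C2_on_ivl 0 s f" and n: "\<And>t. t \<in> {0..s} \<Longrightarrow> norm (T t) = 1"
    and curv: "\<And>t. t \<in> {0..s} \<Longrightarrow> T differentiable (at t within {0..s}) \<Longrightarrow>
        norm (ivl_deriv 0 s T t) \<le> \<kappa>" and f0: "f 0 = x" and fs: "f s = y"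
    using \<sigma> by (auto simp: sf constrained_curves_def constrained_curve_def T_def)
  have fd: "(f has_vector_derivative T t) (at t within {0..s})" if "t \<in> {0..s}" for t
    using C1_on_ivlD[OF C1 that] by (simp add: T_def)
  have Tc: "continuous_on {0..s} T" using C1 by (simp add: C1_on_ivl_def T_def)
  obtain \<phi> where c: "continuous_on {0..s} \<phi>" and \<phi>: "\<And>t. t \<in> {0..s} \<Longrightarrow> T t = dir (\<phi> t)"
    using continuous_angle_exists[OF Tc n] by metis
  obtain m p where p: "p 0 = 0" "p (m::nat) = s"
    "\<And>i. i < m \<Longrightarrow> p i < p (Suc i)" "\<And>i. i < m \<Longrightarrow> C2_on_ivl (p i) (p (Suc i)) f"
    using C2 unfolding piecewise_C2_on_ivl_def by blast
  have sub: "{p i..p (Suc i)} \<subseteq> {0..s}" if "i < m" for i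
    using partition_mono[of m p 0 i] partition_mono[of m p "Suc i" m] p that by auto
  have piece: "C1_on_ivl (p i) (p (Suc i)) \<phi>" if i: "i < m" for i
  proof (rule C1_on_ivl_angle[OF p(3)[OF i]])
    show "continuous_on {p i..p (Suc i)} \<phi>" using c sub[OF i] continuous_on_subset by blast
    show "C1_on_ivl (p i) (p (Suc i)) (ivl_deriv (p i) (p (Suc i)) f)"
      using p(4)[OF i] by (simp add: C2_on_ivl_def)
    fix t assume t: "t \<in> {p i..p (Suc i)}"
    have "ivl_deriv (p i) (p (Suc i)) f t = T t"
      by (rule ivl_derivI[OF p(3)[OF i] t])
         (use fd sub[OF i] t has_vector_derivative_within_subset in blast)
    then show "ivl_deriv (p i) (p (Suc i)) f t = dir (\<phi> t)" using \<phi> sub[OF i] t by auto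
  qed
  have bound: "\<exists>D. (\<phi> has_real_derivative D) (at t) \<and> \<bar>D\<bar> \<le> \<kappa>" if "t \<in> {0<..<s} - p ` {..m}" for t
  proof -
    have "t \<in> {p 0<..<p m} - p ` {..m}" using that by (simp add: p)
    then obtain i where i: "i < m" and ti: "t \<in> {p i<..<p (Suc i)}"
      using partition_cover_open by blast
    let ?D = "ivl_deriv (p i) (p (Suc i)) \<phi> t"
    have t: "t \<in> {0..s}" using that by auto
    have D: "(\<phi> has_real_derivative ?D) (at t)"
      using C1_on_ivl_interior[OF piece[OF i] ti] .
    then have "(\<phi> has_vector_derivative ?D) (at t within {0..s})"
      by (simp add: has_real_derivative_iff_has_vector_derivative has_vector_derivative_at_within)
    from has_vector_derivative_dir[OF this]
    have Td: "(T has_vector_derivative ?D *\<^sub>R dir (\<phi> t + pi / 2)) (at t within {0..s})"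
      by (rule has_vector_derivative_transform[OF t, rotated]) (simp add: \<phi>)
    then have "norm (?D *\<^sub>R dir (\<phi> t + pi / 2)) \<le> \<kappa>"
      using curv[OF t] ivl_derivI[OF s t Td] differentiableI_vector by metis
    with D show ?thesis by auto
  qed
  have lip: "\<bar>\<phi> v - \<phi> u\<bar> \<le> \<kappa> * (v - u)" if "u \<in> {0..s}" "v \<in> {0..s}" "u \<le> v" for u v
  proof -
    have "\<bar>\<phi> v - \<phi> u\<bar> \<le> integral {u..v} (\<lambda>t. \<kappa>)"
    proof (rule abs_diff_le_integral[of "p ` {..m}"])
      show "continuous_on {u..v} \<phi>" using c that continuous_on_subset[of "{0..s}" \<phi> "{u..v}"] by auto
    qed (use that bound \<open>\<kappa> \<ge> 0\<close> in auto)
    then show ?thesis using that by (simp add: mult.commute)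
  qed
  have "\<bar>\<phi> v - \<phi> u\<bar> \<le> \<kappa> * \<bar>v - u\<bar>" if "u \<in> {0..s}" "v \<in> {0..s}" for u v
    using lip[of u v] lip[of v u] that by (cases "u \<le> v") (auto simp: abs_minus_commute)
  moreover have "piecewise_C1_on_ivl 0 s \<phi>"
    unfolding piecewise_C1_on_ivl_def using p piece by (intro exI[of _ m] exI[of _ p]) auto
  ultimately have a: "angle_fun \<kappa> s \<phi>" using s by (auto simp: angle_fun_def)
  have int: "integral {0..t} (\<lambda>u. dir (\<phi> u)) = f t - x" if t: "t \<in> {0..s}" for t
  proof (rule integral_unique)
    have "(T has_integral (f t - f 0)) {0..t}"
    proof (rule fundamental_theorem_of_calculus)
      fix u assume "u \<in> {0..t}"
      then show "(f has_vector_derivative T u) (at u within {0..t})"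
        using fd[of u] t by (auto intro: has_vector_derivative_within_subset)
    qed (use t in auto)
    then show "((\<lambda>u. dir (\<phi> u)) has_integral (f t - x)) {0..t}"
      unfolding f0 by (rule has_integral_eq[rotated]) (use \<phi> t in auto)
  qed
  show thesis
  proof
    show "angle_fun \<kappa> s \<phi>" by fact
    show "x + integral {0..s} (\<lambda>t. dir (\<phi> t)) = y" using int[of s] s fs by simp
    have "f = restrict (\<lambda>t. x + integral {0..t} (\<lambda>u. dir (\<phi> u))) {0..s}"
      by (rule extensionalityI[OF ext restrict_extensional]) (simp add: int)
    then show "\<sigma> = curve_of x s \<phi>" by (simp add: sf curve_of_def)
  qed
qed

subsection \<open>Turning and the lens\<close>

text \<open>Identifies the component of a chord in direction \<open>m\<close> with the integral that
  \<open>angle_fun_sin_diff\<close> bounds from below.\<close>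

lemma curve_of_increment:
  assumes c: "continuous_on {0..s} \<phi>" and uv: "0 \<le> u" "u \<le> v" "v \<le> s"
  shows "(snd (curve_of x s \<phi>) v - snd (curve_of x s \<phi>) u) \<bullet> dir m
    = integral {u..v} (\<lambda>t. cos (\<phi> t - m))"
proof -
  have i: "(\<lambda>t. dir (\<phi> t)) integrable_on {0..v}" "(\<lambda>t. dir (\<phi> t)) integrable_on {u..v}"
    by (rule integrable_continuous_real, intro continuous_intros continuous_on_subset[OF c], use uv in auto)+
  have "integral {0..u} (\<lambda>t. dir (\<phi> t)) + integral {u..v} (\<lambda>t. dir (\<phi> t))
      = integral {0..v} (\<lambda>t. dir (\<phi> t))"
    by (rule Henstock_Kurzweil_Integration.integral_combine[OF uv(1,2) i(1)])
  then have "snd (curve_of x s \<phi>) v - snd (curve_of x s \<phi>) u = integral {u..v} (\<lambda>t. dir (\<phi> t))"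
    using uv by (simp add: curve_of_def algebra_simps)
  also have "\<dots> \<bullet> dir m = integral {u..v} ((\<lambda>a. a \<bullet> dir m) \<circ> (\<lambda>t. dir (\<phi> t)))"
    by (rule integral_linear[symmetric, OF i(2) bounded_linear_inner_left])
  finally show ?thesis by (simp add: o_def inner_dir_dir)
qed

text \<open>The closed segment makes the order of \<open>a\<close> and \<open>b\<close> immaterial,
  and the absolute value covers rises and falls alike.\<close>

lemma IVT_abs:
  fixes g :: "real \<Rightarrow> real"
  assumes "continuous_on (closed_segment a b) g" "\<bar>g b - g a\<bar> \<ge> c" "c \<ge> 0"
  shows "\<exists>t\<in>closed_segment a b. \<bar>g t - g a\<bar> = c"
proof -
  have "connected ((\<lambda>t. \<bar>g t - g a\<bar>) ` closed_segment a b)"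
    by (intro connected_continuous_image continuous_intros assms connected_segment)
  moreover have "0 \<in> (\<lambda>t. \<bar>g t - g a\<bar>) ` closed_segment a b" by (rule image_eqI[of _ _ a]) auto
  moreover have "\<bar>g b - g a\<bar> \<in> (\<lambda>t. \<bar>g t - g a\<bar>) ` closed_segment a b" by (rule image_eqI[of _ _ b]) auto
  ultimately have "c \<in> (\<lambda>t. \<bar>g t - g a\<bar>) ` closed_segment a b"
    using assms(3,2) by (rule connectedD_interval)
  then show ?thesis by auto
qed

text \<open>A pair of times at distance minimal among those where the angle differs by exactly \<open>\<pi>\<close>
  bounds a subarc on which the angle stays between its end values.\<close>

lemma half_turn_subarc:
  fixes \<phi> :: "real \<Rightarrow> real"
  assumes c: "continuous_on {0..s} \<phi>" and ab: "a \<in> {0..s}" "b \<in> {0..s}" "\<phi> b - \<phi> a > pi"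
  obtains u v where "0 \<le> u" "u \<le> v" "v \<le> s" "\<bar>\<phi> v - \<phi> u\<bar> = pi"
    "\<And>t. t \<in> {u..v} \<Longrightarrow> \<bar>\<phi> t - (\<phi> u + \<phi> v) / 2\<bar> \<le> pi / 2"
proof -
  have sub: "closed_segment t t' \<subseteq> {0..s}" if "t \<in> {0..s}" "t' \<in> {0..s}" for t t'
    using that closed_segment_subset convex_real_interval(5) by blast
  define K where "K = ({0..s} \<times> {0..s}) \<inter> (\<lambda>(t, t'). \<bar>\<phi> t' - \<phi> t\<bar>) -` {pi}"
  have cc: "continuous_on ({0..s} \<times> {0..s}) (\<lambda>(t, t'). \<bar>\<phi> t' - \<phi> t\<bar>)"
    unfolding case_prod_unfold
    by (intro continuous_intros continuous_on_compose2[OF c]) auto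
  then have "closed K"
    unfolding K_def by (intro continuous_closed_preimage closed_Times) auto
  then have "compact (({0..s} \<times> {0..s}) \<inter> K)" by (intro compact_Int_closed compact_Times) auto
  then have "compact K" by (simp add: K_def Int_absorb1)
  have "\<exists>t\<in>closed_segment a b. \<bar>\<phi> t - \<phi> a\<bar> = pi"
    using ab(3) by (intro IVT_abs continuous_on_subset[OF c sub[OF ab(1,2)]]) auto
  then obtain q where "q \<in> closed_segment a b" "\<bar>\<phi> q - \<phi> a\<bar> = pi" by blast
  then have "(a, q) \<in> K" using sub[OF ab(1,2)] ab(1) by (auto simp: K_def)
  then have "K \<noteq> {}" by blast
  have "continuous_on K (\<lambda>(t, t'). \<bar>t' - t\<bar>)"
    unfolding case_prod_unfold by (intro continuous_intros)
  from continuous_attains_inf[OF \<open>compact K\<close> \<open>K \<noteq> {}\<close> this]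
  obtain u v where uv: "(u, v) \<in> K" and min: "\<And>t t'. (t, t') \<in> K \<Longrightarrow> \<bar>v - u\<bar> \<le> \<bar>t' - t\<bar>"
    by force
  have uvs: "u \<in> {0..s}" "v \<in> {0..s}" and pi: "\<bar>\<phi> v - \<phi> u\<bar> = pi" using uv by (auto simp: K_def)
  \<comment> \<open>A difference of at least \<pi> over a shorter distance would, by the
    intermediate value theorem, yield a pair in \<open>K\<close> closer together than the minimal
    one.\<close>
  have lt: "\<bar>\<phi> t' - \<phi> t\<bar> < pi" if h: "t \<in> {0..s}" "t' \<in> {0..s}" "\<bar>t' - t\<bar> < \<bar>v - u\<bar>" for t t'
  proof (rule ccontr)
    assume "\<not> \<bar>\<phi> t' - \<phi> t\<bar> < pi"
    then obtain q where q: "q \<in> closed_segment t t'" "\<bar>\<phi> q - \<phi> t\<bar> = pi"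
      using IVT_abs[of t t' \<phi> pi] continuous_on_subset[OF c sub[OF h(1,2)]] by auto
    have "(t, q) \<in> K" using q sub[OF h(1,2)] h(1) by (auto simp: K_def)
    from min[OF this] show False using h(3) q(1)
      unfolding closed_segment_eq_real_ivl by (cases "t \<le> t'") auto
  qed
  have between: "\<bar>\<phi> t - (\<phi> u + \<phi> v) / 2\<bar> \<le> pi / 2" if "t \<in> closed_segment u v" for t
  proof (cases "t = u \<or> t = v")
    case True
    have "\<phi> u - (\<phi> u + \<phi> v) / 2 = - ((\<phi> v - \<phi> u) / 2)"
      "\<phi> v - (\<phi> u + \<phi> v) / 2 = (\<phi> v - \<phi> u) / 2" by (simp_all add: field_simps)
    then have "\<bar>\<phi> t - (\<phi> u + \<phi> v) / 2\<bar> = \<bar>(\<phi> v - \<phi> u) / 2\<bar>"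
      using True by (metis abs_minus_cancel)
    then show ?thesis using pi by simp
  next
    case False
    then have "\<bar>\<phi> t - \<phi> u\<bar> < pi" "\<bar>\<phi> v - \<phi> t\<bar> < pi"
      using lt[of u t] lt[of t v] that uvs unfolding closed_segment_eq_real_ivl
      by (cases "u \<le> v"; auto)+
    moreover have "\<phi> t - (\<phi> u + \<phi> v) / 2 = ((\<phi> t - \<phi> u) - (\<phi> v - \<phi> t)) / 2"
      by (simp add: field_simps)
    moreover have "\<phi> v - \<phi> u = (\<phi> t - \<phi> u) + (\<phi> v - \<phi> t)" by simp
    \<comment> \<open>Two numbers smaller in size than |A + B| have the sign of their sum, so the
      angle at \<open>t\<close> lies between the end values.\<close>
    moreover have "\<bar>(A - B) / 2\<bar> \<le> p / 2" if "\<bar>A\<bar> < p" "\<bar>B\<bar> < p" "\<bar>A + B\<bar> = p" for A B p :: real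
      using that by (auto simp: abs_if field_simps split: if_splits)
    ultimately show ?thesis using pi by metis
  qed
  show thesis
  proof (cases "u \<le> v")
    case True
    show thesis by (rule that[of u v]) (use True between pi uvs closed_segment_eq_real_ivl in auto)
  next
    case False
    show thesis by (rule that[of v u])
      (use False between pi uvs in \<open>simp_all add: closed_segment_eq_real_ivl add.commute abs_minus_commute\<close>)
  qed
qed

text \<open>For \<open>m\<close> the middle angle of the half turn, sin (\<phi> - m) passes between
  -1 and 1 while the curve never moves backwards along \<open>m\<close>. The change by 2 forces
  progress of at least 2 / \<kappa> along \<open>m\<close>; a semicircle attains it.\<close>

lemma long_chord:
  assumes \<phi>: "angle_fun \<kappa> s \<phi>" and "\<kappa> > 0"
    and ab: "a \<in> {0..s}" "b \<in> {0..s}" "\<phi> b - \<phi> a > pi"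
  obtains u v where "u \<in> {0..s}" "v \<in> {0..s}"
    "dist (snd (curve_of x s \<phi>) u) (snd (curve_of x s \<phi>) v) \<ge> 2 / \<kappa>"
proof -
  note c = angle_fun_continuous[OF \<phi>]
  obtain u v where uv: "0 \<le> u" "u \<le> v" "v \<le> s" and pi: "\<bar>\<phi> v - \<phi> u\<bar> = pi"
    and bt: "\<And>t. t \<in> {u..v} \<Longrightarrow> \<bar>\<phi> t - (\<phi> u + \<phi> v) / 2\<bar> \<le> pi / 2"
    using half_turn_subarc[OF c ab] by metis
  define m where "m = (\<phi> u + \<phi> v) / 2"
  have v: "\<phi> v - m = (\<phi> v - \<phi> u) / 2" and u: "\<phi> u - m = - ((\<phi> v - \<phi> u) / 2)"
    by (simp_all add: m_def field_simps)
  have "\<phi> v - \<phi> u = pi \<or> \<phi> v - \<phi> u = - pi" using pi by linarith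
  then have "\<bar>sin (\<phi> v - m) - sin (\<phi> u - m)\<bar> = 2"
    unfolding v u sin_minus by auto
  moreover have "\<bar>sin (\<phi> v - m) - sin (\<phi> u - m)\<bar> \<le> \<kappa> * integral {u..v} (\<lambda>t. cos (\<phi> t - m))"
  proof (rule angle_fun_sin_diff[OF \<phi> uv])
    fix t assume "t \<in> {u..v}"
    from bt[OF this] show "cos (\<phi> t - m) \<ge> 0" unfolding m_def
      by (intro cos_ge_zero) linarith+
  qed (use \<open>\<kappa> > 0\<close> in simp)
  ultimately have "2 / \<kappa> \<le> (snd (curve_of x s \<phi>) v - snd (curve_of x s \<phi>) u) \<bullet> dir m"
    unfolding curve_of_increment[OF c uv] using \<open>\<kappa> > 0\<close> by (simp add: field_simps)
  also have "\<dots> \<le> dist (snd (curve_of x s \<phi>) u) (snd (curve_of x s \<phi>) v)"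
    using norm_cauchy_schwarz[of "snd (curve_of x s \<phi>) v - snd (curve_of x s \<phi>) u" "dir m"]
    by (simp add: dist_norm norm_minus_commute)
  finally show thesis using that[of u v] uv by auto
qed

text \<open>Let \<open>m\<close> be the middle of the range of angles and \<alpha> half its width.
  Passing between the extreme angles costs progress 2 sin \<alpha> / \<kappa> along
  \<open>m\<close>, but the whole curve advances there by only
  \<open>d * cos (\<phi>\<^sub>0 - m)\<close>. As d < 2 / \<kappa>, this gives
  \<open>sin \<alpha> < cos (\<phi>\<^sub>0 - m)\<close>: modulo full turns the chord is within less
  than \<pi>/2 - \<alpha> of \<open>m\<close>, hence within less than \<pi>/2 of every
  tangent.\<close>

lemma small_turn_forward:
  assumes \<phi>: "angle_fun \<kappa> s \<phi>" and "\<kappa> > 0"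
    and w: "snd (curve_of x s \<phi>) s - x = d *\<^sub>R dir \<phi>\<^sub>0" and d: "0 < d" "d < 2 / \<kappa>"
    and osc: "\<And>a b. a \<in> {0..s} \<Longrightarrow> b \<in> {0..s} \<Longrightarrow> \<phi> b - \<phi> a \<le> pi"
    and t: "t \<in> {0..s}"
  shows "cos (\<phi> t - \<phi>\<^sub>0) > 0"
proof -
  note c = angle_fun_continuous[OF \<phi>]
  have s: "s > 0" using \<phi> by (simp add: angle_fun_def)
  obtain a where a: "a \<in> {0..s}" "\<And>u. u \<in> {0..s} \<Longrightarrow> \<phi> a \<le> \<phi> u"
    using continuous_attains_inf[OF _ _ c] s by auto
  obtain b where b: "b \<in> {0..s}" "\<And>u. u \<in> {0..s} \<Longrightarrow> \<phi> u \<le> \<phi> b"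
    using continuous_attains_sup[OF _ _ c] s by auto
  define m \<alpha> where "m = (\<phi> a + \<phi> b) / 2" and "\<alpha> = (\<phi> b - \<phi> a) / 2"
  have \<alpha>: "0 \<le> \<alpha>" "\<alpha> \<le> pi / 2" using osc[OF a(1) b(1)] a(2)[OF b(1)] by (auto simp: \<alpha>_def)
  have near: "\<bar>\<phi> u - m\<bar> \<le> \<alpha>" if "u \<in> {0..s}" for u
    using a(2)[OF that] b(2)[OF that] unfolding m_def \<alpha>_def abs_le_iff by (simp add: field_simps)
  have pos: "cos (\<phi> u - m) \<ge> cos \<alpha>" if "u \<in> {0..s}" for u
    using near[OF that] \<alpha> by (metis abs_ge_zero cos_abs_real cos_mono_le_eq
        order.trans field_sum_of_halves le_add_same_cancel1 pi_half_ge_zero)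
  have c\<alpha>: "cos \<alpha> \<ge> 0" using \<alpha> by (intro cos_ge_zero) auto
  have s\<alpha>: "sin \<alpha> \<ge> 0" using \<alpha> by (intro sin_ge_zero) auto
  \<comment> \<open>The total progress along \<open>m\<close>: it is determined by the chord, and as
    the integral of a nonnegative function it dominates the progress over each subinterval.\<close>
  define J where "J = integral {0..s} (\<lambda>u. cos (\<phi> u - m))"
  have J: "J = d * cos (\<phi>\<^sub>0 - m)"
    using curve_of_increment[OF c, of 0 s x m] w s
    by (simp add: J_def curve_of_def inner_dir_dir)
  have pos0: "cos (\<phi> u - m) \<ge> 0" if "u \<in> {0..s}" for u
    using pos[OF that] c\<alpha> by linarith
  have sub: "integral {u..v} (\<lambda>u. cos (\<phi> u - m)) \<le> J" if "0 \<le> u" "v \<le> s" for u v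
    unfolding J_def
  proof (rule integral_subset_le)
    show "(\<lambda>u. cos (\<phi> u - m)) integrable_on {u..v}"
      by (rule integrable_continuous_real) (intro continuous_intros continuous_on_subset[OF c], use that in auto)
    show "(\<lambda>u. cos (\<phi> u - m)) integrable_on {0..s}"
      by (rule integrable_continuous_real) (intro continuous_intros c)
  qed (use that pos0 in auto)
  have m: "\<phi> b - m = \<alpha>" "\<phi> a - m = - \<alpha>" by (simp_all add: m_def \<alpha>_def field_simps)
  have "2 * sin \<alpha> \<le> \<kappa> * J"
  proof (cases "a \<le> b")
    case True
    have "\<bar>sin (\<phi> b - m) - sin (\<phi> a - m)\<bar> \<le> \<kappa> * integral {a..b} (\<lambda>t. cos (\<phi> t - m))"
      by (rule angle_fun_sin_diff[OF \<phi>]) (use a b True \<open>\<kappa> > 0\<close> pos0 in auto)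
    also have "\<dots> \<le> \<kappa> * J" using sub[of a b] a b \<open>\<kappa> > 0\<close> by simp
    finally show ?thesis unfolding m by simp
  next
    case False
    have "\<bar>sin (\<phi> a - m) - sin (\<phi> b - m)\<bar> \<le> \<kappa> * integral {b..a} (\<lambda>t. cos (\<phi> t - m))"
      by (rule angle_fun_sin_diff[OF \<phi>]) (use a b False \<open>\<kappa> > 0\<close> pos0 in auto)
    also have "\<dots> \<le> \<kappa> * J" using sub[of b a] a b \<open>\<kappa> > 0\<close> by simp
    finally show ?thesis unfolding m by simp
  qed
  then have le: "2 * sin \<alpha> \<le> \<kappa> * d * cos (\<phi>\<^sub>0 - m)" by (simp add: J)
  have kd: "0 < \<kappa> * d" "\<kappa> * d < 2" using d \<open>\<kappa> > 0\<close> by (auto simp: field_simps)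
  have gt: "sin \<alpha> < cos (\<phi>\<^sub>0 - m)"
  \<comment> \<open>For \<alpha> = 0 the previous estimate only gives a weak inequality; strictness
    comes from the positive length of a straight curve.\<close>
  proof (cases "\<alpha> = 0")
    case True
    have "J = integral {0..s} (\<lambda>u. 1)"
      unfolding J_def using near True by (intro Henstock_Kurzweil_Integration.integral_cong) auto
    then have "J > 0" using s by simp
    then show ?thesis using True d by (simp add: J zero_less_mult_iff)
  next
    case False
    then have "sin \<alpha> > 0" using \<alpha> by (intro sin_gt_zero) auto
    then have "\<kappa> * d * cos (\<phi>\<^sub>0 - m) > 0" using le by linarith
    then have "cos (\<phi>\<^sub>0 - m) > 0" using kd by (simp add: zero_less_mult_iff)
    then have "\<kappa> * d * cos (\<phi>\<^sub>0 - m) < 2 * cos (\<phi>\<^sub>0 - m)" using kd by simp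
    then show ?thesis using le by linarith
  qed
  \<comment> \<open>The angle of the chord is known only modulo full turns, so the conclusion is
    drawn from sines and cosines instead of comparing angles.\<close>
  define \<delta> \<eta> where "\<delta> = \<phi> t - m" and "\<eta> = \<phi>\<^sub>0 - m"
  have "cos \<alpha> \<noteq> 0"
  proof
    assume "cos \<alpha> = 0"
    then have "(sin \<alpha>)\<^sup>2 = 1" using sin_cos_squared_add[of \<alpha>] by simp
    then have "sin \<alpha> = 1" using s\<alpha> by (simp add: power2_eq_1_iff)
    then show False using gt cos_le_one[of "\<phi>\<^sub>0 - m"] by linarith
  qed
  then have c\<alpha>': "cos \<alpha> > 0" using c\<alpha> by simp
  have "\<bar>sin \<delta>\<bar> \<le> sin \<alpha>"
  proof -
    have "(cos \<alpha>)\<^sup>2 \<le> (cos \<delta>)\<^sup>2" using pos[OF t] c\<alpha> by (intro power_mono) (auto simp: \<delta>_def)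
    then have "(sin \<delta>)\<^sup>2 \<le> (sin \<alpha>)\<^sup>2" using sin_cos_squared_add[of \<alpha>] sin_cos_squared_add[of \<delta>] by linarith
    then show ?thesis using s\<alpha> abs_le_square_iff[of "sin \<delta>" "sin \<alpha>"] by simp
  qed
  moreover have "\<bar>sin \<eta>\<bar> \<le> cos \<alpha>"
  proof -
    have "(sin \<alpha>)\<^sup>2 \<le> (cos \<eta>)\<^sup>2" using gt s\<alpha> by (intro power_mono) (auto simp: \<eta>_def)
    then have "(sin \<eta>)\<^sup>2 \<le> (cos \<alpha>)\<^sup>2" using sin_cos_squared_add[of \<alpha>] sin_cos_squared_add[of \<eta>] by linarith
    then show ?thesis using c\<alpha> abs_le_square_iff[of "sin \<eta>" "cos \<alpha>"] by simp
  qed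
  ultimately have "\<bar>sin \<delta> * sin \<eta>\<bar> \<le> sin \<alpha> * cos \<alpha>"
    unfolding abs_mult by (intro mult_mono) (use s\<alpha> in auto)
  also have "\<dots> < cos \<eta> * cos \<alpha>" using gt c\<alpha>' by (simp add: \<eta>_def)
  also have "\<dots> \<le> cos \<eta> * cos \<delta>"
    using pos[OF t] gt s\<alpha> by (intro mult_left_mono) (auto simp: \<eta>_def \<delta>_def)
  finally have "cos \<delta> * cos \<eta> + sin \<delta> * sin \<eta> > 0" by (simp add: mult.commute)
  then have "cos (\<delta> - \<eta>) > 0" by (simp add: cos_diff)
  then show ?thesis by (simp add: \<delta>_def \<eta>_def)
qed

text \<open>\<open>S\<close>, \<open>C\<close> and \<open>X\<close>, \<open>Q\<close> are sine and
  cosine of two angles in [-\<pi>/2, \<pi>/2]. If the sum of the sines is nonnegative, so is the sum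
  of the angles, and the conclusion is the sine of that sum.\<close>

lemma arc_slope_sign:
  fixes S C X Q :: real
  assumes "S\<^sup>2 + C\<^sup>2 = 1" "X\<^sup>2 + Q\<^sup>2 = 1" "0 \<le> C" "0 \<le> Q" "0 \<le> S + X"
  shows "0 \<le> S * Q + X * C"
proof -
  consider "0 \<le> S" "0 \<le> X" | "S < 0" | "X < 0" by linarith
  then show ?thesis
  proof cases
    case 2
    have "\<bar>S\<bar>\<^sup>2 \<le> X\<^sup>2" using 2 assms by (intro power_mono) auto
    then have "Q\<^sup>2 \<le> C\<^sup>2" using assms(1,2) by simp
    then have "Q \<le> C" using assms(3) by (rule power2_le_imp_le)
    then have "- S * Q \<le> X * C" using 2 assms by (intro mult_mono) auto
    then show ?thesis by simp
  next
    case 3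
    have "\<bar>X\<bar>\<^sup>2 \<le> S\<^sup>2" using 3 assms by (intro power_mono) auto
    then have "C\<^sup>2 \<le> Q\<^sup>2" using assms(1,2) by simp
    then have "C \<le> Q" using assms(4) by (rule power2_le_imp_le)
    then have "- X * C \<le> S * Q" using 3 assms by (intro mult_mono) auto
    then show ?thesis by simp
  qed (use assms in auto)
qed

text \<open>The height of the curve above the upper boundary arc of the lens is nonincreasing while
  \<open>sin \<psi> + \<kappa> U \<le> 0\<close> and nondecreasing while \<open>sin \<psi> + \<kappa> U \<ge> 0\<close>; since that quantity is monotone and
  the height vanishes at both ends, the height is never positive.\<close>

lemma below_upper_arc:
  fixes \<psi> U Y :: "real \<Rightarrow> real"
  assumes r: "r > 0"
    and U: "\<And>t. t \<in> {0..s} \<Longrightarrow> (U has_real_derivative cos (\<psi> t)) (at t within {0..s})"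
    and Y: "\<And>t. t \<in> {0..s} \<Longrightarrow> (Y has_real_derivative sin (\<psi> t)) (at t within {0..s})"
    and cos: "\<And>t. t \<in> {0..s} \<Longrightarrow> 0 \<le> cos (\<psi> t)"
    and mono: "\<And>t t'. 0 \<le> t \<Longrightarrow> t \<le> t' \<Longrightarrow> t' \<le> s \<Longrightarrow>
        sin (\<psi> t) + U t / r \<le> sin (\<psi> t') + U t' / r"
    and bd: "\<And>t. t \<in> {0..s} \<Longrightarrow> \<bar>U t\<bar> < r"
    and ends: "Y 0 \<le> sqrt (r\<^sup>2 - (U 0)\<^sup>2) - k" "Y s \<le> sqrt (r\<^sup>2 - (U s)\<^sup>2) - k"
    and t: "t \<in> {0..s}"
  shows "Y t \<le> sqrt (r\<^sup>2 - (U t)\<^sup>2) - k"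
proof -
  define q where "q t = sqrt (r\<^sup>2 - (U t)\<^sup>2)" for t
  define G where "G t = Y t - q t" for t
  have pos: "r\<^sup>2 - (U t)\<^sup>2 > 0" if "t \<in> {0..s}" for t
  proof -
    have "\<bar>U t\<bar>\<^sup>2 < r\<^sup>2" using bd[OF that] by (intro power_strict_mono) auto
    then show ?thesis by simp
  qed
  have qpos: "q t > 0" if "t \<in> {0..s}" for t using pos[OF that] by (simp add: q_def)
  have dG: "(G has_real_derivative sin (\<psi> t) + U t * cos (\<psi> t) / q t) (at t within {0..s})"
    if t: "t \<in> {0..s}" for t
    unfolding G_def q_def using pos[OF t] 
    by (auto intro!: derivative_eq_intros U[OF t] Y[OF t] simp: field_simps power2_eq_square)
  \<comment> \<open>Up to the positive factor r / q, the slope of the height is the sine of the sum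
    of \<psi> and the angle with sine U / r and cosine q / r, which \<open>arc_slope_sign\<close>
    handles. Negating both sines gives the opposite sign.\<close>
  have eq: "sin (\<psi> t) + U t * cos (\<psi> t) / q t = (sin (\<psi> t) * (q t / r) + U t / r * cos (\<psi> t)) * (r / q t)"
    if "t \<in> {0..s}" for t using qpos[OF that] r by (simp add: field_simps)
  have unit: "(U t / r)\<^sup>2 + (q t / r)\<^sup>2 = 1" if "t \<in> {0..s}" for t
    using pos[OF that] r by (simp add: q_def power_divide flip: add_divide_distrib)
  have up: "0 \<le> sin (\<psi> t) + U t * cos (\<psi> t) / q t" if "t \<in> {0..s}" "0 \<le> sin (\<psi> t) + U t / r" for t
    unfolding eq[OF that(1)]
    using arc_slope_sign[of "sin (\<psi> t)" "cos (\<psi> t)" "U t / r" "q t / r"] unit[OF that(1)]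
      cos[OF that(1)] qpos[OF that(1)] r that(2) by (intro mult_nonneg_nonneg) auto
  have down: "sin (\<psi> t) + U t * cos (\<psi> t) / q t \<le> 0" if "t \<in> {0..s}" "sin (\<psi> t) + U t / r \<le> 0" for t
    unfolding eq[OF that(1)]
    using arc_slope_sign[of "- sin (\<psi> t)" "cos (\<psi> t)" "- U t / r" "q t / r"] unit[OF that(1)]
      cos[OF that(1)] qpos[OF that(1)] r that(2) by (intro mult_nonpos_nonneg) auto
  have cont: "continuous_on {a..b} G" if "0 \<le> a" "b \<le> s" for a b
    using dG that by (intro continuous_on_subset[OF DERIV_continuous_on[of "{0..s}" G]]) auto
  have dG': "(G has_real_derivative sin (\<psi> t) + U t * cos (\<psi> t) / q t) (at t)"
    if t: "0 < t" "t < s" for t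
    using dG[of t] t by (simp add: at_within_Icc_at)
  show ?thesis
  proof (cases "0 \<le> sin (\<psi> t) + U t / r")
    case True
    have "G t \<le> G s"
    proof (rule DERIV_nonneg_imp_increasing_open[of t s G])
      fix u assume u: "t < u" "u < s"
      have "0 \<le> sin (\<psi> u) + U u / r" using mono[of t u] u t True by auto
      then show "\<exists>y. (G has_real_derivative y) (at u) \<and> 0 \<le> y"
        using dG'[of u] up[of u] u t by auto
    qed (use t cont in auto)
    then show ?thesis using ends by (simp add: G_def q_def)
  next
    case False
    have "G 0 \<ge> G t"
    proof (rule DERIV_nonpos_imp_decreasing_open[of 0 t G])
      fix u assume u: "0 < u" "u < t"
      have "sin (\<psi> u) + U u / r \<le> 0" using mono[of u t] u t False by auto
      then show "\<exists>y. (G has_real_derivative y) (at u) \<and> y \<le> 0"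
        using dG'[of u] down[of u] u t by auto
    qed (use t cont in auto)
    then show ?thesis using ends by (simp add: G_def q_def)
  qed
qed

section \<open>Coordinates along the chord and the shape of the lens\<close>

lemma real2_eq_dir:
  fixes w :: "real^2"
  obtains a where "w = norm w *\<^sub>R dir a"
proof (cases "w = 0")
  case False
  define z where "z = Complex (w$1) (w$2)"
  have "norm z = norm w" by (simp add: z_def cmod_def norm_real2)
  then have "z = of_real (norm w) * cis (Arg z)" using rcis_cmod_Arg[of z] by (simp add: rcis_def)
  then have "w = norm w *\<^sub>R dir (Arg z)"
    by (simp add: vec_eq_iff forall_2 z_def complex_eq_iff)
  then show thesis by (rule that)
qed (use that in auto)

lemma real2_dir_eqI:
  fixes v w :: "real^2"
  assumes "v \<bullet> dir a = w \<bullet> dir a" "v \<bullet> dir (a + pi/2) = w \<bullet> dir (a + pi/2)"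
  shows "v = w"
proof -
  define z where "z = v - w"
  have z: "z$1 * cos a + z$2 * sin a = 0" "- z$1 * sin a + z$2 * cos a = 0"
    using assms by (auto simp: inner_real2 z_def cos_add sin_add algebra_simps)
  have "z$1 = cos a * (z$1 * cos a + z$2 * sin a) - sin a * (- z$1 * sin a + z$2 * cos a)"
    using sin_cos_squared_add[of a] by algebra
  moreover have "z$2 = sin a * (z$1 * cos a + z$2 * sin a) + cos a * (- z$1 * sin a + z$2 * cos a)"
    using sin_cos_squared_add[of a] by algebra
  ultimately have "z = 0" unfolding z by (simp add: vec_eq_iff forall_2)
  then show ?thesis by (simp add: z_def)
qed

lemma norm_sq_dir:
  fixes v :: "real^2"
  shows "(norm v)\<^sup>2 = (v \<bullet> dir a)\<^sup>2 + (v \<bullet> dir (a + pi/2))\<^sup>2"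
proof -
  have "(p * c + q * s)\<^sup>2 + (q * c - p * s)\<^sup>2 = (p\<^sup>2 + q\<^sup>2) * (s\<^sup>2 + c\<^sup>2)" for p q c s :: real
    by algebra
  from this[of "v$1" "cos a" "v$2" "sin a"]
  show ?thesis by (simp add: norm_real2 inner_real2 cos_add sin_add)
qed

text \<open>A centre equidistant from \<open>x\<close> and \<open>y\<close> lies on the
  perpendicular bisector, at distance \<open>k\<close> from the midpoint, which leaves two
  candidates. The centres differ, since two equal circles would share more than two points.\<close>

lemma two_circles_centres:
  fixes x y c1 c2 :: "real^2"
  assumes d: "0 < dist x y" "dist x y < 2 * r" and I: "sphere c1 r \<inter> sphere c2 r = {x, y}"
    and \<phi>: "y - x = dist x y *\<^sub>R dir \<phi>\<^sub>0"
  defines "k \<equiv> sqrt (r\<^sup>2 - (dist x y / 2)\<^sup>2)" and "m \<equiv> (1/2) *\<^sub>R (x + y)"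
    and "n \<equiv> dir (\<phi>\<^sub>0 + pi/2)"
  shows "{c1, c2} = {m + k *\<^sub>R n, m - k *\<^sub>R n}"
proof -
  have r: "r > 0" using d by linarith
  have dr: "(dist x y / 2)\<^sup>2 < r\<^sup>2" using d by (intro power_strict_mono) auto
  have k2: "k\<^sup>2 = r\<^sup>2 - (dist x y / 2)\<^sup>2" using dr by (simp add: k_def)
  have centre: "c = m + k *\<^sub>R n \<or> c = m - k *\<^sub>R n" if "x \<in> sphere c r" "y \<in> sphere c r" for c
  proof -
    define v where "v = c - m"
    define e where "e = (dist x y / 2) *\<^sub>R dir \<phi>\<^sub>0"
    have e: "c - x = v + e" "c - y = v - e"
    proof -
      have "e = (1/2) *\<^sub>R (y - x)" unfolding e_def \<phi> by simp
      then show "c - x = v + e" "c - y = v - e" by (simp_all add: v_def m_def vec_eq_iff field_simps)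
    qed
    have "(norm (v + e))\<^sup>2 = r\<^sup>2" "(norm (v - e))\<^sup>2 = r\<^sup>2"
      using that by (simp_all add: dist_norm e)
    then have "v \<bullet> e = 0" "(norm v)\<^sup>2 = r\<^sup>2 - (norm e)\<^sup>2"
      by (auto simp: power2_norm_eq_inner inner_add_left inner_add_right inner_diff_left inner_diff_right inner_commute)
    then have v0: "v \<bullet> dir \<phi>\<^sub>0 = 0" and v: "(norm v)\<^sup>2 = k\<^sup>2" using d by (auto simp: e_def k2)
    have "(v \<bullet> n)\<^sup>2 = k\<^sup>2" using norm_sq_dir[of v \<phi>\<^sub>0] v0 v by (simp add: n_def)
    then have "v \<bullet> n = k \<or> v \<bullet> n = - k" by (simp add: power2_eq_iff)
    then have "v = k *\<^sub>R n \<or> v = - k *\<^sub>R n"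
      using real2_dir_eqI[of v \<phi>\<^sub>0 "k *\<^sub>R n"] real2_dir_eqI[of v \<phi>\<^sub>0 "- k *\<^sub>R n"] v0
      by (auto simp: n_def inner_dir_dir)
    then show ?thesis by (auto simp: v_def algebra_simps)
  qed
  have "c1 \<noteq> c2"
  proof
    assume "c1 = c2"
    then have S: "sphere c1 r = {x, y}" using I by simp
    \<comment> \<open>The antipode of \<open>x\<close> on the common circle: at distance 2 r from
      \<open>x\<close>, it can be neither \<open>x\<close> nor \<open>y\<close>.\<close>
    define z where "z = 2 *\<^sub>R c1 - x"
    have "x \<in> sphere c1 r" unfolding S by simp
    then have "dist c1 x = r" by simp
    have "z - c1 = c1 - x" by (simp add: z_def algebra_simps scaleR_2)
    with \<open>dist c1 x = r\<close> have "dist c1 z = r" by (metis dist_commute dist_norm)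
    then have "z \<in> {x, y}" unfolding S[symmetric] by simp
    moreover have "dist x z = 2 * r"
    proof -
      have "x - z = 2 *\<^sub>R (x - c1)" by (simp add: z_def algebra_simps scaleR_2)
      then show ?thesis using \<open>dist c1 x = r\<close> by (simp add: dist_norm norm_minus_commute)
    qed
    ultimately have "dist x y = 2 * r \<or> 2 * r = 0" by auto
    then show False using d r by linarith
  qed
  have "{x, y} \<subseteq> sphere c1 r" "{x, y} \<subseteq> sphere c2 r" using I by blast+
  then have "c1 = m + k *\<^sub>R n \<or> c1 = m - k *\<^sub>R n" "c2 = m + k *\<^sub>R n \<or> c2 = m - k *\<^sub>R n"
    using centre[of c1] centre[of c2] by blast+
  with \<open>c1 \<noteq> c2\<close> show ?thesis by (elim disjE) (simp_all add: insert_commute)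
qed

text \<open>The midpoint of the chord lies in both open discs by strict convexity, so the lens is a
  closed convex set with nonempty interior.\<close>

lemma closure_interior_lens:
  fixes x y :: "real^2"
  assumes "0 < dist x y" "sphere c1 r \<inter> sphere c2 r = {x, y}"
  shows "closure (interior (cball c1 r \<inter> cball c2 r)) = cball c1 r \<inter> cball c2 r"
proof -
  have "x \<noteq> y" using assms by auto
  have "midpoint x y \<in> ball c r" if "dist c x = r" "dist c y = r" for c
    using dist_decreases_open_segment[of "midpoint x y" x y c] \<open>x \<noteq> y\<close> that by auto
  moreover have "{x, y} \<subseteq> sphere c1 r" "{x, y} \<subseteq> sphere c2 r" using assms(2) by blast+
  ultimately have "midpoint x y \<in> ball c1 r \<inter> ball c2 r" by simp
  then have "interior (cball c1 r \<inter> cball c2 r) \<noteq> {}" by auto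
  then have "closure (interior (cball c1 r \<inter> cball c2 r)) = closure (cball c1 r \<inter> cball c2 r)"
    by (intro convex_closure_interior convex_Int convex_cball)
  then show ?thesis by (simp add: closed_Int)
qed

text \<open>The binding disc is the one centred on the other side of the chord: seen from its
  centre, \<open>p\<close> has transversal distance |Y| + k. The formula is also independent of
  which disc is called the first.\<close>

lemma lens_alt:
  fixes x y c1 c2 :: "real^2"
  assumes d: "0 < dist x y" "dist x y < 2 * r" and I: "sphere c1 r \<inter> sphere c2 r = {x, y}"
    and \<phi>: "y - x = dist x y *\<^sub>R dir \<phi>\<^sub>0"
  defines "k \<equiv> sqrt (r\<^sup>2 - (dist x y / 2)\<^sup>2)" and "m \<equiv> (1/2) *\<^sub>R (x + y)"
  shows "p \<in> cball c1 r \<inter> cball c2 r \<longleftrightarrow>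
    ((p - m) \<bullet> dir \<phi>\<^sub>0)\<^sup>2 + (\<bar>(p - m) \<bullet> dir (\<phi>\<^sub>0 + pi/2)\<bar> + k)\<^sup>2 \<le> r\<^sup>2"
proof -
  let ?n = "dir (\<phi>\<^sub>0 + pi/2)"
  have r: "r > 0" using d by linarith
  have "(dist x y / 2)\<^sup>2 < r\<^sup>2" using d by (intro power_strict_mono) auto
  then have k: "k > 0" by (simp add: k_def)
  define U Y where "U = (p - m) \<bullet> dir \<phi>\<^sub>0" and "Y = (p - m) \<bullet> ?n"
  have cb: "p \<in> cball (m + h *\<^sub>R ?n) r \<longleftrightarrow> U\<^sup>2 + (Y - h)\<^sup>2 \<le> r\<^sup>2" for h
  proof -
    have "p \<in> cball (m + h *\<^sub>R ?n) r \<longleftrightarrow> norm ((p - m) - h *\<^sub>R ?n) \<le> r"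
      by (simp add: dist_norm norm_minus_commute algebra_simps)
    also have "\<dots> \<longleftrightarrow> (norm ((p - m) - h *\<^sub>R ?n))\<^sup>2 \<le> r\<^sup>2"
      using r by (simp add: abs_le_square_iff[symmetric])
    also have "(norm ((p - m) - h *\<^sub>R ?n))\<^sup>2 = U\<^sup>2 + (Y - h)\<^sup>2"
      unfolding norm_sq_dir[of _ \<phi>\<^sub>0] inner_diff_left[of "p - m"]
      by (simp add: U_def Y_def inner_dir_dir)
    finally show ?thesis .
  qed
  have "{c1, c2} = {m + k *\<^sub>R ?n, m - k *\<^sub>R ?n}"
    unfolding k_def m_def by (rule two_circles_centres[OF d I \<phi>])
  then have "cball c1 r \<inter> cball c2 r = cball (m + k *\<^sub>R ?n) r \<inter> cball (m + (- k) *\<^sub>R ?n) r"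
    by (auto simp: doubleton_eq_iff)
  then have "p \<in> cball c1 r \<inter> cball c2 r \<longleftrightarrow> U\<^sup>2 + (Y - k)\<^sup>2 \<le> r\<^sup>2 \<and> U\<^sup>2 + (Y - (- k))\<^sup>2 \<le> r\<^sup>2"
    unfolding cb[symmetric] by simp
  also have "\<dots> \<longleftrightarrow> U\<^sup>2 + (\<bar>Y\<bar> + k)\<^sup>2 \<le> r\<^sup>2"
  proof (cases "Y \<ge> 0")
    case True
    then have "(Y - k)\<^sup>2 \<le> (Y + k)\<^sup>2" using k by (simp add: power2_eq_square algebra_simps)
    then show ?thesis using True by auto
  next
    case False
    then have "(Y + k)\<^sup>2 \<le> (Y - k)\<^sup>2" using k
      by (simp add: power2_eq_square algebra_simps mult_nonpos_nonneg)
    moreover have "(\<bar>Y\<bar> + k)\<^sup>2 = (Y - k)\<^sup>2" using False by (simp add: power2_commute)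
    ultimately show ?thesis by auto
  qed
  finally show ?thesis by (simp add: U_def Y_def)
qed

text \<open>Dropping the term 2 |Y| k in the description of the lens shows that it is contained in
  the disc whose diameter is the chord.\<close>

lemma lens_diameter:
  fixes x y c1 c2 :: "real^2"
  assumes d: "0 < dist x y" "dist x y < 2 * r" and I: "sphere c1 r \<inter> sphere c2 r = {x, y}"
    and pq: "p \<in> cball c1 r \<inter> cball c2 r" "q \<in> cball c1 r \<inter> cball c2 r"
  shows "dist p q < 2 * r"
proof -
  obtain \<phi>\<^sub>0 where \<phi>: "y - x = dist x y *\<^sub>R dir \<phi>\<^sub>0"
    using real2_eq_dir[of "y - x"] by (metis dist_norm norm_minus_commute)
  define k where "k = sqrt (r\<^sup>2 - (dist x y / 2)\<^sup>2)"
  define m where "m = (1/2) *\<^sub>R (x + y)"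
  have "(dist x y / 2)\<^sup>2 < r\<^sup>2" using d by (intro power_strict_mono) auto
  then have k: "k > 0" "k\<^sup>2 = r\<^sup>2 - (dist x y / 2)\<^sup>2" by (simp_all add: k_def)
  have near: "norm (p - m) \<le> dist x y / 2" if "p \<in> cball c1 r \<inter> cball c2 r" for p
  proof -
    define U Y where "U = (p - m) \<bullet> dir \<phi>\<^sub>0" and "Y = (p - m) \<bullet> dir (\<phi>\<^sub>0 + pi/2)"
    have "U\<^sup>2 + (\<bar>Y\<bar> + k)\<^sup>2 \<le> r\<^sup>2"
      using that unfolding lens_alt[OF d I \<phi>] U_def Y_def k_def m_def .
    moreover have "(\<bar>Y\<bar> + k)\<^sup>2 = Y\<^sup>2 + k\<^sup>2 + 2 * \<bar>Y\<bar> * k" by (simp add: power2_sum)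
    moreover have "2 * \<bar>Y\<bar> * k \<ge> 0" using k by simp
    ultimately have "(norm (p - m))\<^sup>2 \<le> (dist x y / 2)\<^sup>2"
      unfolding norm_sq_dir[of _ \<phi>\<^sub>0] U_def[symmetric] Y_def[symmetric] using k by linarith
    then show ?thesis by (rule power2_le_imp_le) (use d in simp)
  qed
  have "dist p q \<le> norm (p - m) + norm (q - m)"
    using norm_triangle_ineq4[of "p - m" "q - m"] by (simp add: dist_norm)
  then show ?thesis using near[OF pq(1)] near[OF pq(2)] d by linarith
qed

text \<open>In coordinates \<open>U\<close> along and \<open>Y\<close> across the chord, centred at
  its midpoint, forward motion keeps |U| at most half the chord. Both ends of the curve lie on both
  boundary arcs, so the comparison with an arc applies to each side.\<close>

lemma forward_curve_in_lens:
  fixes x y c1 c2 :: "real^2"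
  assumes \<kappa>: "\<kappa> > 0" and r: "r = 1 / \<kappa>"
    and d: "0 < dist x y" "dist x y < 2 * r" and I: "sphere c1 r \<inter> sphere c2 r = {x, y}"
    and \<phi>0: "y - x = dist x y *\<^sub>R dir \<phi>\<^sub>0"
    and \<phi>: "angle_fun \<kappa> s \<phi>" and y: "snd (curve_of x s \<phi>) s = y"
    and fwd: "\<And>t. t \<in> {0..s} \<Longrightarrow> 0 < cos (\<phi> t - \<phi>\<^sub>0)"
    and t: "t \<in> {0..s}"
  shows "snd (curve_of x s \<phi>) t \<in> cball c1 r \<inter> cball c2 r"
proof -
  note c = angle_fun_continuous[OF \<phi>]
  define f where "f = snd (curve_of x s \<phi>)"
  define \<psi> where "\<psi> t = \<phi> t - \<phi>\<^sub>0" for t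
  define k where "k = sqrt (r\<^sup>2 - (dist x y / 2)\<^sup>2)"
  define m where "m = (1/2) *\<^sub>R (x + y)"
  define U Y where "U t = (f t - m) \<bullet> dir \<phi>\<^sub>0" and "Y t = (f t - m) \<bullet> dir (\<phi>\<^sub>0 + pi/2)" for t
  have s: "s > 0" using \<phi> by (simp add: angle_fun_def)
  have rpos: "r > 0" using \<kappa> r by simp
  have "(dist x y / 2)\<^sup>2 < r\<^sup>2" using d by (intro power_strict_mono) auto
  then have k: "k > 0" by (simp add: k_def)
  have f0: "f 0 = x" "f s = y" using s y by (auto simp: f_def curve_of_def)
  have "f 0 - m = - (1/2) *\<^sub>R (y - x)" "f s - m = (1/2) *\<^sub>R (y - x)"
    by (simp_all add: f0 m_def vec_eq_iff field_simps)
  then have U0: "U 0 = - dist x y / 2" "U s = dist x y / 2" and Y0: "Y 0 = 0" "Y s = 0"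
    by (simp_all add: U_def Y_def \<phi>0 inner_dir_dir del: scaleR_scaleR)
  have df: "(f has_vector_derivative dir (\<phi> t)) (at t within {0..s})" if "t \<in> {0..s}" for t
    unfolding f_def by (rule curve_of_deriv[OF c that])
  have dfm: "((\<lambda>t. (f t - m) \<bullet> b) has_real_derivative dir (\<phi> t) \<bullet> b) (at t within {0..s})"
    if "t \<in> {0..s}" for t b
  proof -
    have "((\<lambda>t. f t - m) has_vector_derivative dir (\<phi> t) - 0) (at t within {0..s})"
      by (intro has_vector_derivative_diff has_vector_derivative_const df that)
    from bounded_linear.has_vector_derivative[OF bounded_linear_inner_left this]
    show ?thesis by (simp add: has_real_derivative_iff_has_vector_derivative)
  qed
  have dU: "(U has_real_derivative cos (\<psi> t)) (at t within {0..s})" if "t \<in> {0..s}" for t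
    using dfm[OF that, of "dir \<phi>\<^sub>0"] by (simp add: U_def[abs_def] \<psi>_def inner_dir_dir)
  have "cos (a - (b + pi/2)) = sin (a - b)" for a b
    by (simp add: cos_diff sin_diff cos_add sin_add)
  then have dY: "(Y has_real_derivative sin (\<psi> t)) (at t within {0..s})" if "t \<in> {0..s}" for t
    using dfm[OF that, of "dir (\<phi>\<^sub>0 + pi/2)"] by (simp add: Y_def[abs_def] \<psi>_def inner_dir_dir)
  have UU: "U t' - U t = integral {t..t'} (\<lambda>u. cos (\<phi> u - \<phi>\<^sub>0))" if "0 \<le> t" "t \<le> t'" "t' \<le> s" for t t'
    using curve_of_increment[OF c that, of x \<phi>\<^sub>0] by (simp add: U_def f_def inner_diff_left)
  \<comment> \<open>The absolute value gives two monotone quantities, U / r + sin \<psi> for the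
    upper arc and U / r - sin \<psi> for the lower one.\<close>
  have inc: "\<bar>sin (\<psi> t') - sin (\<psi> t)\<bar> \<le> U t' / r - U t / r" if "0 \<le> t" "t \<le> t'" "t' \<le> s" for t t'
  proof -
    have "\<bar>sin (\<phi> t' - \<phi>\<^sub>0) - sin (\<phi> t - \<phi>\<^sub>0)\<bar> \<le> \<kappa> * integral {t..t'} (\<lambda>u. cos (\<phi> u - \<phi>\<^sub>0))"
      by (rule angle_fun_sin_diff[OF \<phi> that]) (use \<kappa> fwd that in \<open>auto intro: less_imp_le\<close>)
    then show ?thesis using UU[OF that] by (simp add: \<psi>_def r algebra_simps)
  qed
  have bd: "\<bar>U t\<bar> < r" if t: "t \<in> {0..s}" for t
  proof -
    have "U 0 / r \<le> U t / r" "U t / r \<le> U s / r" using inc[of 0 t] inc[of t s] t by auto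
    then have "U 0 \<le> U t" "U t \<le> U s" using rpos by (simp_all add: divide_le_cancel)
    then show ?thesis unfolding U0 using d by linarith
  qed
  have upper: "Y t \<le> sqrt (r\<^sup>2 - (U t)\<^sup>2) - k"
  proof (rule below_upper_arc[OF rpos dU dY _ _ bd _ _ t])
    fix t t' assume "0 \<le> t" "t \<le> t'" "t' \<le> s"
    from inc[OF this] show "sin (\<psi> t) + U t / r \<le> sin (\<psi> t') + U t' / r" by linarith
  next
    fix t assume "t \<in> {0..s}"
    then show "0 \<le> cos (\<psi> t)" using fwd[of t] by (simp add: \<psi>_def)
  qed (simp_all add: Y0 U0 k_def)
  \<comment> \<open>Reflection in the chord negates \<psi> and \<open>Y\<close> and fixes
    \<open>U\<close>, so the lower arc becomes the upper arc of the reflected curve.\<close>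
  have lower: "- Y t \<le> sqrt (r\<^sup>2 - (U t)\<^sup>2) - k"
  proof (rule below_upper_arc[OF rpos _ _ _ _ bd _ _ t, where \<psi> = "\<lambda>t. - \<psi> t"])
    fix t t' assume "0 \<le> t" "t \<le> t'" "t' \<le> s"
    from inc[OF this] show "sin (- \<psi> t) + U t / r \<le> sin (- \<psi> t') + U t' / r"
      unfolding sin_minus by linarith
  next
    fix t assume t: "t \<in> {0..s}"
    then show "0 \<le> cos (- \<psi> t)" using fwd[of t] unfolding cos_minus \<psi>_def by simp
    show "(U has_real_derivative cos (- \<psi> t)) (at t within {0..s})" using dU[OF t] by simp
    show "((\<lambda>t. - Y t) has_real_derivative sin (- \<psi> t)) (at t within {0..s})"
      using DERIV_minus[OF dY[OF t]] by simp
  qed (simp_all add: Y0 U0 k_def)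
  have "\<bar>Y t\<bar> + k \<le> sqrt (r\<^sup>2 - (U t)\<^sup>2)" using upper lower by linarith
  then have "(\<bar>Y t\<bar> + k)\<^sup>2 \<le> (sqrt (r\<^sup>2 - (U t)\<^sup>2))\<^sup>2" using k by (intro power_mono) auto
  also have "\<dots> = r\<^sup>2 - (U t)\<^sup>2"
  proof -
    have "\<bar>U t\<bar>\<^sup>2 \<le> r\<^sup>2" using bd[OF t] by (intro power_mono) auto
    then show ?thesis by simp
  qed
  finally have "(U t)\<^sup>2 + (\<bar>Y t\<bar> + k)\<^sup>2 \<le> r\<^sup>2" by simp
  then show ?thesis
    unfolding lens_alt[OF d I \<phi>0] by (simp add: U_def Y_def f_def k_def m_def)
qed

subsection \<open>The metric on curves\<close>

abbreviation unit_deriv :: "curve \<Rightarrow> real \<Rightarrow> real^2" where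
  "unit_deriv \<sigma> \<equiv> ivl_deriv 0 1 (unit_param \<sigma>)"

lemma bdd_dist_unit_param:
  assumes "\<sigma> \<in> constrained_curves \<kappa> x y" "\<gamma> \<in> constrained_curves \<kappa> x y"
  shows "bdd_above ((\<lambda>u. dist (unit_param \<sigma> u) (unit_param \<gamma> u)) ` {0..1})"
    "bdd_above ((\<lambda>u. dist (unit_deriv \<sigma> u) (unit_deriv \<gamma> u)) ` {0..1})"
  using assms by (auto intro!: bdd_above_dist continuous_on_unit_param continuous_on_deriv_unit_param)

lemma dist_le_C1_dist:
  assumes M: "\<sigma> \<in> constrained_curves \<kappa> x y" "\<gamma> \<in> constrained_curves \<kappa> x y" and u: "u \<in> {0..1}"
  shows "dist (unit_param \<sigma> u) (unit_param \<gamma> u) \<le> C1_dist \<kappa> x y \<sigma> \<gamma>"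
    "dist (unit_deriv \<sigma> u) (unit_deriv \<gamma> u) \<le> C1_dist \<kappa> x y \<sigma> \<gamma>"
proof -
  have "0 \<le> (SUP u\<in>{0..1}. dist (f u) (g u))"
    if "bdd_above ((\<lambda>u. dist (f u) (g u)) ` {0..1})" for f g :: "real \<Rightarrow> real^2"
    by (rule cSUP_upper2[OF that, of 0]) auto
  note nn = this[OF bdd_dist_unit_param(1)[OF M]] this[OF bdd_dist_unit_param(2)[OF M]]
  show "dist (unit_param \<sigma> u) (unit_param \<gamma> u) \<le> C1_dist \<kappa> x y \<sigma> \<gamma>"
    using cSUP_upper[OF u bdd_dist_unit_param(1)[OF M]] nn M by (simp add: C1_dist_def)
  show "dist (unit_deriv \<sigma> u) (unit_deriv \<gamma> u) \<le> C1_dist \<kappa> x y \<sigma> \<gamma>"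
    using cSUP_upper[OF u bdd_dist_unit_param(2)[OF M]] nn M by (simp add: C1_dist_def)
qed

lemma unit_param_ends:
  assumes "\<sigma> \<in> constrained_curves \<kappa> x y"
  shows "unit_param \<sigma> 0 = x" "unit_param \<sigma> 1 = y"
  using assms by (auto simp: constrained_curves_def unit_param_def)

text \<open>All curves start at \<open>x\<close>, so by the mean value inequality the distance of
  the derivatives also controls that of the values. Continuity of a homotopy has to be checked on
  derivatives only.\<close>

lemma C1_dist_le:
  assumes M: "\<sigma> \<in> constrained_curves \<kappa> x y" "\<gamma> \<in> constrained_curves \<kappa> x y"
    and e: "\<And>u. u \<in> {0..1} \<Longrightarrow> dist (unit_deriv \<sigma> u) (unit_deriv \<gamma> u) \<le> e"
  shows "C1_dist \<kappa> x y \<sigma> \<gamma> \<le> 2 * e"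
proof -
  have e0: "e \<ge> 0" using e[of 0] order_trans[OF zero_le_dist] by auto
  have d: "(unit_param \<sigma> has_vector_derivative unit_deriv \<sigma> u) (at u within {0..1})"
    if "\<sigma> \<in> constrained_curves \<kappa> x y" "u \<in> {0..1}" for \<sigma> u
    using unit_param_has_deriv[OF that] ivl_deriv_unit_param[OF that] by simp
  have "dist (unit_param \<sigma> u) (unit_param \<gamma> u) \<le> e" if u: "u \<in> {0..1}" for u
  proof -
    define h where "h u = unit_param \<sigma> u - unit_param \<gamma> u" for u
    have "norm (h u - h 0) \<le> e * norm (u - 0)"
    proof (rule differentiable_bound[of "{0..1}" h "\<lambda>t s. s *\<^sub>R (unit_deriv \<sigma> t - unit_deriv \<gamma> t)"])
      fix t :: real assume t: "t \<in> {0..1}"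
      have "(h has_vector_derivative unit_deriv \<sigma> t - unit_deriv \<gamma> t) (at t within {0..1})"
        unfolding h_def[abs_def] by (intro has_vector_derivative_diff d M t)
      then show "(h has_derivative (\<lambda>s. s *\<^sub>R (unit_deriv \<sigma> t - unit_deriv \<gamma> t))) (at t within {0..1})"
        by (simp add: has_vector_derivative_def)
      show "onorm (\<lambda>s. s *\<^sub>R (unit_deriv \<sigma> t - unit_deriv \<gamma> t)) \<le> e"
      proof (rule onorm_bound[OF e0])
        fix s :: real
        show "norm (s *\<^sub>R (unit_deriv \<sigma> t - unit_deriv \<gamma> t)) \<le> e * norm s"
          using mult_left_mono[OF e[OF t], of "\<bar>s\<bar>"] by (simp add: dist_norm mult.commute)
      qed
    qed (use u in auto)
    moreover have "h 0 = 0" using unit_param_ends[OF M(1)] unit_param_ends[OF M(2)] by (simp add: h_def)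
    moreover have "e * norm (u - 0) \<le> e" using u e0 by (simp add: mult_left_le)
    ultimately show ?thesis by (simp add: h_def dist_norm)
  qed
  then have "(SUP u\<in>{0..1}. dist (unit_param \<sigma> u) (unit_param \<gamma> u)) \<le> e" by (intro cSUP_least) auto
  moreover have "(SUP u\<in>{0..1}. dist (unit_deriv \<sigma> u) (unit_deriv \<gamma> u)) \<le> e"
    using e by (intro cSUP_least) auto
  ultimately show ?thesis using M by (simp add: C1_dist_def)
qed

text \<open>Joint continuity on the compact square is uniform, which is continuity in the first
  variable for the supremum norm in the second.\<close>

lemma pathin_curve_topologyI:
  assumes M: "\<And>l. l \<in> {0..1} \<Longrightarrow> c l \<in> constrained_curves \<kappa> x y"
    and cont: "continuous_on ({0..1} \<times> {0..1}) (\<lambda>(l, u). unit_deriv (c l) u)"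
  shows "pathin (curve_topology \<kappa> x y) c"
proof -
  interpret Metric_space "constrained_curves \<kappa> x y" "C1_dist \<kappa> x y" by (rule Metric_space_C1_dist)
  have uc: "uniformly_continuous_on ({0..1} \<times> {0..1}) (\<lambda>(l, u). unit_deriv (c l) u)"
    by (intro compact_uniformly_continuous cont compact_Times) auto
  have "\<exists>U. openin (top_of_set {0..1}) U \<and> l \<in> U \<and> (\<forall>l'\<in>U. c l' \<in> mball (c l) e)"
    if l: "l \<in> {0..1}" and e: "e > 0" for l e
  proof -
    \<comment> \<open>\<open>C1_dist_le\<close> doubles the bound; with e / 3 the result 2 e / 3
      stays strictly below e.\<close>
    obtain d where d: "d > 0" and *: "\<And>p q. p \<in> {0..1} \<times> {0..1} \<Longrightarrow> q \<in> {0..1} \<times> {0..1} \<Longrightarrow>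
        dist q p < d \<Longrightarrow> dist (case q of (l, u) \<Rightarrow> unit_deriv (c l) u) (case p of (l, u) \<Rightarrow> unit_deriv (c l) u) < e / 3"
      using uc e unfolding uniformly_continuous_on_def by (metis zero_less_divide_iff zero_less_numeral)
    show ?thesis
    proof (intro exI conjI ballI)
      show "openin (top_of_set {0..1}) ({0..1} \<inter> ball l d)" by (simp add: openin_open_Int)
      show "l \<in> {0..1} \<inter> ball l d" using l d by simp
      fix l' assume l': "l' \<in> {0..1} \<inter> ball l d"
      have "C1_dist \<kappa> x y (c l) (c l') \<le> 2 * (e / 3)"
      proof (rule C1_dist_le)
        fix u :: real assume u: "u \<in> {0..1}"
        show "dist (unit_deriv (c l) u) (unit_deriv (c l') u) \<le> e / 3"
          using *[of "(l', u)" "(l, u)"] l l' u by (auto simp: dist_Pair_Pair less_imp_le)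
      qed (use M l l' in auto)
      then have "C1_dist \<kappa> x y (c l) (c l') < e" using e by simp
      then show "c l' \<in> mball (c l) e" using M l l' by simp
    qed
  qed
  then show ?thesis
    unfolding pathin_def curve_topology_def continuous_map_to_metric by simp
qed

lemma openin_not_in:
  assumes "closed X"
  shows "openin (curve_topology \<kappa> x y) {\<sigma> \<in> constrained_curves \<kappa> x y. not_in \<sigma> X}"
proof -
  interpret Metric_space "constrained_curves \<kappa> x y" "C1_dist \<kappa> x y" by (rule Metric_space_C1_dist)
  have alt: "not_in \<sigma> X \<longleftrightarrow> (\<exists>u\<in>{0..1}. unit_param \<sigma> u \<notin> X)"
    if "\<sigma> \<in> constrained_curves \<kappa> x y" for \<sigma>
  proof -
    obtain s f where sf: "\<sigma> = (s, f)" by force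
    have "s > 0" using that by (auto simp: sf constrained_curves_def constrained_curve_def)
    then have "{0..s} = (\<lambda>u. s * u) ` {0..1}" by (simp add: image_mult_atLeastAtMost)
    then show ?thesis unfolding sf not_in_def unit_param_def by auto
  qed
  have "\<exists>e>0. mball \<sigma> e \<subseteq> {\<sigma> \<in> constrained_curves \<kappa> x y. not_in \<sigma> X}"
    if \<sigma>: "\<sigma> \<in> constrained_curves \<kappa> x y" "not_in \<sigma> X" for \<sigma>
  proof -
    obtain u where u: "u \<in> {0..1}" "unit_param \<sigma> u \<in> - X" using \<sigma> alt by auto
    then obtain e where e: "e > 0" "ball (unit_param \<sigma> u) e \<subseteq> - X"
      using assms openE[of "- X"] by blast
    have "not_in \<gamma> X" if "\<gamma> \<in> mball \<sigma> e" for \<gamma>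
    proof -
      have g: "\<gamma> \<in> constrained_curves \<kappa> x y" "C1_dist \<kappa> x y \<sigma> \<gamma> < e" using that by auto
      then have "unit_param \<gamma> u \<in> ball (unit_param \<sigma> u) e"
        using dist_le_C1_dist(1)[OF \<sigma>(1) g(1) u(1)] by simp
      then show ?thesis using alt[OF g(1)] e u by blast
    qed
    then show ?thesis using e by auto
  qed
  then show ?thesis unfolding curve_topology_def openin_mtopology by auto
qed

text \<open>By compactness the component of the velocity along \<open>b\<close> has a positive
  minimum, and this minimum serves as the radius of a ball.\<close>

lemma openin_forward:
  assumes b: "norm (b :: real^2) = 1"
  shows "openin (curve_topology \<kappa> x y)
    {\<sigma> \<in> constrained_curves \<kappa> x y. \<forall>u\<in>{0..1}. 0 < unit_deriv \<sigma> u \<bullet> b}"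
proof -
  interpret Metric_space "constrained_curves \<kappa> x y" "C1_dist \<kappa> x y" by (rule Metric_space_C1_dist)
  have "\<exists>e>0. \<forall>\<gamma>\<in>mball \<sigma> e. \<forall>u\<in>{0..1}. 0 < unit_deriv \<gamma> u \<bullet> b"
    if \<sigma>: "\<sigma> \<in> constrained_curves \<kappa> x y" "\<forall>u\<in>{0..1}. 0 < unit_deriv \<sigma> u \<bullet> b" for \<sigma>
  proof -
    have "continuous_on {0..1} (\<lambda>u. unit_deriv \<sigma> u \<bullet> b)"
      by (intro continuous_intros continuous_on_deriv_unit_param[OF \<sigma>(1)])
    then obtain u0 where u0: "u0 \<in> {0..1}"
      and min: "\<And>u. u \<in> {0..1} \<Longrightarrow> unit_deriv \<sigma> u0 \<bullet> b \<le> unit_deriv \<sigma> u \<bullet> b"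
      using continuous_attains_inf[of "{0..1}" "\<lambda>u. unit_deriv \<sigma> u \<bullet> b"] by auto
    have "0 < unit_deriv \<gamma> u \<bullet> b" if "\<gamma> \<in> mball \<sigma> (unit_deriv \<sigma> u0 \<bullet> b)" and u: "u \<in> {0..1}" for \<gamma> u
    proof -
      have g: "\<gamma> \<in> constrained_curves \<kappa> x y" "C1_dist \<kappa> x y \<sigma> \<gamma> < unit_deriv \<sigma> u0 \<bullet> b" using that by auto
      have "(unit_deriv \<sigma> u - unit_deriv \<gamma> u) \<bullet> b \<le> dist (unit_deriv \<sigma> u) (unit_deriv \<gamma> u)"
        using norm_cauchy_schwarz[of "unit_deriv \<sigma> u - unit_deriv \<gamma> u" b] b by (simp add: dist_norm)
      then show ?thesis
        using dist_le_C1_dist(2)[OF \<sigma>(1) g(1) u] g(2) min[OF u] by (simp add: inner_diff_left)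
    qed
    then show ?thesis using u0 \<sigma>(2) by blast
  qed
  then show ?thesis unfolding curve_topology_def openin_mtopology
    by (smt (verit, ccfv_SIG) in_mball mem_Collect_eq subsetI)
qed

subsection \<open>Curves with a given angle and speed\<close>

definition arclength :: "(real \<Rightarrow> real) \<Rightarrow> real \<Rightarrow> real" where
  "arclength \<rho> u = integral {0..u} \<rho>"

definition arclength_inv :: "(real \<Rightarrow> real) \<Rightarrow> real \<Rightarrow> real" where
  "arclength_inv \<rho> = inv_into {0..1} (arclength \<rho>)"

text \<open>Angle and speed live on the fixed interval \<open>{0..1}\<close> although the length
  varies; the inverse of arc length leads back to the arc-length parametrisation that curves
  require.\<close>

definition curve_with :: "real^2 \<Rightarrow> (real \<Rightarrow> real) \<Rightarrow> (real \<Rightarrow> real) \<Rightarrow> curve" where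
  "curve_with x \<theta> \<rho> = curve_of x (arclength \<rho> 1) (\<lambda>t. \<theta> (arclength_inv \<rho> t))"

text \<open>The increment condition is the curvature bound, integrated so that it is linear in \<open>\<rho>\<close>.\<close>

definition admissible :: "real \<Rightarrow> real^2 \<Rightarrow> (real \<Rightarrow> real) \<Rightarrow> (real \<Rightarrow> real) \<Rightarrow> bool" where
  "admissible \<kappa> w \<theta> \<rho> \<longleftrightarrow>
     piecewise_C1_on_ivl 0 1 \<theta> \<and> continuous_on {0..1} \<theta> \<and> continuous_on {0..1} \<rho> \<and>
     (\<forall>u\<in>{0..1}. 0 < \<rho> u) \<and>
     (\<forall>u v. 0 \<le> u \<longrightarrow> u \<le> v \<longrightarrow> v \<le> 1 \<longrightarrow> \<bar>\<theta> v - \<theta> u\<bar> \<le> \<kappa> * integral {u..v} \<rho>) \<and>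
     integral {0..1} (\<lambda>u. \<rho> u *\<^sub>R dir (\<theta> u)) = w"

section \<open>Arc length of a positive speed as a change of variable\<close>

context
  fixes \<rho> :: "real \<Rightarrow> real"
  assumes cont: "continuous_on {0..1} \<rho>" and pos: "\<And>u. u \<in> {0..1} \<Longrightarrow> 0 < \<rho> u"
begin

lemma arclength_diff:
  assumes "0 \<le> u" "u \<le> v" "v \<le> 1"
  shows "arclength \<rho> v - arclength \<rho> u = integral {u..v} \<rho>"
proof -
  have "\<rho> integrable_on {0..v}"
    by (rule integrable_continuous_real, rule continuous_on_subset[OF cont]) (use assms in auto)
  from Henstock_Kurzweil_Integration.integral_combine[OF assms(1,2) this]
  show ?thesis by (simp add: arclength_def)
qed

lemma arclength_deriv:
  assumes "u \<in> {0..1}"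
  shows "(arclength \<rho> has_real_derivative \<rho> u) (at u within {0..1})"
  using integral_has_vector_derivative[OF cont assms]
  by (simp add: arclength_def[abs_def] has_real_derivative_iff_has_vector_derivative)

lemma arclength_continuous: "continuous_on {0..1} (arclength \<rho>)"
  using DERIV_continuous_on[OF arclength_deriv] .

lemma arclength_less:
  assumes "0 \<le> u" "u < v" "v \<le> 1"
  shows "arclength \<rho> u < arclength \<rho> v"
proof (rule DERIV_pos_imp_increasing_open[OF assms(2), of "arclength \<rho>"])
  fix t assume t: "u < t" "t < v"
  then have "(arclength \<rho> has_real_derivative \<rho> t) (at t)"
    using arclength_deriv[of t] assms by (simp add: at_within_Icc_at)
  then show "\<exists>y. (arclength \<rho> has_real_derivative y) (at t) \<and> 0 < y" using pos[of t] t assms by auto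
qed (use continuous_on_subset[OF arclength_continuous] assms in auto)

lemma arclength_0: "arclength \<rho> 0 = 0" by (simp add: arclength_def)

lemma arclength_pos: "arclength \<rho> 1 > 0" using arclength_less[of 0 1] by (simp add: arclength_0)

lemma arclength_le_iff:
  assumes "u \<in> {0..1}" "v \<in> {0..1}" shows "arclength \<rho> u \<le> arclength \<rho> v \<longleftrightarrow> u \<le> v"
  using arclength_less[of u v] arclength_less[of v u] assms by (cases u v rule: linorder_cases) auto

lemma inj_on_arclength: "inj_on (arclength \<rho>) {0..1}"
  by (rule inj_onI) (metis arclength_le_iff order_antisym order_refl)

lemma arclength_image:
  assumes "0 \<le> u" "u \<le> v" "v \<le> 1"
  shows "arclength \<rho> ` {u..v} = {arclength \<rho> u..arclength \<rho> v}"
proof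
  show "arclength \<rho> ` {u..v} \<subseteq> {arclength \<rho> u..arclength \<rho> v}"
    using assms arclength_le_iff by auto
  show "{arclength \<rho> u..arclength \<rho> v} \<subseteq> arclength \<rho> ` {u..v}"
  proof
    fix t assume "t \<in> {arclength \<rho> u..arclength \<rho> v}"
    then show "t \<in> arclength \<rho> ` {u..v}"
      using IVT'[of "arclength \<rho>" u t v] assms continuous_on_subset[OF arclength_continuous, of "{u..v}"]
      by force
  qed
qed

lemma arclength_inv_arclength: "u \<in> {0..1} \<Longrightarrow> arclength_inv \<rho> (arclength \<rho> u) = u"
  by (simp add: arclength_inv_def inv_into_f_f[OF inj_on_arclength])

lemma arclength_inv_in:
  assumes "0 \<le> u" "u \<le> v" "v \<le> 1" "t \<in> {arclength \<rho> u..arclength \<rho> v}"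
  shows "arclength_inv \<rho> t \<in> {u..v}" "arclength \<rho> (arclength_inv \<rho> t) = t"
proof -
  obtain a where "a \<in> {u..v}" "t = arclength \<rho> a" using assms arclength_image[OF assms(1-3)] by blast
  then show "arclength_inv \<rho> t \<in> {u..v}" "arclength \<rho> (arclength_inv \<rho> t) = t"
    using arclength_inv_arclength[of a] assms by auto
qed

lemma arclength_inv_continuous: "continuous_on {0..arclength \<rho> 1} (arclength_inv \<rho>)"
  using continuous_on_inv[OF arclength_continuous, of "arclength_inv \<rho>"] arclength_inv_arclength
    arclength_image[of 0 1] by (simp add: arclength_0)

text \<open>The inverse is substituted into the difference quotient of the arc length, which also
  covers the one-sided derivatives at the ends; injectivity keeps the increments nonzero.\<close>

lemma arclength_inv_deriv:
  assumes t: "t \<in> {0..arclength \<rho> 1}"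
  shows "(arclength_inv \<rho> has_real_derivative 1 / \<rho> (arclength_inv \<rho> t)) (at t within {0..arclength \<rho> 1})"
proof -
  let ?S = "arclength \<rho>" and ?\<tau> = "arclength_inv \<rho>"
  have in01: "?\<tau> t \<in> {0..1}" "?S (?\<tau> t) = t" if "t \<in> {0..?S 1}" for t
    using arclength_inv_in[of 0 1 t] that by (auto simp: arclength_0)
  have *: "((\<lambda>u. (?S u - ?S (?\<tau> t)) / (u - ?\<tau> t)) \<longlongrightarrow> \<rho> (?\<tau> t)) (at (?\<tau> t) within {0..1})"
    using arclength_deriv[OF in01(1)[OF t]] by (simp add: has_field_derivative_iff)
  have ev: "\<forall>\<^sub>F v in at t within {0..?S 1}. v \<in> {0..?S 1} \<and> v \<noteq> t"
    by (auto simp: eventually_at_filter)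
  have "filterlim ?\<tau> (at (?\<tau> t) within {0..1}) (at t within {0..?S 1})"
    unfolding filterlim_at
  proof
    show "\<forall>\<^sub>F v in at t within {0..?S 1}. ?\<tau> v \<in> {0..1} \<and> ?\<tau> v \<noteq> ?\<tau> t"
      using ev by eventually_elim (metis in01 t)
    show "(?\<tau> \<longlongrightarrow> ?\<tau> t) (at t within {0..?S 1})"
      using arclength_inv_continuous t by (auto simp: continuous_on_def)
  qed
  from filterlim_compose[OF * this]
  have "((\<lambda>v. (?S (?\<tau> v) - ?S (?\<tau> t)) / (?\<tau> v - ?\<tau> t)) \<longlongrightarrow> \<rho> (?\<tau> t)) (at t within {0..?S 1})" .
  from tendsto_inverse[OF this]
  have "((\<lambda>v. inverse ((?S (?\<tau> v) - ?S (?\<tau> t)) / (?\<tau> v - ?\<tau> t))) \<longlongrightarrow> 1 / \<rho> (?\<tau> t)) (at t within {0..?S 1})"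
    using pos[OF in01(1)[OF t]] by (simp add: inverse_eq_divide)
  then show ?thesis
    unfolding has_field_derivative_iff
    by (rule Lim_transform_eventually) (use ev in eventually_elim, use in01 t in auto)
qed

text \<open>The substitution turns the end point condition, whose domain depends on the length, into
  one that is linear in \<rho> over a fixed interval.\<close>

lemma integral_dir_arclength_inv:
  assumes \<theta>: "continuous_on {0..1} \<theta>"
  shows "integral {0..arclength \<rho> 1} (\<lambda>t. dir (\<theta> (arclength_inv \<rho> t)))
    = integral {0..1} (\<lambda>u. \<rho> u *\<^sub>R dir (\<theta> u))"
proof -
  let ?g = "\<lambda>t. dir (\<theta> (arclength_inv \<rho> t))"
  have in01: "arclength_inv \<rho> t \<in> {0..1}" if "t \<in> {0..arclength \<rho> 1}" for t
    using arclength_inv_in[of 0 1 t] that by (auto simp: arclength_0)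
  have "((\<lambda>u. \<rho> u *\<^sub>R ?g (arclength \<rho> u)) has_integral integral {arclength \<rho> 0..arclength \<rho> 1} ?g) {0..1}"
  proof (rule has_integral_substitution)
    show "arclength \<rho> ` {0..1} \<subseteq> {0..arclength \<rho> 1}" using arclength_image[of 0 1] by (simp add: arclength_0)
    show "continuous_on {0..arclength \<rho> 1} ?g"
      by (intro continuous_intros continuous_on_compose2[OF \<theta> arclength_inv_continuous]) (use in01 in auto)
  qed (use arclength_deriv arclength_pos arclength_0 in auto)
  then have "((\<lambda>u. \<rho> u *\<^sub>R dir (\<theta> u)) has_integral integral {0..arclength \<rho> 1} ?g) {0..1}"
    unfolding arclength_0 by (rule has_integral_eq[rotated]) (simp add: arclength_inv_arclength)
  then show ?thesis by (simp add: integral_unique)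
qed

end

text \<open>Arc length carries the pieces of \<theta> to pieces of the new angle, and the integral
  of \<rho> between two times is the arc length between them, so the increment condition becomes the
  Lipschitz bound.\<close>

lemma angle_fun_arclength_inv:
  assumes "admissible \<kappa> w \<theta> \<rho>"
  shows "angle_fun \<kappa> (arclength \<rho> 1) (\<lambda>t. \<theta> (arclength_inv \<rho> t))"
proof -
  have cont: "continuous_on {0..1} \<rho>" and pos: "\<And>u. u \<in> {0..1} \<Longrightarrow> 0 < \<rho> u"
    and pw: "piecewise_C1_on_ivl 0 1 \<theta>" and \<theta>: "continuous_on {0..1} \<theta>"
    and lip: "\<And>u v. 0 \<le> u \<Longrightarrow> u \<le> v \<Longrightarrow> v \<le> 1 \<Longrightarrow> \<bar>\<theta> v - \<theta> u\<bar> \<le> \<kappa> * integral {u..v} \<rho>"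
    using assms by (auto simp: admissible_def)
  note facts = cont pos
  let ?S = "arclength \<rho>" and ?\<tau> = "arclength_inv \<rho>"
  have S0: "?S 0 = 0" by (simp add: arclength_def)
  have in01: "?\<tau> t \<in> {0..1}" "?S (?\<tau> t) = t" if "t \<in> {0..?S 1}" for t
    using arclength_inv_in[OF facts, of 0 1 t] that by (auto simp: S0)
  obtain n p where p: "p 0 = 0" "p (n::nat) = 1"
    "\<And>i. i < n \<Longrightarrow> p i < p (Suc i)" "\<And>i. i < n \<Longrightarrow> C1_on_ivl (p i) (p (Suc i)) \<theta>"
    using pw unfolding piecewise_C1_on_ivl_def by blast
  have piece: "C1_on_ivl (?S (p i)) (?S (p (Suc i))) (\<lambda>t. \<theta> (?\<tau> t))" and less: "?S (p i) < ?S (p (Suc i))"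
    if i: "i < n" for i
  proof -
    let ?a = "p i" and ?b = "p (Suc i)"
    have ab: "0 \<le> ?a" "?a < ?b" "?b \<le> 1"
      using partition_mono[of n p 0 i] partition_mono[of n p "Suc i" n] p i by auto
    show less: "?S ?a < ?S ?b" using arclength_less[OF facts ab] .
    have sub: "{?S ?a..?S ?b} \<subseteq> {0..?S 1}"
      using arclength_le_iff[OF facts, of 0 ?a] arclength_le_iff[OF facts, of ?b 1] ab S0 by auto
    have im: "?\<tau> ` {?S ?a..?S ?b} \<subseteq> {?a..?b}"
      using arclength_inv_in(1)[OF facts, of ?a ?b] ab by auto
    have \<tau>c: "continuous_on {?S ?a..?S ?b} ?\<tau>"
      using arclength_inv_continuous[OF facts] sub continuous_on_subset by blast
    show "C1_on_ivl (?S ?a) (?S ?b) (\<lambda>t. \<theta> (?\<tau> t))"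
    proof (rule C1_on_ivlI[OF less])
      fix t assume t: "t \<in> {?S ?a..?S ?b}"
      have "(?\<tau> has_real_derivative 1 / \<rho> (?\<tau> t)) (at t within {?S ?a..?S ?b})"
        using arclength_inv_deriv[OF facts, of t] sub t by (meson DERIV_subset subsetD)
      moreover have "(\<theta> has_vector_derivative ivl_deriv ?a ?b \<theta> (?\<tau> t)) (at (?\<tau> t) within {?a..?b})"
        using C1_on_ivlD[OF p(4)[OF i]] im t by blast
      then have "(\<theta> has_real_derivative ivl_deriv ?a ?b \<theta> (?\<tau> t)) (at (?\<tau> t) within ?\<tau> ` {?S ?a..?S ?b})"
        using im by (meson DERIV_subset has_real_derivative_iff_has_vector_derivative)
      ultimately have "((\<theta> \<circ> ?\<tau>) has_real_derivative ivl_deriv ?a ?b \<theta> (?\<tau> t) * (1 / \<rho> (?\<tau> t)))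
          (at t within {?S ?a..?S ?b})"
        by (intro DERIV_image_chain)
      then show "((\<lambda>t. \<theta> (?\<tau> t)) has_vector_derivative ivl_deriv ?a ?b \<theta> (?\<tau> t) * (1 / \<rho> (?\<tau> t)))
          (at t within {?S ?a..?S ?b})"
        by (simp add: has_real_derivative_iff_has_vector_derivative o_def)
    next
      have "continuous_on {?a..?b} (ivl_deriv ?a ?b \<theta>)" using p(4)[OF i] by (simp add: C1_on_ivl_def)
      then have "continuous_on {?S ?a..?S ?b} (\<lambda>t. ivl_deriv ?a ?b \<theta> (?\<tau> t))"
        using continuous_on_compose2[OF _ \<tau>c im] by blast
      moreover have "continuous_on {?S ?a..?S ?b} (\<lambda>t. \<rho> (?\<tau> t))"
        by (rule continuous_on_compose2[OF cont \<tau>c]) (use im ab in force)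
      moreover have "\<rho> (?\<tau> t) \<noteq> 0" if "t \<in> {?S ?a..?S ?b}" for t
        using pos[of "?\<tau> t"] in01(1)[of t] sub that by force
      ultimately show "continuous_on {?S ?a..?S ?b} (\<lambda>t. ivl_deriv ?a ?b \<theta> (?\<tau> t) * (1 / \<rho> (?\<tau> t)))"
        by (intro continuous_intros) auto
    qed
  qed
  have "piecewise_C1_on_ivl 0 (?S 1) (\<lambda>t. \<theta> (?\<tau> t))"
    unfolding piecewise_C1_on_ivl_def
    by (rule exI[of _ n], rule exI[of _ "\<lambda>i. ?S (p i)"]) (use p S0 piece less in auto)
  moreover have lip': "\<bar>\<theta> (?\<tau> v) - \<theta> (?\<tau> u)\<bar> \<le> \<kappa> * (v - u)"
    if uv: "u \<in> {0..?S 1}" "v \<in> {0..?S 1}" "u \<le> v" for u v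
  proof -
    have le: "?\<tau> u \<le> ?\<tau> v"
      using arclength_le_iff[OF facts, of "?\<tau> u" "?\<tau> v"] in01[OF uv(1)] in01[OF uv(2)] uv by auto
    have "\<bar>\<theta> (?\<tau> v) - \<theta> (?\<tau> u)\<bar> \<le> \<kappa> * integral {?\<tau> u..?\<tau> v} \<rho>"
      using lip[OF _ le] in01[OF uv(1)] in01[OF uv(2)] by auto
    also have "integral {?\<tau> u..?\<tau> v} \<rho> = v - u"
      using arclength_diff[OF facts _ le] in01[OF uv(1)] in01[OF uv(2)] by auto
    finally show ?thesis .
  qed
  moreover have "\<bar>\<theta> (?\<tau> v) - \<theta> (?\<tau> u)\<bar> \<le> \<kappa> * \<bar>v - u\<bar>"
    if uv: "u \<in> {0..?S 1}" "v \<in> {0..?S 1}" for u v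
    using lip'[of u v] lip'[of v u] uv by (cases "u \<le> v") (auto simp: abs_minus_commute)
  ultimately show ?thesis using arclength_pos[OF facts] by (simp add: angle_fun_def)
qed

lemma curve_with_constrained:
  assumes "admissible \<kappa> (y - x) \<theta> \<rho>"
  shows "curve_with x \<theta> \<rho> \<in> constrained_curves \<kappa> x y"
  unfolding curve_with_def
proof (rule curve_of_constrained[OF angle_fun_arclength_inv[OF assms]])
  show "x + integral {0..arclength \<rho> 1} (\<lambda>\<tau>. dir (\<theta> (arclength_inv \<rho> \<tau>))) = y"
    using assms by (subst integral_dir_arclength_inv) (auto simp: admissible_def)
qed

text \<open>A constant speed, equal to the length of the curve, suffices.\<close>

lemma curve_with_surj:
  assumes \<sigma>: "\<sigma> \<in> constrained_curves \<kappa> x y" and "\<kappa> \<ge> 0"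
  obtains \<theta> \<rho> where "admissible \<kappa> (y - x) \<theta> \<rho>" "\<sigma> = curve_with x \<theta> \<rho>"
proof -
  obtain s \<phi> where \<phi>: "angle_fun \<kappa> s \<phi>" and eq: "\<sigma> = curve_of x s \<phi>"
    and y: "x + integral {0..s} (\<lambda>t. dir (\<phi> t)) = y"
    using constrained_curve_angle[OF assms] by metis
  have s: "s > 0" and lip: "\<And>u v. u \<in> {0..s} \<Longrightarrow> v \<in> {0..s} \<Longrightarrow> \<bar>\<phi> v - \<phi> u\<bar> \<le> \<kappa> * \<bar>v - u\<bar>"
    using \<phi> by (auto simp: angle_fun_def)
  define \<theta> \<rho> where "\<theta> u = \<phi> (s * u)" and "\<rho> u = s" for u :: real
  have S: "arclength \<rho> u = s * u" if "u \<ge> 0" for u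
    using that by (simp add: arclength_def \<rho>_def[abs_def])
  have r: "continuous_on {0..1} \<rho>" "\<And>u. u \<in> {0..1} \<Longrightarrow> 0 < \<rho> u"
    using s by (auto simp: \<rho>_def[abs_def])
  have \<tau>: "arclength_inv \<rho> t = t / s" if "t \<in> {0..s}" for t
  proof -
    have "arclength \<rho> (t / s) = t" using S[of "t / s"] that s by simp
    then show ?thesis using arclength_inv_arclength[OF r, of "t / s"] that s by auto
  qed
  have \<theta>\<tau>: "\<theta> (arclength_inv \<rho> t) = \<phi> t" if "t \<in> {0..s}" for t
    using \<tau>[OF that] s by (simp add: \<theta>_def)
  have c: "continuous_on {0..1} \<theta>"
    unfolding \<theta>_def by (rule continuous_on_compose2[OF angle_fun_continuous[OF \<phi>]])
      (use s in \<open>auto intro!: continuous_intros simp: mult_left_le\<close>)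
  obtain n p where p: "p 0 = 0" "p (n::nat) = s"
    "\<And>i. i < n \<Longrightarrow> p i < p (Suc i)" "\<And>i. i < n \<Longrightarrow> C1_on_ivl (p i) (p (Suc i)) \<phi>"
    using \<phi> unfolding angle_fun_def piecewise_C1_on_ivl_def by blast
  have "C1_on_ivl (p i / s) (p (Suc i) / s) \<theta>" if i: "i < n" for i
  proof (rule C1_on_ivlI)
    have im: "(\<lambda>u. s * u) ` {p i / s..p (Suc i) / s} = {p i..p (Suc i)}"
      using s p(3)[OF i] by (simp add: image_mult_atLeastAtMost divide_right_mono)
    show "p i / s < p (Suc i) / s" using p(3)[OF i] s by (simp add: divide_strict_right_mono)
    let ?D = "ivl_deriv (p i) (p (Suc i)) \<phi>"
    fix u assume "u \<in> {p i / s..p (Suc i) / s}"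
    then have "s * u \<in> {p i..p (Suc i)}" using im by blast
    then have "(\<phi> has_real_derivative ?D (s * u)) (at (s * u) within (\<lambda>u. s * u) ` {p i / s..p (Suc i) / s})"
      using C1_on_ivlD[OF p(4)[OF i]] unfolding im has_real_derivative_iff_has_vector_derivative by blast
    moreover have "((\<lambda>u. s * u) has_real_derivative s) (at u within {p i / s..p (Suc i) / s})"
      by (auto intro!: derivative_eq_intros)
    ultimately have "(\<phi> \<circ> (\<lambda>u. s * u) has_real_derivative ?D (s * u) * s) (at u within {p i / s..p (Suc i) / s})"
      by (rule DERIV_image_chain)
    then show "(\<theta> has_vector_derivative ?D (s * u) * s) (at u within {p i / s..p (Suc i) / s})"
      by (simp add: has_real_derivative_iff_has_vector_derivative o_def \<theta>_def[abs_def])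
  next
    let ?D = "ivl_deriv (p i) (p (Suc i)) \<phi>"
    have im: "(\<lambda>u. s * u) ` {p i / s..p (Suc i) / s} = {p i..p (Suc i)}"
      using s p(3)[OF i] by (simp add: image_mult_atLeastAtMost divide_right_mono)
    have "continuous_on {p i..p (Suc i)} ?D" using p(4)[OF i] by (simp add: C1_on_ivl_def)
    then have "continuous_on {p i / s..p (Suc i) / s} (\<lambda>u. ?D (s * u))"
      by (rule continuous_on_compose2) (use im in \<open>auto intro!: continuous_intros\<close>)
    then show "continuous_on {p i / s..p (Suc i) / s} (\<lambda>u. ?D (s * u) * s)"
      by (intro continuous_intros)
  qed
  then have "piecewise_C1_on_ivl 0 1 \<theta>"
    unfolding piecewise_C1_on_ivl_def using p s
    by (intro exI[of _ n] exI[of _ "\<lambda>i. p i / s"]) (auto simp: divide_strict_right_mono)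
  moreover have "\<bar>\<theta> v - \<theta> u\<bar> \<le> \<kappa> * integral {u..v} \<rho>" if uv: "0 \<le> u" "u \<le> v" "v \<le> 1" for u v
  proof -
    have "s * u \<in> {0..s}" "s * v \<in> {0..s}" using uv s by (auto simp: mult_left_le)
    from lip[OF this] have "\<bar>\<theta> v - \<theta> u\<bar> \<le> \<kappa> * \<bar>s * v - s * u\<bar>" by (simp add: \<theta>_def)
    also have "\<bar>s * v - s * u\<bar> = s * (v - u)" using uv s by (simp add: right_diff_distrib mult_left_mono)
    finally show ?thesis using uv by (simp add: \<rho>_def[abs_def] mult.commute)
  qed
  moreover have "integral {0..1} (\<lambda>u. \<rho> u *\<^sub>R dir (\<theta> u)) = y - x"
  proof -
    have "integral {0..s} (\<lambda>t. dir (\<theta> (arclength_inv \<rho> t))) = integral {0..s} (\<lambda>t. dir (\<phi> t))"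
      by (rule Henstock_Kurzweil_Integration.integral_cong) (simp add: \<theta>\<tau>)
    then show ?thesis using integral_dir_arclength_inv[OF r c] y S[of 1] by auto
  qed
  ultimately have "admissible \<kappa> (y - x) \<theta> \<rho>" using r c by (auto simp: admissible_def)
  moreover have "curve_of x s \<phi> = curve_with x \<theta> \<rho>"
  proof -
    have "integral {0..t} (\<lambda>\<tau>. dir (\<theta> (arclength_inv \<rho> \<tau>))) = integral {0..t} (\<lambda>\<tau>. dir (\<phi> \<tau>))"
      if "t \<in> {0..s}" for t
      by (rule Henstock_Kurzweil_Integration.integral_cong) (use that \<theta>\<tau> in auto)
    then show ?thesis using S[of 1] by (auto simp: curve_with_def curve_of_def)
  qed
  ultimately show thesis using that eq by metis
qed

text \<open>Scaling the integration variable by \<open>u\<close> moves the variable upper limit into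
  the integrand, which leaves a parameter integral over a fixed interval.\<close>

lemma arclength_continuous_param:
  assumes c: "continuous_on ({0..1} \<times> {0..1}) (\<lambda>(l, u). \<rho> l u)"
  shows "continuous_on ({0..1::real} \<times> {0..1}) (\<lambda>(l, u). arclength (\<rho> l) u)"
proof -
  have 1: "continuous_on ({0..1} \<times> {0..1}) (\<lambda>x. integral (cbox 0 1) (\<lambda>t. snd x *\<^sub>R \<rho> (fst x) (t * snd x)))"
  proof (rule integral_continuous_on_param)
    have "continuous_on (({0..1} \<times> {0..1}) \<times> cbox 0 1)
        (\<lambda>z. (\<lambda>(l, u). \<rho> l u) (fst (fst z), snd z * snd (fst z)))"
      by (rule continuous_on_compose2[OF c])
        (auto intro!: continuous_intros mult_le_one)
    then show "continuous_on (({0..1} \<times> {0..1}) \<times> cbox (0::real) 1)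
        (\<lambda>(x, t). snd x *\<^sub>R \<rho> (fst x) (t * snd x))"
      unfolding case_prod_unfold by (intro continuous_intros) auto
  qed
  have 2: "integral (cbox 0 1) (\<lambda>t. u *\<^sub>R \<rho> l (t * u)) = arclength (\<rho> l) u"
    if l: "l \<in> {0..1}" and u: "u \<in> {0..1}" for l u
  proof -
    have "continuous_on {0..1} (\<rho> l)"
      using continuous_on_o_Pair[OF c l] by (simp add: o_def)
    then have "((\<lambda>t. u *\<^sub>R \<rho> l (t * u)) has_integral integral {0 * u..1 * u} (\<rho> l)) {0..1}"
      by (intro has_integral_substitution[of 0 1 _ 0 1])
        (use u in \<open>auto intro!: derivative_eq_intros mult_le_one\<close>)
    from integral_unique[OF this] show ?thesis by (simp add: arclength_def)
  qed
  show ?thesis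
    by (rule continuous_on_eq[OF 1]) (use 2 in auto)
qed

lemma curve_with_pathin:
  fixes \<theta> \<rho> :: "real \<Rightarrow> real \<Rightarrow> real"
  assumes \<theta>: "continuous_on ({0..1} \<times> {0..1}) (\<lambda>(l, u). \<theta> l u)"
    and \<rho>: "continuous_on ({0..1} \<times> {0..1}) (\<lambda>(l, u). \<rho> l u)"
    and adm: "\<And>l. l \<in> {0..1} \<Longrightarrow> admissible \<kappa> (y - x) (\<theta> l) (\<rho> l)"
  shows "pathin (curve_topology \<kappa> x y) (\<lambda>l. curve_with x (\<theta> l) (\<rho> l))"
proof (rule pathin_curve_topologyI)
  show M: "curve_with x (\<theta> l) (\<rho> l) \<in> constrained_curves \<kappa> x y" if "l \<in> {0..1}" for l
    using curve_with_constrained[OF adm[OF that]] .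
  have facts: "continuous_on {0..1} (\<rho> l)" "\<And>u. u \<in> {0..1} \<Longrightarrow> 0 < \<rho> l u" if "l \<in> {0..1}" for l
    using adm[OF that] by (auto simp: admissible_def)
  let ?S = "\<lambda>l. arclength (\<rho> l)" and ?\<tau> = "\<lambda>l. arclength_inv (\<rho> l)"
  \<comment> \<open>Joint continuity of the inverse arc length in \<open>l\<close> and
    \<open>v\<close> comes from compactness: \<open>F\<close> is a continuous bijection of the
    square onto itself, so its inverse \<open>G\<close> is continuous.\<close>
  define F G where "F = (\<lambda>(l, u). (l, ?S l u / ?S l 1))" and "G = (\<lambda>(l, v). (l, ?\<tau> l (?S l 1 * v)))"
  note Sc = arclength_continuous_param[OF \<rho>]
  have S1: "continuous_on ({0..1} \<times> {0..1::real}) (\<lambda>z. ?S (fst z) 1)"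
  proof -
    have "continuous_on ({0..1} \<times> {0..1}) (\<lambda>z. (\<lambda>(l, u). ?S l u) (fst z, 1))"
      by (rule continuous_on_compose2[OF Sc]) (auto intro!: continuous_intros)
    then show ?thesis by simp
  qed
  have pos: "?S l 1 > 0" if "l \<in> {0..1}" for l using arclength_pos[OF facts[OF that]] .
  have "continuous_on ({0..1} \<times> {0..1}) F"
    using Sc S1 pos unfolding F_def case_prod_unfold by (intro continuous_intros) force+
  moreover have GF: "G (F z) = z" if "z \<in> {0..1} \<times> {0..1}" for z
  proof -
    obtain l u where z: "z = (l, u)" "l \<in> {0..1}" "u \<in> {0..1}" using \<open>z \<in> _\<close> by auto
    then show ?thesis
      using pos[OF z(2)] arclength_inv_arclength[OF facts[OF z(2)] z(3)] by (simp add: F_def G_def)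
  qed
  ultimately have "continuous_on (F ` ({0..1} \<times> {0..1})) G"
    by (intro continuous_on_inv compact_Times) auto
  moreover have "{0..1} \<times> {0..1} \<subseteq> F ` ({0..1} \<times> {0..1})"
  proof
    fix z :: "real \<times> real" assume "z \<in> {0..1} \<times> {0..1}"
    then obtain l v where z: "z = (l, v)" "l \<in> {0..1}" "v \<in> {0..1}" by auto
    have in01: "?\<tau> l (?S l 1 * v) \<in> {0..1}" "?S l (?\<tau> l (?S l 1 * v)) = ?S l 1 * v"
      using arclength_inv_in[OF facts[OF z(2)], of 0 1 "?S l 1 * v"] z pos[OF z(2)]
      by (auto simp: arclength_def[of _ 0] mult_left_le)
    then have "F (l, ?\<tau> l (?S l 1 * v)) = z" using z pos[OF z(2)] by (simp add: F_def)
    then show "z \<in> F ` ({0..1} \<times> {0..1})" using z in01 by force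
  qed
  ultimately have Gc: "continuous_on ({0..1} \<times> {0..1}) G" using continuous_on_subset by blast
  have G01: "G z \<in> {0..1} \<times> {0..1}" if "z \<in> {0..1} \<times> {0..1}" for z
    using arclength_inv_in(1)[OF facts, of "fst z" 0 1 "?S (fst z) 1 * snd z"] pos[of "fst z"] that
    by (auto simp: G_def arclength_def[of _ 0] mult_left_le)
  have "continuous_on ({0..1} \<times> {0..1}) (\<lambda>z. (\<lambda>(l, u). \<theta> l u) (G z))"
    by (rule continuous_on_compose2[OF \<theta> Gc]) (use G01 in blast)
  then have "continuous_on ({0..1} \<times> {0..1}) (\<lambda>z. ?S (fst z) 1 *\<^sub>R dir ((\<lambda>(l, u). \<theta> l u) (G z)))"
    by (intro continuous_intros S1)
  then show "continuous_on ({0..1} \<times> {0..1}) (\<lambda>(l, u). unit_deriv (curve_with x (\<theta> l) (\<rho> l)) u)"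
  proof (rule continuous_on_eq)
    fix z :: "real \<times> real" assume "z \<in> {0..1} \<times> {0..1}"
    then obtain l v where z: "z = (l, v)" "l \<in> {0..1}" "v \<in> {0..1}" by auto
    have "ivl_deriv 0 (?S l 1) (snd (curve_with x (\<theta> l) (\<rho> l))) (?S l 1 * v)
        = dir (\<theta> l (?\<tau> l (?S l 1 * v)))"
      unfolding curve_with_def
      by (intro ivl_derivI[OF pos[OF z(2)]] curve_of_deriv
          angle_fun_continuous[OF angle_fun_arclength_inv[OF adm[OF z(2)]]])
        (use z pos[OF z(2)] in \<open>auto simp: mult_left_le\<close>)
    then show "?S (fst z) 1 *\<^sub>R dir ((\<lambda>(l, u). \<theta> l u) (G z))
        = (case z of (l, u) \<Rightarrow> unit_deriv (curve_with x (\<theta> l) (\<rho> l)) u)"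
      using ivl_deriv_unit_param[OF M[OF z(2)] z(3)] z
      by (simp add: curve_with_def curve_of_def G_def)
  qed
qed

lemma curve_with_homotopic:
  fixes \<theta> \<rho> :: "real \<Rightarrow> real \<Rightarrow> real"
  assumes \<theta>: "continuous_on ({0..1} \<times> {0..1}) (\<lambda>(l, u). \<theta> l u)"
    and \<rho>: "continuous_on ({0..1} \<times> {0..1}) (\<lambda>(l, u). \<rho> l u)"
    and adm: "\<And>l. l \<in> {0..1} \<Longrightarrow> admissible \<kappa> (y - x) (\<theta> l) (\<rho> l)"
  shows "path_component_of (curve_topology \<kappa> x y) (curve_with x (\<theta> 0) (\<rho> 0)) (curve_with x (\<theta> 1) (\<rho> 1))"
  unfolding path_component_of_def using curve_with_pathin[OF assms] by blast

lemma admissible_convex: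
  assumes a: "admissible \<kappa> w \<theta> \<rho>" and b: "admissible \<kappa> w \<theta> \<rho>'" and l: "l \<in> {0..1}"
  shows "admissible \<kappa> w \<theta> (\<lambda>u. (1 - l) * \<rho> u + l * \<rho>' u)"
proof -
  have c: "continuous_on {0..1} \<rho>" "continuous_on {0..1} \<rho>'" "continuous_on {0..1} \<theta>"
    using a b by (auto simp: admissible_def)
  have "\<bar>\<theta> v - \<theta> u\<bar> \<le> \<kappa> * integral {u..v} (\<lambda>u. (1 - l) * \<rho> u + l * \<rho>' u)"
    if "0 \<le> u" "u \<le> v" "v \<le> 1" for u v
  proof -
    have "\<rho> integrable_on {u..v}" "\<rho>' integrable_on {u..v}"
      by (rule integrable_continuous_real, rule continuous_on_subset[OF c(1)] continuous_on_subset[OF c(2)],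
          use that in auto)+
    then have eq: "integral {u..v} (\<lambda>u. (1 - l) * \<rho> u + l * \<rho>' u)
        = (1 - l) * integral {u..v} \<rho> + l * integral {u..v} \<rho>'"
      by (subst Henstock_Kurzweil_Integration.integral_add) (auto intro: integrable_on_mult_right)
    have "(1 - l) * \<bar>\<theta> v - \<theta> u\<bar> \<le> (1 - l) * (\<kappa> * integral {u..v} \<rho>)"
      using a that l by (intro mult_left_mono) (auto simp: admissible_def)
    moreover have "l * \<bar>\<theta> v - \<theta> u\<bar> \<le> l * (\<kappa> * integral {u..v} \<rho>')"
      using b that l by (intro mult_left_mono) (auto simp: admissible_def)
    ultimately show ?thesis unfolding eq by (simp add: algebra_simps)
  qed
  moreover have "0 < (1 - l) * \<rho> u + l * \<rho>' u" if "u \<in> {0..1}" for u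
  proof -
    have "0 < \<rho> u" "0 < \<rho>' u" using a b that by (auto simp: admissible_def)
    then show ?thesis using l by (cases "l = 0") (auto intro!: add_nonneg_pos)
  qed
  moreover have "integral {0..1} (\<lambda>u. ((1 - l) * \<rho> u + l * \<rho>' u) *\<^sub>R dir (\<theta> u)) = w"
  proof -
    have i: "(\<lambda>u. \<rho> u *\<^sub>R dir (\<theta> u)) integrable_on {0..1}" "(\<lambda>u. \<rho>' u *\<^sub>R dir (\<theta> u)) integrable_on {0..1}"
      by (rule integrable_continuous_real, intro continuous_intros c)+
    have "integral {0..1} (\<lambda>u. (1 - l) *\<^sub>R (\<rho> u *\<^sub>R dir (\<theta> u)) + l *\<^sub>R (\<rho>' u *\<^sub>R dir (\<theta> u)))
        = (1 - l) *\<^sub>R integral {0..1} (\<lambda>u. \<rho> u *\<^sub>R dir (\<theta> u)) + l *\<^sub>R integral {0..1} (\<lambda>u. \<rho>' u *\<^sub>R dir (\<theta> u))"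
      by (simp only: Henstock_Kurzweil_Integration.integral_add integrable_cmul integral_cmul i)
    also have "\<dots> = w" using a b by (simp add: admissible_def flip: scaleR_add_left)
    finally show ?thesis by (simp add: scaleR_add_left)
  qed
  ultimately show ?thesis
    using a by (auto simp: admissible_def intro!: continuous_intros c)
qed

text \<open>The segment between the two speeds is a homotopy. Up to homotopy a curve thus depends on
  its angle function alone, and speeds may be replaced at will.\<close>

lemma curve_with_homotopic_same_angle:
  assumes a: "admissible \<kappa> (y - x) \<theta> \<rho>" and b: "admissible \<kappa> (y - x) \<theta> \<rho>'"
  shows "path_component_of (curve_topology \<kappa> x y) (curve_with x \<theta> \<rho>) (curve_with x \<theta> \<rho>')"
proof -
  have c: "continuous_on {0..1} \<rho>" "continuous_on {0..1} \<rho>'" "continuous_on {0..1} \<theta>"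
    using a b by (auto simp: admissible_def)
  have s: "continuous_on ({0..1::real} \<times> {0..1}) (\<lambda>z. h (snd z))" if "continuous_on {0..1} h" for h :: "real \<Rightarrow> real"
    by (rule continuous_on_compose2[OF that]) (auto intro!: continuous_intros)
  have "path_component_of (curve_topology \<kappa> x y)
      (curve_with x \<theta> (\<lambda>u. (1 - 0) * \<rho> u + 0 * \<rho>' u)) (curve_with x \<theta> (\<lambda>u. (1 - 1) * \<rho> u + 1 * \<rho>' u))"
    by (rule curve_with_homotopic[where \<theta> = "\<lambda>l. \<theta>" and \<rho> = "\<lambda>l u. (1 - l) * \<rho> u + l * \<rho>' u"])
      (auto simp: case_prod_unfold intro!: continuous_intros s c admissible_convex[OF a b])
  then show ?thesis by simp
qed

subsection \<open>Homotopies between curves that leave the lens\<close>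

lemma integral_inner_left:
  fixes f :: "real \<Rightarrow> real^2"
  assumes "continuous_on {a..b} f"
  shows "integral {a..b} f \<bullet> c = integral {a..b} (\<lambda>t. f t \<bullet> c)"
  using integral_linear[OF integrable_continuous_real[OF assms] bounded_linear_inner_left, of c]
  by (simp add: o_def)

text \<open>An interval longer than \<pi> contains pairs of opposite directions, on which the
  functional must vanish; two independent such pairs force \<open>v = 0\<close>.\<close>

lemma inner_dir_nonpos_imp_zero:
  fixes v :: "real^2"
  assumes "b - a > pi" and le: "\<And>t. t \<in> {a..b} \<Longrightarrow> v \<bullet> dir t \<le> 0"
  shows "v = 0"
proof -
  \<comment> \<open>The cap at 1 keeps \<open>e\<close> below \<pi>, so the directions at
    \<open>a\<close> and \<open>a + e\<close> are independent.\<close>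
  define e where "e = min (b - a - pi) 1"
  have e: "0 < e" "e < pi" "a + e + pi \<le> b" using assms(1) pi_gt3 by (auto simp: e_def)
  have "v \<bullet> dir t = 0" if "t \<in> {a..a + e}" for t
  proof -
    have "v \<bullet> dir (t + pi) = - (v \<bullet> dir t)" by (simp add: inner_real2)
    then show ?thesis using le[of t] le[of "t + pi"] that e pi_gt3 by auto
  qed
  then have z: "v \<bullet> dir a = 0" "v \<bullet> dir (a + e) = 0" using e by auto
  have "v \<bullet> dir (a + pi / 2) * sin e = v \<bullet> dir (a + e) - v \<bullet> dir a * cos e"
    by (simp add: inner_real2 cos_add sin_add algebra_simps)
  moreover have "sin e \<noteq> 0" using sin_gt_zero[of e] e by auto
  ultimately have "v \<bullet> dir (a + pi / 2) = 0" using z by simp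
  then show ?thesis using real2_dir_eqI[of v a 0] z by simp
qed

text \<open>If the cone of all vectors reachable with nonnegative densities were proper, a separating
  functional \<open>a\<close> would be nonpositive on it; testing it with the density \<open>max 0 (a \<bullet> dir (\<theta> u))\<close>
  shows that \<open>a\<close> is nonpositive on all directions taken by \<open>\<theta>\<close>, which cover more than a half circle.\<close>

lemma reach_by_density:
  fixes z :: "real^2" and \<theta> :: "real \<Rightarrow> real"
  assumes \<theta>: "continuous_on {0..1} \<theta>" and pq: "p \<in> {0..1}" "q \<in> {0..1}" "\<theta> q - \<theta> p > pi"
  obtains \<eta> where "continuous_on {0..1} \<eta>" "\<And>u. u \<in> {0..1} \<Longrightarrow> 0 \<le> \<eta> u"
    "integral {0..1} (\<lambda>u. \<eta> u *\<^sub>R dir (\<theta> u)) = z"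
proof -
  define I where "I \<eta> = integral {0..1} (\<lambda>u. \<eta> u *\<^sub>R dir (\<theta> u))" for \<eta>
  define D where "D = {\<eta> :: real \<Rightarrow> real. continuous_on {0..1} \<eta> \<and> (\<forall>u\<in>{0..1}. 0 \<le> \<eta> u)}"
  have ii: "(\<lambda>u. \<eta> u *\<^sub>R dir (\<theta> u)) integrable_on {0..1}" if "\<eta> \<in> D" for \<eta>
    using that by (intro integrable_continuous_real continuous_intros \<theta>) (auto simp: D_def)
  have "z \<in> I ` D"
  proof (rule ccontr)
    assume "z \<notin> I ` D"
    have lin: "(\<lambda>u. s * \<eta> u + t * \<eta>' u) \<in> D" "I (\<lambda>u. s * \<eta> u + t * \<eta>' u) = s *\<^sub>R I \<eta> + t *\<^sub>R I \<eta>'"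
      if "\<eta> \<in> D" "\<eta>' \<in> D" "s \<ge> 0" "t \<ge> 0" for \<eta> \<eta>' s t
    proof -
      show "(\<lambda>u. s * \<eta> u + t * \<eta>' u) \<in> D" using that by (auto simp: D_def intro!: continuous_intros)
      have "integral {0..1} (\<lambda>u. s *\<^sub>R (\<eta> u *\<^sub>R dir (\<theta> u)) + t *\<^sub>R (\<eta>' u *\<^sub>R dir (\<theta> u)))
        = s *\<^sub>R I \<eta> + t *\<^sub>R I \<eta>'"
        unfolding I_def
        by (simp only: Henstock_Kurzweil_Integration.integral_add integrable_cmul integral_cmul
            ii[OF that(1)] ii[OF that(2)])
      then show "I (\<lambda>u. s * \<eta> u + t * \<eta>' u) = s *\<^sub>R I \<eta> + t *\<^sub>R I \<eta>'"
        by (simp add: I_def scaleR_add_left)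
    qed
    have "convex (I ` D)"
    proof (rule convexI)
      fix v w :: "real^2" and s t :: real assume "v \<in> I ` D" "w \<in> I ` D" and st: "0 \<le> s" "0 \<le> t"
      then obtain \<eta> \<eta>' where "\<eta> \<in> D" "\<eta>' \<in> D" "v = I \<eta>" "w = I \<eta>'" by blast
      then show "s *\<^sub>R v + t *\<^sub>R w \<in> I ` D"
        using lin(2)[of \<eta> \<eta>' s t] imageI[OF lin(1)[of \<eta> \<eta>' s t], of I] st by simp
    qed
    moreover have "(\<lambda>_. 0) \<in> D" by (simp add: D_def)
    then have "I ` D \<noteq> {}" by blast
    ultimately have "\<exists>a b. a \<noteq> 0 \<and> (\<forall>v\<in>I ` D. a \<bullet> v \<le> b) \<and> (\<forall>v\<in>{z}. a \<bullet> v \<ge> b)"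
      using \<open>z \<notin> I ` D\<close> by (intro separating_hyperplane_sets) simp_all
    then obtain a b where a: "a \<noteq> 0" "\<And>v. v \<in> I ` D \<Longrightarrow> a \<bullet> v \<le> b" by blast
    \<comment> \<open>A functional bounded above on a cone is nonpositive there: a positive value
      could be scaled to |b| + 1.\<close>
    have cone: "a \<bullet> I \<eta> \<le> 0" if "\<eta> \<in> D" for \<eta>
    proof (rule ccontr)
      assume "\<not> a \<bullet> I \<eta> \<le> 0"
      then have pos: "a \<bullet> I \<eta> > 0" by simp
      define s where "s = (\<bar>b\<bar> + 1) / (a \<bullet> I \<eta>)"
      have "s \<ge> 0" using pos by (simp add: s_def)
      then have "I (\<lambda>u. s * \<eta> u + 0 * \<eta> u) \<in> I ` D" using lin(1)[OF that that] by blast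
      then have "a \<bullet> (s *\<^sub>R I \<eta>) \<le> b" using a(2) lin(2)[OF that that \<open>s \<ge> 0\<close>, of 0] by fastforce
      then show False using pos by (simp add: s_def)
    qed
    define \<eta> where "\<eta> u = max 0 (a \<bullet> dir (\<theta> u))" for u
    have \<eta>: "continuous_on {0..1} \<eta>" unfolding \<eta>_def[abs_def] by (intro continuous_intros \<theta>)
    then have "\<eta> \<in> D" by (auto simp: D_def \<eta>_def)
    have "a \<bullet> I \<eta> = integral {0..1} (\<lambda>u. (\<eta> u *\<^sub>R dir (\<theta> u)) \<bullet> a)"
      unfolding I_def by (subst inner_commute, rule integral_inner_left) (intro continuous_intros \<theta> \<eta>)
    also have "\<dots> = integral {0..1} (\<lambda>u. (\<eta> u)\<^sup>2)"
      by (rule Henstock_Kurzweil_Integration.integral_cong)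
        (auto simp: \<eta>_def max_def power2_eq_square inner_commute)
    finally have "integral {0..1} (\<lambda>u. (\<eta> u)\<^sup>2) \<le> 0" using cone[OF \<open>\<eta> \<in> D\<close>] by simp
    moreover have "integral {0..1} (\<lambda>u. (\<eta> u)\<^sup>2) \<ge> 0"
      by (rule Henstock_Kurzweil_Integration.integral_nonneg)
        (auto intro!: integrable_continuous_real continuous_intros \<eta>)
    ultimately have "\<forall>u\<in>{0..1}. (\<eta> u)\<^sup>2 = 0"
      using integral_eq_0_iff[of 0 1 "\<lambda>u. (\<eta> u)\<^sup>2"] \<eta> by (auto intro!: continuous_intros)
    then have nonpos: "a \<bullet> dir (\<theta> u) \<le> 0" if "u \<in> {0..1}" for u
      using that by (metis \<eta>_def max.cobounded2 zero_eq_power2)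
    have "a = 0"
    proof (rule inner_dir_nonpos_imp_zero[OF pq(3)])
      fix t assume t: "t \<in> {\<theta> p..\<theta> q}"
      have "connected (\<theta> ` {0..1})" by (intro connected_continuous_image \<theta>) auto
      then have "t \<in> \<theta> ` {0..1}"
        using connectedD_interval[of "\<theta> ` {0..1}" "\<theta> p" "\<theta> q" t] pq t by auto
      then show "a \<bullet> dir t \<le> 0" using nonpos by auto
    qed
    then show False using a by simp
  qed
  then show thesis using that by (auto simp: I_def D_def)
qed

text \<open>A Lipschitz bound for the angle with constant \<kappa> L makes every speed above
  \<open>L\<close> satisfy the curvature bound, so nonnegative densities can be added freely to
  adjust the end point.\<close>

lemma admissibleI:
  assumes "piecewise_C1_on_ivl 0 1 \<theta>" and \<theta>: "continuous_on {0..1} \<theta>" and \<rho>: "continuous_on {0..1} \<rho>"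
    and lip: "\<And>u v. 0 \<le> u \<Longrightarrow> u \<le> v \<Longrightarrow> v \<le> 1 \<Longrightarrow> \<bar>\<theta> v - \<theta> u\<bar> \<le> \<kappa> * (L * (v - u))"
    and "\<kappa> \<ge> 0" and L: "\<And>u. u \<in> {0..1} \<Longrightarrow> L \<le> \<rho> u" "\<And>u. u \<in> {0..1} \<Longrightarrow> 0 < \<rho> u"
    and "integral {0..1} (\<lambda>u. \<rho> u *\<^sub>R dir (\<theta> u)) = w"
  shows "admissible \<kappa> w \<theta> \<rho>"
proof -
  have "\<bar>\<theta> v - \<theta> u\<bar> \<le> \<kappa> * integral {u..v} \<rho>" if uv: "0 \<le> u" "u \<le> v" "v \<le> 1" for u v
  proof -
    have "integral {u..v} (\<lambda>_. L) \<le> integral {u..v} \<rho>"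
      by (rule integral_le) (use uv L in \<open>auto intro!: integrable_continuous_real continuous_on_subset[OF \<rho>]\<close>)
    then have "L * (v - u) \<le> integral {u..v} \<rho>" using uv by (simp add: mult.commute)
    then show ?thesis using lip[OF uv] \<open>\<kappa> \<ge> 0\<close> by (meson mult_left_mono order_trans)
  qed
  then show ?thesis using assms by (auto simp: admissible_def)
qed

definition det2 :: "real^2 \<Rightarrow> real^2 \<Rightarrow> real" where
  "det2 v w = v$1 * w$2 - v$2 * w$1"

lemma cramer2:
  assumes "det2 a b \<noteq> 0"
  shows "(det2 z b / det2 a b) *\<^sub>R a + (det2 a z / det2 a b) *\<^sub>R b = z"
proof -
  have "det2 z b * a$i + det2 a z * b$i = det2 a b * z$i" for i
    using exhaust_2[of i] by (auto simp: det2_def algebra_simps)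
  then have "(det2 z b * a$i + det2 a z * b$i) / det2 a b = z$i" for i using assms by simp
  then show ?thesis by (simp add: vec_eq_iff add_divide_distrib)
qed

text \<open>Start from a speed at \<open>l\<^sub>0\<close> that exceeds the lower bound \<open>L\<close> with room to spare, and restore
  the prescribed end point near \<open>l\<^sub>0\<close> by small multiples of two nonnegative densities whose displacements
  at \<open>l\<^sub>0\<close> form a basis.\<close>

lemma admissible_locally:
  fixes \<theta> :: "real \<Rightarrow> real \<Rightarrow> real" and w :: "real^2"
  assumes \<theta>: "continuous_on ({0..1} \<times> {0..1}) (\<lambda>(l, u). \<theta> l u)"
    and pw: "\<And>l. l \<in> {0..1} \<Longrightarrow> piecewise_C1_on_ivl 0 1 (\<theta> l)"
    and lip: "\<And>l u v. l \<in> {0..1} \<Longrightarrow> 0 \<le> u \<Longrightarrow> u \<le> v \<Longrightarrow> v \<le> 1 \<Longrightarrow> \<bar>\<theta> l v - \<theta> l u\<bar> \<le> \<kappa> * (L * (v - u))"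
    and "\<kappa> \<ge> 0" "L \<ge> 0"
    and l0: "l0 \<in> {0..1}" and pq: "p \<in> {0..1}" "q \<in> {0..1}" "\<theta> l0 q - \<theta> l0 p > pi"
  obtains d \<rho> where "d > 0" "continuous_on (({0..1} \<inter> ball l0 d) \<times> {0..1}) (\<lambda>(l, u). \<rho> l u)"
    "\<And>l. l \<in> {0..1} \<inter> ball l0 d \<Longrightarrow> admissible \<kappa> w (\<theta> l) (\<rho> l)"
proof -
  have c: "continuous_on {0..1} (\<theta> l)" if "l \<in> {0..1}" for l
    using continuous_on_o_Pair[OF \<theta> that] by (simp add: o_def)
  define I where "I l \<eta> = integral {0..1} (\<lambda>u. \<eta> u *\<^sub>R dir (\<theta> l u))" for l \<eta>
  have ii: "(\<lambda>u. \<eta> u *\<^sub>R dir (\<theta> l u)) integrable_on {0..1}" if "l \<in> {0..1}" "continuous_on {0..1} \<eta>" for l \<eta>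
    by (intro integrable_continuous_real continuous_intros c that)
  have Ic: "continuous_on {0..1} (\<lambda>l. I l \<eta>)" if \<eta>: "continuous_on {0..1} \<eta>" for \<eta>
  proof -
    have "continuous_on ({0..1} \<times> cbox 0 1) (\<lambda>(l, u). \<eta> u *\<^sub>R dir (\<theta> l u))"
      using \<theta> unfolding case_prod_unfold
      by (auto intro!: continuous_intros continuous_on_compose2[OF \<eta>])
    from integral_continuous_on_param[OF this] show ?thesis by (simp add: I_def[abs_def])
  qed
  have ex: "\<exists>\<eta>. continuous_on {0..1} \<eta> \<and> (\<forall>u\<in>{0..1}. 0 \<le> \<eta> u) \<and> I l0 \<eta> = z" for z
    using reach_by_density[OF c[OF l0] pq, of z] unfolding I_def by metis
  obtain \<eta>1 where \<eta>1: "continuous_on {0..1} \<eta>1" "\<And>u. u \<in> {0..1} \<Longrightarrow> 0 \<le> \<eta>1 u" "I l0 \<eta>1 = axis 1 1"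
    using ex by metis
  obtain \<eta>2 where \<eta>2: "continuous_on {0..1} \<eta>2" "\<And>u. u \<in> {0..1} \<Longrightarrow> 0 \<le> \<eta>2 u" "I l0 \<eta>2 = axis 2 1"
    using ex by metis
  obtain \<eta>0 where \<eta>0: "continuous_on {0..1} \<eta>0" "\<And>u. u \<in> {0..1} \<Longrightarrow> 0 \<le> \<eta>0 u"
    "I l0 \<eta>0 = w - I l0 (\<lambda>u. L + 2)"
    using ex by metis
  \<comment> \<open>\<eta>0 corrects the end point of the constant speed L + 2. The two later
    corrections use at most 1/2 each, so the speed stays at least L + 1, which is positive even for
    L = 0.\<close>
  define \<rho>0 where "\<rho>0 u = (L + 2) + \<eta>0 u" for u
  have \<rho>0: "continuous_on {0..1} \<rho>0" unfolding \<rho>0_def[abs_def] by (intro continuous_intros \<eta>0)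
  have "I l0 \<rho>0 = w"
    using \<eta>0(3) ii[OF l0 \<eta>0(1)] ii[OF l0, of "\<lambda>u. L + 2"]
    by (simp add: I_def \<rho>0_def scaleR_add_left[of "L + 2"] Henstock_Kurzweil_Integration.integral_add)
  define R where "R l = w - I l \<rho>0" for l
  define D where "D l = det2 (I l \<eta>1) (I l \<eta>2)" for l
  define a b where "a l = det2 (R l) (I l \<eta>2) / D l" and "b l = det2 (I l \<eta>1) (R l) / D l" for l
  have Dc: "continuous_on {0..1} D"
    unfolding D_def[abs_def] det2_def by (intro continuous_intros Ic \<eta>1 \<eta>2)
  have D0: "D l0 = 1" by (simp add: D_def det2_def \<eta>1 \<eta>2 axis_def)
  have R0: "R l0 = 0" by (simp add: R_def \<open>I l0 \<rho>0 = w\<close>)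
  \<comment> \<open>The determinant is 1 at \<open>l0\<close>, so it cannot vanish while it differs
    from that value by less than 1.\<close>
  obtain d1 where d1: "d1 > 0" "\<And>l. l \<in> {0..1} \<Longrightarrow> dist l l0 < d1 \<Longrightarrow> dist (D l) (D l0) < 1"
    using Dc l0 unfolding continuous_on_iff by (metis zero_less_one)
  let ?U = "{0..1} \<inter> ball l0 d1"
  have Dne: "D l \<noteq> 0" if "l \<in> ?U" for l
    using d1(2)[of l] that by (auto simp: D0 dist_commute dist_real_def)
  have Uc: "continuous_on ?U f" if "continuous_on {0..1} f" for f :: "real \<Rightarrow> 'b::topological_space"
    using that continuous_on_subset by blast
  have ab: "continuous_on ?U a" "continuous_on ?U b"
    unfolding a_def[abs_def] b_def[abs_def] det2_def R_def
    by (intro continuous_intros Uc Ic \<eta>1 \<eta>2 \<rho>0 Dc ballI Dne; assumption)+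
  obtain M where M: "M > 0" "\<And>u. u \<in> {0..1} \<Longrightarrow> \<eta>1 u \<le> M" "\<And>u. u \<in> {0..1} \<Longrightarrow> \<eta>2 u \<le> M"
  proof -
    have "bdd_above (\<eta>1 ` {0..1})" "bdd_above (\<eta>2 ` {0..1})"
      by (intro bounded_imp_bdd_above compact_imp_bounded compact_continuous_image \<eta>1 \<eta>2; simp)+
    then obtain M1 M2 where "\<forall>u\<in>{0..1}. \<eta>1 u \<le> M1" "\<forall>u\<in>{0..1}. \<eta>2 u \<le> M2"
      unfolding bdd_above_def by blast
    then show thesis by (intro that[of "max 1 (max M1 M2)"]) (auto simp: le_max_iff_disj)
  qed
  have "l0 \<in> ?U" using l0 d1 by simp
  have "a l0 = 0" "b l0 = 0" by (simp_all add: a_def b_def R0 det2_def)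
  \<comment> \<open>The coefficients vanish at \<open>l0\<close>, and \<open>M\<close> bounds both
    densities; below 1 / (2 M) each correction has size at most 1/2.\<close>
  obtain d2 where d2: "d2 > 0" "\<And>l. l \<in> ?U \<Longrightarrow> dist l l0 < d2 \<Longrightarrow> dist (a l) (a l0) < 1 / (2 * M)"
    using ab(1) \<open>l0 \<in> ?U\<close> M(1) unfolding continuous_on_iff by (metis zero_less_divide_1_iff zero_less_mult_iff zero_less_numeral)
  obtain d3 where d3: "d3 > 0" "\<And>l. l \<in> ?U \<Longrightarrow> dist l l0 < d3 \<Longrightarrow> dist (b l) (b l0) < 1 / (2 * M)"
    using ab(2) \<open>l0 \<in> ?U\<close> M(1) unfolding continuous_on_iff by (metis zero_less_divide_1_iff zero_less_mult_iff zero_less_numeral)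
  define d where "d = min d1 (min d2 d3)"
  have sub: "{0..1} \<inter> ball l0 d \<subseteq> ?U" by (auto simp: d_def)
  define \<rho> where "\<rho> l u = \<rho>0 u + a l * \<eta>1 u + b l * \<eta>2 u" for l u
  show thesis
  proof
    show "d > 0" using d1 d2 d3 by (simp add: d_def)
    let ?V = "{0..1} \<inter> ball l0 d"
    have sn: "continuous_on (?V \<times> {0..1}) (\<lambda>z. h (snd z))" if "continuous_on {0..1} h" for h :: "real \<Rightarrow> real"
      by (rule continuous_on_compose2[OF that]) (auto intro!: continuous_intros)
    have fs: "continuous_on (?V \<times> {0..1}) (\<lambda>z. h (fst z))" if "continuous_on ?U h" for h :: "real \<Rightarrow> real"
      by (rule continuous_on_compose2[OF that]) (use sub in \<open>auto intro!: continuous_intros\<close>)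
    show "continuous_on (?V \<times> {0..1}) (\<lambda>(l, u). \<rho> l u)"
      unfolding \<rho>_def case_prod_unfold by (intro continuous_intros sn fs \<rho>0 ab \<eta>1 \<eta>2)
    fix l assume l: "l \<in> ?V"
    then have lU: "l \<in> ?U" and l01: "l \<in> {0..1}" using sub by auto
    have "dist l l0 < d2" "dist l l0 < d3" using l by (auto simp: d_def dist_commute)
    then have "\<bar>a l\<bar> < 1 / (2 * M)" "\<bar>b l\<bar> < 1 / (2 * M)"
      using d2(2)[OF lU] d3(2)[OF lU] by (simp_all add: \<open>a l0 = 0\<close> \<open>b l0 = 0\<close>)
    then have ab': "\<bar>a l\<bar> * M \<le> 1 / 2" "\<bar>b l\<bar> * M \<le> 1 / 2" using M(1) by (simp_all add: field_simps)
    have ge: "\<rho> l u \<ge> L + 1" if u: "u \<in> {0..1}" for u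
    proof -
      have "\<bar>a l * \<eta>1 u\<bar> \<le> 1 / 2" "\<bar>b l * \<eta>2 u\<bar> \<le> 1 / 2"
        using mult_left_mono[OF M(2)[OF u], of "\<bar>a l\<bar>"] mult_left_mono[OF M(3)[OF u], of "\<bar>b l\<bar>"] ab'
          \<eta>1(2)[OF u] \<eta>2(2)[OF u] by (simp_all add: abs_mult)
      then show ?thesis using \<eta>0(2)[OF u] by (simp add: \<rho>_def \<rho>0_def abs_le_iff)
    qed
    have \<rho>c: "continuous_on {0..1} (\<rho> l)"
      unfolding \<rho>_def[abs_def] by (intro continuous_intros \<rho>0 \<eta>1 \<eta>2)
    show "admissible \<kappa> w (\<theta> l) (\<rho> l)"
    proof (rule admissibleI[OF pw[OF l01] c[OF l01] \<rho>c lip[OF l01] \<open>\<kappa> \<ge> 0\<close>])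
      have "integral {0..1} (\<lambda>u. \<rho>0 u *\<^sub>R dir (\<theta> l u) + (a l *\<^sub>R (\<eta>1 u *\<^sub>R dir (\<theta> l u)) + b l *\<^sub>R (\<eta>2 u *\<^sub>R dir (\<theta> l u))))
        = I l \<rho>0 + (a l *\<^sub>R I l \<eta>1 + b l *\<^sub>R I l \<eta>2)"
        using ii[OF l01 \<rho>0] ii[OF l01 \<eta>1(1)] ii[OF l01 \<eta>2(1)]
        by (simp only: I_def Henstock_Kurzweil_Integration.integral_add integrable_add integrable_cmul
            integral_cmul)
      also have "a l *\<^sub>R I l \<eta>1 + b l *\<^sub>R I l \<eta>2 = R l"
        unfolding a_def b_def D_def by (rule cramer2) (use Dne[OF lU] in \<open>simp add: D_def\<close>)
      finally show "integral {0..1} (\<lambda>u. \<rho> l u *\<^sub>R dir (\<theta> l u)) = w"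
        by (simp add: \<rho>_def R_def scaleR_add_left add.assoc)
    next
      fix u :: real assume "u \<in> {0..1}"
      from ge[OF this] show "L \<le> \<rho> l u" "0 < \<rho> l u" using \<open>L \<ge> 0\<close> by linarith+
    qed
  qed
qed

section \<open>Joining angle functions that share a large turn\<close>

lemma piecewise_C1_smooth:
  assumes d: "\<And>t. (f has_real_derivative f' t) (at t)" and c: "continuous_on UNIV f'"
  shows "piecewise_C1_on_ivl 0 1 f"
proof -
  have "C1_on_ivl 0 1 f"
    by (rule C1_on_ivlI[of _ _ _ f'])
      (use d continuous_on_subset[OF c] in \<open>auto simp flip: has_real_derivative_iff_has_vector_derivative
        intro: has_field_derivative_at_within\<close>)
  then show ?thesis
    unfolding piecewise_C1_on_ivl_def by (intro exI[of _ "1::nat"] exI[of _ real]) auto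
qed

text \<open>With the second function smooth everywhere, the partition of the first one serves the
  sum and no common refinement arises. Hence every interpolation of angles below has a smooth
  target.\<close>

lemma piecewise_C1_linear_combination:
  assumes f: "piecewise_C1_on_ivl a b f"
    and d: "\<And>t. (g has_real_derivative g' t) (at t)" and c: "continuous_on UNIV g'"
  shows "piecewise_C1_on_ivl a b (\<lambda>t. k * f t + m * g t)"
proof -
  obtain n p where p: "p 0 = a" "p (n::nat) = b"
    "\<And>i. i < n \<Longrightarrow> p i < p (Suc i) \<and> C1_on_ivl (p i) (p (Suc i)) f"
    using f unfolding piecewise_C1_on_ivl_def by blast
  have "C1_on_ivl (p i) (p (Suc i)) (\<lambda>t. k * f t + m * g t)" if i: "i < n" for i
  proof -
    let ?D = "ivl_deriv (p i) (p (Suc i)) f" and ?I = "{p i..p (Suc i)}"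
    have less: "p i < p (Suc i)" and C1: "C1_on_ivl (p i) (p (Suc i)) f" using p(3)[OF i] by auto
    show ?thesis
    proof (rule C1_on_ivlI[OF less])
      fix t assume "t \<in> ?I"
      then have "(f has_real_derivative ?D t) (at t within ?I)"
        using C1_on_ivlD[OF C1] by (simp add: has_real_derivative_iff_has_vector_derivative)
      moreover have "(g has_real_derivative g' t) (at t within ?I)"
        using d by (rule has_field_derivative_at_within)
      ultimately have "((\<lambda>t. k * f t + m * g t) has_real_derivative k * ?D t + m * g' t) (at t within ?I)"
        by (intro DERIV_add DERIV_cmult)
      then show "((\<lambda>t. k * f t + m * g t) has_vector_derivative k * ?D t + m * g' t) (at t within ?I)"
        by (simp add: has_real_derivative_iff_has_vector_derivative)
    next
      show "continuous_on ?I (\<lambda>t. k * ?D t + m * g' t)"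
        using C1 continuous_on_subset[OF c] by (auto simp: C1_on_ivl_def intro!: continuous_intros)
    qed
  qed
  then show ?thesis unfolding piecewise_C1_on_ivl_def using p by blast
qed

lemma admissible_lipschitz:
  assumes a: "admissible \<kappa> w \<theta> \<rho>" and "\<kappa> \<ge> 0" and M: "\<And>u. u \<in> {0..1} \<Longrightarrow> \<rho> u \<le> M"
    and uv: "0 \<le> u" "u \<le> v" "v \<le> 1"
  shows "\<bar>\<theta> v - \<theta> u\<bar> \<le> \<kappa> * (M * (v - u))"
proof -
  have \<rho>: "continuous_on {0..1} \<rho>" using a by (simp add: admissible_def)
  have "integral {u..v} \<rho> \<le> integral {u..v} (\<lambda>_. M)"
    by (rule integral_le) (use uv M in \<open>auto intro!: integrable_continuous_real continuous_on_subset[OF \<rho>]\<close>)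
  then have "\<kappa> * integral {u..v} \<rho> \<le> \<kappa> * (M * (v - u))"
    using uv \<open>\<kappa> \<ge> 0\<close> by (intro mult_left_mono) (simp_all add: mult.commute)
  moreover have "\<bar>\<theta> v - \<theta> u\<bar> \<le> \<kappa> * integral {u..v} \<rho>" using a uv by (auto simp: admissible_def)
  ultimately show ?thesis by linarith
qed

text \<open>The local construction, applied to the constant family of angles.\<close>

lemma admissible_exists:
  assumes "continuous_on {0..1} \<theta>" "piecewise_C1_on_ivl 0 1 \<theta>"
    and "\<And>u v. 0 \<le> u \<Longrightarrow> u \<le> v \<Longrightarrow> v \<le> 1 \<Longrightarrow> \<bar>\<theta> v - \<theta> u\<bar> \<le> \<kappa> * (L * (v - u))"
    and "\<kappa> \<ge> 0" "L \<ge> 0" and pq: "p \<in> {0..1}" "q \<in> {0..1}" "\<theta> q - \<theta> p > pi"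
  obtains \<rho> where "admissible \<kappa> w \<theta> \<rho>"
proof -
  have c: "continuous_on ({0..1} \<times> {0..1}) (\<lambda>(l::real, u). \<theta> u)"
    unfolding case_prod_unfold
    by (rule continuous_on_compose2[OF assms(1)]) (auto intro!: continuous_intros)
  show thesis
  proof (rule admissible_locally[where \<theta> = "\<lambda>_. \<theta>" and \<kappa> = \<kappa> and L = L and ?l0.0 = 0
        and p = p and q = q and w = w])
    fix d and \<rho> :: "real \<Rightarrow> real \<Rightarrow> real"
    assume "0 < d" and a: "\<And>l. l \<in> {0..1} \<inter> ball 0 d \<Longrightarrow> admissible \<kappa> w \<theta> (\<rho> l)"
    then show thesis using that[OF a[of 0]] by simp
  qed (use assms c in auto)
qed

text \<open>Every convex combination of the angles also gains more than \<pi> from \<open>p\<close>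
  to \<open>q\<close>, so admissible speeds exist at each stage and can be chosen continuously
  nearby. Local choices are reconciled by the homotopies over a fixed angle, and connectedness of
  \<open>{0..1}\<close> joins the two ends.\<close>

lemma curve_with_homotopic_common_turn:
  fixes \<theta>0 \<theta>1 :: "real \<Rightarrow> real"
  assumes "\<kappa> \<ge> 0"
    and a0: "admissible \<kappa> (y - x) \<theta>0 \<rho>0" and a1: "admissible \<kappa> (y - x) \<theta>1 \<rho>1"
    and smooth: "\<And>t. (\<theta>1 has_real_derivative \<theta>1' t) (at t)" "continuous_on UNIV \<theta>1'"
    and pq: "p \<in> {0..1}" "q \<in> {0..1}" "\<theta>0 q - \<theta>0 p > pi" "\<theta>1 q - \<theta>1 p > pi"
  shows "path_component_of (curve_topology \<kappa> x y) (curve_with x \<theta>0 \<rho>0) (curve_with x \<theta>1 \<rho>1)"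
proof -
  define \<theta> where "\<theta> l u = (1 - l) * \<theta>0 u + l * \<theta>1 u" for l u
  have c: "continuous_on {0..1} \<theta>0" "continuous_on {0..1} \<theta>1" "continuous_on {0..1} \<rho>0" "continuous_on {0..1} \<rho>1"
    using a0 a1 by (auto simp: admissible_def)
  have sn: "continuous_on ({0..1::real} \<times> {0..1}) (\<lambda>z. h (snd z))" if "continuous_on {0..1} h" for h :: "real \<Rightarrow> real"
    by (rule continuous_on_compose2[OF that]) (auto intro!: continuous_intros)
  have \<theta>c: "continuous_on ({0..1} \<times> {0..1}) (\<lambda>(l, u). \<theta> l u)"
    unfolding \<theta>_def case_prod_unfold by (intro continuous_intros sn c)
  \<comment> \<open>A common bound for both speeds yields one Lipschitz constant for all
    intermediate angles.\<close>
  obtain M where M: "M \<ge> 0" "\<And>u. u \<in> {0..1} \<Longrightarrow> \<rho>0 u \<le> M" "\<And>u. u \<in> {0..1} \<Longrightarrow> \<rho>1 u \<le> M"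
  proof -
    have "bdd_above (\<rho>0 ` {0..1})" "bdd_above (\<rho>1 ` {0..1})"
      by (intro bounded_imp_bdd_above compact_imp_bounded compact_continuous_image c; simp)+
    then obtain M1 M2 where "\<forall>u\<in>{0..1}. \<rho>0 u \<le> M1" "\<forall>u\<in>{0..1}. \<rho>1 u \<le> M2"
      unfolding bdd_above_def by blast
    then show thesis by (intro that[of "max 0 (max M1 M2)"]) (auto simp: le_max_iff_disj)
  qed
  have conv: "\<bar>(1 - l) * s + l * t\<bar> \<le> B" if "\<bar>s\<bar> \<le> B" "\<bar>t\<bar> \<le> B" "l \<in> {0..1}" for l s t B :: real
  proof -
    have "\<bar>(1 - l) * s + l * t\<bar> \<le> (1 - l) * \<bar>s\<bar> + l * \<bar>t\<bar>"
      using abs_triangle_ineq[of "(1 - l) * s" "l * t"] that(3) by (simp add: abs_mult)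
    also have "\<dots> \<le> (1 - l) * B + l * B" using that by (intro add_mono mult_left_mono) auto
    finally show ?thesis by (simp add: algebra_simps)
  qed
  have lip: "\<bar>\<theta> l v - \<theta> l u\<bar> \<le> \<kappa> * (M * (v - u))" if l: "l \<in> {0..1}" and uv: "0 \<le> u" "u \<le> v" "v \<le> 1" for l u v
  proof -
    have "\<theta> l v - \<theta> l u = (1 - l) * (\<theta>0 v - \<theta>0 u) + l * (\<theta>1 v - \<theta>1 u)"
      by (simp add: \<theta>_def algebra_simps)
    then show ?thesis
      using conv[OF admissible_lipschitz[OF a0 \<open>\<kappa> \<ge> 0\<close> M(2) uv] admissible_lipschitz[OF a1 \<open>\<kappa> \<ge> 0\<close> M(3) uv] l]
      by simp
  qed
  have pw: "piecewise_C1_on_ivl 0 1 (\<theta> l)" for l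
    unfolding \<theta>_def[abs_def] using a0
    by (intro piecewise_C1_linear_combination[OF _ smooth]) (simp add: admissible_def)
  have turn: "\<theta> l q - \<theta> l p > pi" if l: "l \<in> {0..1}" for l
  proof -
    have "\<theta> l q - \<theta> l p - pi = (1 - l) * (\<theta>0 q - \<theta>0 p - pi) + l * (\<theta>1 q - \<theta>1 p - pi)"
      by (simp add: \<theta>_def algebra_simps)
    moreover have "(1 - l) * (\<theta>0 q - \<theta>0 p - pi) + l * (\<theta>1 q - \<theta>1 p - pi) > 0"
      using l pq by (cases "l = 0") (auto intro!: add_nonneg_pos)
    ultimately show ?thesis by linarith
  qed
  have loc: "\<exists>d \<rho>. d > 0 \<and> continuous_on (({0..1} \<inter> ball a d) \<times> {0..1}) (\<lambda>(l, u). \<rho> l u) \<and>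
      (\<forall>l\<in>{0..1} \<inter> ball a d. admissible \<kappa> (y - x) (\<theta> l) (\<rho> l))" if a: "a \<in> {0..1}" for a
    by (rule admissible_locally[OF \<theta>c pw lip \<open>\<kappa> \<ge> 0\<close> M(1) a pq(1,2) turn[OF a], where w = "y - x"]) blast+
  have ex: "\<exists>\<rho>. admissible \<kappa> (y - x) (\<theta> l) \<rho>" if l: "l \<in> {0..1}" for l
    using loc[OF l] l by (metis IntI centre_in_ball)
  \<comment> \<open>Quantifying over all admissible speeds makes \<open>R\<close> a relation between
    parameters alone. Transitivity then needs an admissible speed at the middle parameter, which
    \<open>ex\<close> supplies.\<close>
  define R where "R a b \<longleftrightarrow> (\<forall>\<rho> \<rho>'. admissible \<kappa> (y - x) (\<theta> a) \<rho> \<longrightarrow> admissible \<kappa> (y - x) (\<theta> b) \<rho>' \<longrightarrow>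
      path_component_of (curve_topology \<kappa> x y) (curve_with x (\<theta> a) \<rho>) (curve_with x (\<theta> b) \<rho>'))" for a b
  have "R 0 1"
  proof (rule connected_equivalence_relation[of "{0..1::real}"])
    fix a b assume "R a b" then show "R b a" unfolding R_def by (blast intro: path_component_of_sym)
  next
    fix a b c :: real assume "R a b" "R b c" "b \<in> {0..1}"
    moreover obtain \<rho> where "admissible \<kappa> (y - x) (\<theta> b) \<rho>" using ex[OF \<open>b \<in> _\<close>] by blast
    ultimately show "R a c" unfolding R_def by (blast intro: path_component_of_trans)
  next
    fix a :: real assume a: "a \<in> {0..1}"
    obtain d \<rho> where d: "d > 0" and \<rho>c: "continuous_on (({0..1} \<inter> ball a d) \<times> {0..1}) (\<lambda>(l, u). \<rho> l u)"
      and adm: "\<And>l. l \<in> {0..1} \<inter> ball a d \<Longrightarrow> admissible \<kappa> (y - x) (\<theta> l) (\<rho> l)"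
      using loc[OF a] by metis
    have "R a b" if b: "b \<in> {0..1} \<inter> ball a d" for b
    proof -
      let ?T = "{0..1} \<inter> ball a d"
      define g where "g t = (1 - t) * a + t * b" for t
      have gT: "g t \<in> ?T" if "t \<in> {0..1}" for t
      proof -
        have "convex ?T" by (intro convex_Int convex_ball) auto
        moreover have "a \<in> ?T" using a d by simp
        ultimately show ?thesis using convexD[of ?T a b "1 - t" t] b that by (simp add: g_def)
      qed
      have gc: "continuous_on ({0..1} \<times> {0..1}) (\<lambda>z. (g (fst z), snd z))"
        unfolding g_def by (intro continuous_intros)
      have "continuous_on ({0..1} \<times> {0..1}) (\<lambda>z. (\<lambda>(l, u). \<theta> l u) (g (fst z), snd z))"
        by (rule continuous_on_compose2[OF \<theta>c gc]) (use gT in force)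
      moreover have "continuous_on ({0..1} \<times> {0..1}) (\<lambda>z. (\<lambda>(l, u). \<rho> l u) (g (fst z), snd z))"
        by (rule continuous_on_compose2[OF \<rho>c gc]) (use gT in force)
      ultimately have "path_component_of (curve_topology \<kappa> x y)
          (curve_with x (\<theta> (g 0)) (\<rho> (g 0))) (curve_with x (\<theta> (g 1)) (\<rho> (g 1)))"
        by (intro curve_with_homotopic[where \<theta> = "\<lambda>t. \<theta> (g t)" and \<rho> = "\<lambda>t. \<rho> (g t)"] adm gT)
          (simp_all add: case_prod_unfold)
      then have mid: "path_component_of (curve_topology \<kappa> x y) (curve_with x (\<theta> a) (\<rho> a)) (curve_with x (\<theta> b) (\<rho> b))"
        by (simp add: g_def)
      have "a \<in> ?T" using a d by simp
      show ?thesis unfolding R_def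
        using curve_with_homotopic_same_angle[OF _ adm[OF \<open>a \<in> ?T\<close>]] mid
          curve_with_homotopic_same_angle[OF adm[OF b]] path_component_of_trans by metis
    qed
    then show "\<exists>T. openin (top_of_set {0..1}) T \<and> a \<in> T \<and> (\<forall>b\<in>T. R a b)"
      using a d by (intro exI[of _ "{0..1} \<inter> ball a d"]) (auto simp: openin_open_Int)
  qed auto
  moreover have "\<theta> 0 = \<theta>0" "\<theta> 1 = \<theta>1" by (auto simp: \<theta>_def)
  ultimately show ?thesis using a0 a1 unfolding R_def by metis
qed

text \<open>The factor 16 makes the value at the midpoint 4, which exceeds \<pi>.\<close>

definition hump :: "real \<Rightarrow> real" where
  "hump u = 16 * u * (1 - u)"

lemma hump_facts:
  shows hump_deriv: "(hump has_real_derivative 16 - 32 * t) (at t)"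
    and hump_lipschitz: "0 \<le> u \<Longrightarrow> u \<le> v \<Longrightarrow> v \<le> 1 \<Longrightarrow> \<bar>hump v - hump u\<bar> \<le> 16 * (v - u)"
    and hump_turn: "hump (1/2) - hump 0 > pi" "hump (1/2) - hump 1 > pi"
proof -
  show "(hump has_real_derivative 16 - 32 * t) (at t)"
    unfolding hump_def[abs_def] by (auto intro!: derivative_eq_intros simp: algebra_simps)
  show "hump (1/2) - hump 0 > pi" "hump (1/2) - hump 1 > pi"
    using pi_less_4 by (auto simp: hump_def)
  assume uv: "0 \<le> u" "u \<le> v" "v \<le> 1"
  have "hump v - hump u = 16 * (v - u) * (1 - u - v)" by (simp add: hump_def algebra_simps)
  then have "\<bar>hump v - hump u\<bar> = 16 * (v - u) * \<bar>1 - u - v\<bar>" using uv by (simp add: abs_mult)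
  also have "\<dots> \<le> 16 * (v - u) * 1" using uv by (intro mult_left_mono) auto
  finally show "\<bar>hump v - hump u\<bar> \<le> 16 * (v - u)" by simp
qed

text \<open>The intermediate linear angle is increasing or decreasing according to the order of \<open>p\<close> and \<open>q\<close>,
  and so steep that it also shares a turn by more than \<open>\<pi>\<close> with one of the halves of the hump.\<close>

lemma curve_with_homotopic_hump:
  assumes \<kappa>: "\<kappa> > 0" and a0: "admissible \<kappa> (y - x) \<theta> \<rho>"
    and h: "admissible \<kappa> (y - x) hump \<rho>'"
    and pq: "p \<in> {0..1}" "q \<in> {0..1}" "\<theta> q - \<theta> p > pi"
  shows "path_component_of (curve_topology \<kappa> x y) (curve_with x \<theta> \<rho>) (curve_with x hump \<rho>')"
proof -
  \<comment> \<open>The gain from \<open>p\<close> to \<open>q\<close> is 8, and since these are at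
    most 1 apart, |C| is at least 8. A half of \<open>{0..1}\<close> then still gives a gain of at
    least 4 > \<pi>, in the direction fixed by the sign of q - p.\<close>
  define C where "C = 8 / (q - p)"
  define \<psi> where "\<psi> u = C * u" for u
  have "p \<noteq> q" using pq(3) pi_gt_zero by auto
  have "\<psi> q - \<psi> p = C * (q - p)" by (simp add: \<psi>_def algebra_simps)
  also have "\<dots> = 8" using \<open>p \<noteq> q\<close> by (metis C_def nonzero_divide_eq_eq right_minus_eq)
  finally have \<psi>pq: "\<psi> q - \<psi> p = 8" .
  have d: "(\<psi> has_real_derivative C) (at t)" for t
    unfolding \<psi>_def[abs_def] by (auto intro!: derivative_eq_intros)
  have "\<bar>\<psi> v - \<psi> u\<bar> \<le> \<kappa> * (\<bar>C\<bar> / \<kappa> * (v - u))" if "0 \<le> u" "u \<le> v" "v \<le> 1" for u v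
    using that \<kappa> by (simp add: \<psi>_def abs_mult flip: right_diff_distrib)
  moreover have "continuous_on {0..1} \<psi>" unfolding \<psi>_def[abs_def] by (intro continuous_intros)
  moreover have "piecewise_C1_on_ivl 0 1 \<psi>" by (rule piecewise_C1_smooth[OF d]) auto
  ultimately obtain \<rho>1 where a1: "admissible \<kappa> (y - x) \<psi> \<rho>1"
    using admissible_exists[of \<psi> \<kappa> "\<bar>C\<bar> / \<kappa>" p q "y - x"] pq \<psi>pq \<kappa> pi_less_4 by auto
  have 1: "path_component_of (curve_topology \<kappa> x y) (curve_with x \<theta> \<rho>) (curve_with x \<psi> \<rho>1)"
    by (rule curve_with_homotopic_common_turn[OF _ a0 a1 d _ pq]) (use \<kappa> \<psi>pq pi_less_4 in auto)
  have c: "continuous_on UNIV (\<lambda>t::real. 16 - 32 * t)" by (intro continuous_intros)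
  have 2: "path_component_of (curve_topology \<kappa> x y) (curve_with x \<psi> \<rho>1) (curve_with x hump \<rho>')"
  proof (cases "p < q")
    case True
    then have "C \<ge> 8" using pq by (simp add: C_def field_simps)
    then have "\<psi> (1/2) - \<psi> 0 > pi" using pi_less_4 by (simp add: \<psi>_def)
    then show ?thesis
      by (intro curve_with_homotopic_common_turn[OF _ a1 h hump_deriv c, of 0 "1/2"]) (use \<kappa> hump_turn in auto)
  next
    case False
    then have "C \<le> - 8" using pq \<open>p \<noteq> q\<close> by (simp add: C_def field_simps)
    then have "\<psi> (1/2) - \<psi> 1 > pi" using pi_less_4 by (simp add: \<psi>_def)
    then show ?thesis
      by (intro curve_with_homotopic_common_turn[OF _ a1 h hump_deriv c, of 1 "1/2"]) (use \<kappa> hump_turn in auto)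
  qed
  from 1 2 show ?thesis by (rule path_component_of_trans)
qed

section \<open>Forward curves as the complement of the class\<close>

lemma unit_deriv_curve_of:
  assumes \<phi>: "angle_fun \<kappa> s \<phi>" and M: "curve_of x s \<phi> \<in> constrained_curves \<kappa> x y" and u: "u \<in> {0..1}"
  shows "unit_deriv (curve_of x s \<phi>) u = s *\<^sub>R dir (\<phi> (s * u))"
proof -
  have s: "s > 0" using \<phi> by (simp add: angle_fun_def)
  have "ivl_deriv 0 s (snd (curve_of x s \<phi>)) (s * u) = dir (\<phi> (s * u))"
    by (intro ivl_derivI[OF s] curve_of_deriv angle_fun_continuous[OF \<phi>])
      (use s u in \<open>auto simp: mult_left_le\<close>)
  then show ?thesis using ivl_deriv_unit_param[OF M u] by (simp add: curve_of_def)
qed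

lemma forward_curve_of_iff:
  assumes \<phi>: "angle_fun \<kappa> s \<phi>" and M: "curve_of x s \<phi> \<in> constrained_curves \<kappa> x y"
  shows "(\<forall>u\<in>{0..1}. 0 < unit_deriv (curve_of x s \<phi>) u \<bullet> dir \<phi>\<^sub>0) \<longleftrightarrow>
    (\<forall>t\<in>{0..s}. 0 < cos (\<phi> t - \<phi>\<^sub>0))"
proof -
  have s: "s > 0" using \<phi> by (simp add: angle_fun_def)
  have "(\<forall>u\<in>{0..1}. 0 < unit_deriv (curve_of x s \<phi>) u \<bullet> dir \<phi>\<^sub>0) \<longleftrightarrow>
      (\<forall>u\<in>{0..1}. 0 < cos (\<phi> (s * u) - \<phi>\<^sub>0))"
    using s by (intro ball_cong) (simp_all add: unit_deriv_curve_of[OF assms] inner_dir_dir zero_less_mult_iff)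
  also have "\<dots> \<longleftrightarrow> (\<forall>t\<in>(\<lambda>u. s * u) ` {0..1}. 0 < cos (\<phi> t - \<phi>\<^sub>0))" by simp
  finally show ?thesis using s by (simp add: image_mult_atLeastAtMost)
qed

theorem theorem4p22:
  fixes \<kappa> r :: real and x y c1 c2 :: "real^2"
  assumes "\<kappa> > 0" and "r = 1 / \<kappa>"
    and "0 < dist x y" and "dist x y < 2 * r"
    and "sphere c1 r \<inter> sphere c2 r = {x, y}"
  shows "{\<sigma> \<in> constrained_curves \<kappa> x y.
            not_in \<sigma> (closure (interior (cball c1 r \<inter> cball c2 r)))} \<in> homotopy_classes \<kappa> x y"
proof -
  note d = assms(3,4) and I = assms(5)
  let ?CC = "constrained_curves \<kappa> x y" and ?X = "curve_topology \<kappa> x y"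
  define K where "K = cball c1 r \<inter> cball c2 r"
  define N where "N = {\<sigma> \<in> ?CC. not_in \<sigma> K}"
  have closure: "closure (interior (cball c1 r \<inter> cball c2 r)) = K"
    unfolding K_def by (rule closure_interior_lens[OF assms(3) I])
  obtain \<phi>\<^sub>0 where \<phi>0: "y - x = dist x y *\<^sub>R dir \<phi>\<^sub>0"
    using real2_eq_dir[of "y - x"] by (metis dist_norm norm_minus_commute)
  define F where "F = {\<sigma> \<in> ?CC. \<forall>u\<in>{0..1}. 0 < unit_deriv \<sigma> u \<bullet> dir \<phi>\<^sub>0}"
  have F_lens: "\<not> not_in \<sigma> K" if "\<sigma> \<in> F" for \<sigma>
  proof -
    have \<sigma>: "\<sigma> \<in> ?CC" using that by (simp add: F_def)
    obtain s \<phi> where \<phi>: "angle_fun \<kappa> s \<phi>" "\<sigma> = curve_of x s \<phi>"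
        and y: "x + integral {0..s} (\<lambda>t. dir (\<phi> t)) = y"
      using constrained_curve_angle[OF \<sigma>] assms(1) by (metis less_imp_le)
    have fwd: "\<And>t. t \<in> {0..s} \<Longrightarrow> 0 < cos (\<phi> t - \<phi>\<^sub>0)"
      using that forward_curve_of_iff[OF \<phi>(1)] \<sigma> by (auto simp: F_def \<phi>(2))
    have "s > 0" using \<phi> by (simp add: angle_fun_def)
    then have "snd (curve_of x s \<phi>) s = y" using y by (simp add: curve_of_def)
    from forward_curve_in_lens[OF assms(1,2) d I \<phi>0 \<phi>(1) this fwd]
    show ?thesis unfolding \<phi>(2) K_def by (auto simp: not_in_def curve_of_def)
  qed
  have turn_N: "curve_with x \<theta> \<rho> \<in> N"
    if a: "admissible \<kappa> (y - x) \<theta> \<rho>" and pq: "p \<in> {0..1}" "q \<in> {0..1}" "\<theta> q - \<theta> p > pi" for \<theta> \<rho> p q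
  proof -
    note \<phi> = angle_fun_arclength_inv[OF a]
    have facts: "continuous_on {0..1} \<rho>" "\<And>u. u \<in> {0..1} \<Longrightarrow> 0 < \<rho> u"
      using a by (auto simp: admissible_def)
    let ?S = "arclength \<rho>"
    have S: "?S u \<in> {0..?S 1}" "arclength_inv \<rho> (?S u) = u" if "u \<in> {0..1}" for u
      using arclength_le_iff[OF facts, of 0 u] arclength_le_iff[OF facts, of u 1] that
        arclength_inv_arclength[OF facts that] by (auto simp: arclength_def[of _ 0])
    obtain u v where uv: "u \<in> {0..?S 1}" "v \<in> {0..?S 1}"
      "2 / \<kappa> \<le> dist (snd (curve_with x \<theta> \<rho>) u) (snd (curve_with x \<theta> \<rho>) v)"
      using long_chord[OF \<phi> assms(1) S(1)[OF pq(1)] S(1)[OF pq(2)]] pq(3)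
      unfolding S(2)[OF pq(1)] S(2)[OF pq(2)] curve_with_def by metis
    have "not_in (curve_with x \<theta> \<rho>) K"
    proof (rule ccontr)
      assume "\<not> ?thesis"
      then have "snd (curve_with x \<theta> \<rho>) t \<in> K" if "t \<in> {0..?S 1}" for t
        using that by (auto simp: not_in_def curve_with_def curve_of_def)
      then have "dist (snd (curve_with x \<theta> \<rho>) u) (snd (curve_with x \<theta> \<rho>) v) < 2 * r"
        using lens_diameter[OF d I] uv by (simp add: K_def)
      then show False using uv(3) assms(2) by simp
    qed
    then show ?thesis using curve_with_constrained[OF a] by (simp add: N_def)
  qed
  \<comment> \<open>The contrapositive of \<open>small_turn_forward\<close>: a curve that fails to
    advance somewhere has an angle that varies by more than \<pi>.\<close>
  have turn: "\<exists>\<theta> \<rho> p q. \<sigma> = curve_with x \<theta> \<rho> \<and> admissible \<kappa> (y - x) \<theta> \<rho> \<and>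
      p \<in> {0..1} \<and> q \<in> {0..1} \<and> \<theta> q - \<theta> p > pi" if \<sigma>: "\<sigma> \<in> ?CC" "\<sigma> \<notin> F" for \<sigma>
  proof -
    obtain \<theta> \<rho> where a: "admissible \<kappa> (y - x) \<theta> \<rho>" and eq: "\<sigma> = curve_with x \<theta> \<rho>"
      using curve_with_surj[OF \<sigma>(1)] assms(1) by (metis less_imp_le)
    note \<phi> = angle_fun_arclength_inv[OF a]
    have facts: "continuous_on {0..1} \<rho>" "\<And>u. u \<in> {0..1} \<Longrightarrow> 0 < \<rho> u"
      using a by (auto simp: admissible_def)
    let ?S = "arclength \<rho>"
    have \<tau>: "arclength_inv \<rho> t \<in> {0..1}" if "t \<in> {0..?S 1}" for t
      using arclength_inv_in(1)[OF facts, of 0 1 t] that by (auto simp: arclength_def[of _ 0])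
    have "\<exists>p\<in>{0..1}. \<exists>q\<in>{0..1}. \<theta> q - \<theta> p > pi"
    proof (rule ccontr)
      assume "\<not> ?thesis"
      then have osc: "\<theta> (arclength_inv \<rho> t') - \<theta> (arclength_inv \<rho> t) \<le> pi"
        if "t \<in> {0..?S 1}" "t' \<in> {0..?S 1}" for t t'
        using \<tau>[OF that(1)] \<tau>[OF that(2)] by force
      have "snd (curve_with x \<theta> \<rho>) (?S 1) = y"
        using \<sigma>(1) eq by (auto simp: constrained_curves_def curve_with_def curve_of_def)
      then have w: "snd (curve_of x (?S 1) (\<lambda>t. \<theta> (arclength_inv \<rho> t))) (?S 1) - x = dist x y *\<^sub>R dir \<phi>\<^sub>0"
        using \<phi>0 by (simp add: curve_with_def)
      have "dist x y < 2 / \<kappa>" using d assms(2) by simp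
      then have "\<forall>t\<in>{0..?S 1}. 0 < cos (\<theta> (arclength_inv \<rho> t) - \<phi>\<^sub>0)"
        using small_turn_forward[OF \<phi> assms(1) w d(1)] osc by blast
      then have "\<sigma> \<in> F"
        using forward_curve_of_iff[OF \<phi>, of x y] \<sigma>(1) unfolding eq curve_with_def F_def by blast
      then show False using \<sigma>(2) by simp
    qed
    then show ?thesis using a eq by blast
  qed
  \<comment> \<open>A class is nonempty, so a member has to be exhibited; 16 / \<kappa> matches the
    Lipschitz constant 16 of the hump.\<close>
  obtain \<rho> where h: "admissible \<kappa> (y - x) hump \<rho>"
  proof (rule admissible_exists[of hump \<kappa> "16 / \<kappa>" 0 "1/2" "y - x"])
    show "continuous_on {0..1} hump" unfolding hump_def[abs_def] by (intro continuous_intros)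
    show "piecewise_C1_on_ivl 0 1 hump"
      by (rule piecewise_C1_smooth[OF hump_deriv]) (intro continuous_intros)
  qed (use assms(1) hump_lipschitz hump_turn in auto)
  define \<gamma> where "\<gamma> = curve_with x hump \<rho>"
  have "\<gamma> \<in> N" unfolding \<gamma>_def by (rule turn_N[OF h, of 0 "1/2"]) (use hump_turn in auto)
  have \<gamma>top: "\<gamma> \<in> topspace ?X" using \<open>\<gamma> \<in> N\<close> by (simp add: N_def topspace_curve_topology)
  \<comment> \<open>The implications close up: forward curves stay in the lens, the others turn by
    more than \<pi>, and such a turn leaves the lens.\<close>
  have NF: "N = ?CC - F" using F_lens turn turn_N by (fastforce simp: N_def)
  have "openin ?X N" unfolding N_def K_def by (intro openin_not_in closed_Int closed_cball)
  moreover have "openin ?X F" unfolding F_def by (rule openin_forward) simp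
  then have "closedin ?X N" unfolding NF by (metis closedin_diff closedin_topspace topspace_curve_topology)
  \<comment> \<open>A connected set meeting a clopen set lies inside it, so the path component of
    \<gamma> cannot leave \<open>N\<close>.\<close>
  ultimately have clopen: "C \<subseteq> N \<or> disjnt C N" if "connectedin ?X C" for C
    using connectedin_clopen_cases[OF that] by blast
  have "N = Collect (path_component_of ?X \<gamma>)"
  proof (intro set_eqI iffI)
    fix \<sigma> assume "\<sigma> \<in> N"
    then obtain \<theta> \<rho>' p q where "\<sigma> = curve_with x \<theta> \<rho>'" "admissible \<kappa> (y - x) \<theta> \<rho>'"
      "p \<in> {0..1}" "q \<in> {0..1}" "\<theta> q - \<theta> p > pi" using turn NF by blast
    then have "path_component_of ?X \<sigma> \<gamma>"
      using curve_with_homotopic_hump[OF assms(1) _ h] unfolding \<gamma>_def by blast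
    then show "\<sigma> \<in> Collect (path_component_of ?X \<gamma>)" by (simp add: path_component_of_sym)
  next
    fix \<sigma> assume "\<sigma> \<in> Collect (path_component_of ?X \<gamma>)"
    moreover have "connectedin ?X (Collect (path_component_of ?X \<gamma>))"
      by (intro path_connectedin_imp_connectedin path_connectedin_path_component_of)
    moreover have "\<gamma> \<in> Collect (path_component_of ?X \<gamma>)" using \<gamma>top by (simp add: path_component_of_refl)
    ultimately show "\<sigma> \<in> N" using clopen \<open>\<gamma> \<in> N\<close> by (meson disjnt_iff subsetD)
  qed
  with \<gamma>top have "N \<in> homotopy_classes \<kappa> x y"
    unfolding homotopy_classes_eq path_components_of_def by blast
  then show ?thesis unfolding closure N_def .
qed

end
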